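(* Let $d\ge 2$ and let $P_n$ be the spherical convex hull of $n\ge d+1$ independent uniform random points on the closed halfsphere $\mathbb{S}_e^+\subset\mathbb{S}^d$. Then $$\mathbb{E}\, f_{d-1}(P_n)=\frac{2\omega_d}{\omega_{d+1}}\binom{n}{d}\int_0^\pi\left(1-\frac{\alpha}{\pi}\right)^{n-d}\sin^{d-1}\alpha\,\mathrm{d}\alpha .$$ Further, $$\lim_{n\to\infty}\mathbb{E}\, f_{d-1}(P_n)=2^{-d}\,d!\,\kappa_d^2 .$$
   Context: $d\ge 2$ is an integer; $\mathbb{S}^d$ is the unit sphere of $\mathbb{R}^{d+1}$ with standard scalar product $\langle\cdot,\cdot\rangle$; $\sigma$ is the spherical Lebesgue measure on $\mathbb{S}^d$. For $k\ge 1$, $\omega_k=2\pi^{k/2}/\Gamma(k/2)$ (so $\omega_{d+1}=\sigma(\mathbb{S}^d)$) and $\kappa_k=\omega_k/k$ is the volume of the unit ball in $\mathbb{R}^k$. Fix $e\in\mathbb{S}^d$; $\mathbb{S}_e^+=\{u\in\mathbb{S}^d:\langle u,e\rangle\ge 0\}$, and $\mu=\frac{2}{\omega_{d+1}}\,\sigma$ restricted to $\mathbb{S}_e^+$ is the uniform probability measure on $\mathbb{S}_e^+$. Let $X_1,\dots,X_n$ be independent random points in $\mathbb{S}_e^+$, each with distribution $\mu$, and $P_n=\mathrm{conv}_s\{X_1,\dots,X_n\}$, where $\mathrm{conv}_s(A)=\mathbb{S}^d\cap\mathrm{pos}\,A$ and $\mathrm{pos}$ denotes the positive hull in $\mathbb{R}^{d+1}$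 (the set of all finite linear combinations with nonnegative coefficients). A spherical polytope is an intersection $C\cap\mathbb{S}^d$ with $C$ a pointed closed convex polyhedral cone in $\mathbb{R}^{d+1}$; its $k$-dimensional faces are the intersections with $\mathbb{S}^d$ of the $(k+1)$-dimensional faces of $C$, and $f_k(P)$ is the number of $k$-dimensional faces of $P$. Almost surely $P_n$ is a spherical polytope. *)

theory Defs
  imports "HOL-Probability.Probability"
begin

definition omega :: "nat \<Rightarrow> real" where
  "omega k = 2 * pi powr (real k / 2) / Gamma (real k / 2)"

definition kappa :: "nat \<Rightarrow> real" where
  "kappa k = omega k / real k"

text \<open>
  Spherical Lebesgue measure on the unit sphere, as the image of Lebesgue measure on the punctured
  unit ball under central projection, normalised by the dimension of the ambient space. Lemma
  \<open>emeasure_sphere_measure\<close> gives the usual description by means of the cone over a set.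
\<close>

definition sphere_measure :: "'a::euclidean_space measure" where
  "sphere_measure = scale_measure (of_nat DIM('a))
     (distr (restrict_space lborel (cball 0 1 - {0})) (restrict_space borel (sphere 0 1)) sgn)"

lemma sgn_measurable_sphere:
  "sgn \<in> restrict_space lborel (cball 0 1 - {0}) \<rightarrow>\<^sub>M
     restrict_space borel (sphere (0::'a::euclidean_space) 1)"
proof (rule measurable_restrict_space2)
  show "sgn \<in> space (restrict_space lborel (cball 0 1 - {0})) \<rightarrow> sphere (0::'a) 1"
    by (auto simp: space_restrict_space norm_sgn)
  have "continuous_on (cball 0 1 - {0::'a}) sgn"
    by (auto intro!: continuous_intros)
  then show "sgn \<in> restrict_space lborel (cball 0 1 - {0::'a}) \<rightarrow>\<^sub>M borel"
    by (subst measurable_cong_sets[OF sets_restrict_space_cong[OF sets_lborel] refl])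
       (rule borel_measurable_continuous_on_restrict)
qed

lemma emeasure_sphere_measure:
  fixes A :: "'a::euclidean_space set"
  assumes A: "A \<in> sets borel" "A \<subseteq> sphere 0 1"
  shows "emeasure sphere_measure A =
    of_nat DIM('a) * emeasure lborel {t *\<^sub>R u | t u. 0 \<le> t \<and> t \<le> 1 \<and> u \<in> A}"
proof -
  let ?B = "cball 0 1 - {0::'a}"
  let ?C = "{t *\<^sub>R u | t u. 0 \<le> t \<and> t \<le> 1 \<and> u \<in> A}"
  let ?R = "restrict_space lborel ?B"
  have A': "A \<in> sets (restrict_space borel (sphere 0 1))"
    using A by (auto simp: sets_restrict_space_iff)
  have eq: "sgn -` A \<inter> ?B = ?C - {0}"
  proof (intro equalityI subsetI)
    fix x assume x: "x \<in> sgn -` A \<inter> ?B"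
    then have "x = norm x *\<^sub>R sgn x"
      by (simp add: sgn_div_norm)
    then have "x \<in> ?C"
      using x by (intro CollectI exI[of _ "norm x"] exI[of _ "sgn x"]) auto
    then show "x \<in> ?C - {0}"
      using x by blast
  next
    fix x assume "x \<in> ?C - {0}"
    then obtain t u where tu: "x = t *\<^sub>R u" "0 \<le> t" "t \<le> 1" "u \<in> A" "x \<noteq> 0"
      by auto
    then have u: "norm u = 1" and "t > 0"
      using A by (auto simp: order_less_le)
    then have "sgn x = u"
      by (simp add: tu(1) sgn_scaleR sgn_div_norm)
    then show "x \<in> sgn -` A \<inter> ?B"
      using tu u by auto
  qed
  have "sgn -` A \<inter> ?B \<in> sets ?R"
    using measurable_sets[OF sgn_measurable_sphere A'] by (simp add: space_restrict_space)
  then have meas: "?C - {0} \<in> sets lborel"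
    unfolding eq by (subst (asm) sets_restrict_space_iff) auto
  have "emeasure lborel (?C - {0}) = emeasure lborel ?C"
  proof (cases "0 \<in> ?C")
    case True
    then have "?C = insert 0 (?C - {0})" by blast
    then have "?C \<in> sets lborel"
      using sets.Un[OF meas, of "{0}"] by (simp add: insert_absorb)
    then show ?thesis
      by (intro emeasure_Diff_null_set) (auto intro: finite_imp_null_set_lborel)
  qed simp
  moreover have "emeasure (distr ?R (restrict_space borel (sphere 0 1)) sgn) A =
      emeasure lborel (?C - {0})"
    by (subst emeasure_distr[OF sgn_measurable_sphere A'], subst emeasure_restrict_space)
       (simp_all add: space_restrict_space eq[symmetric])
  ultimately show ?thesis
    by (simp add: sphere_measure_def emeasure_scale_measure)
qed

lemma emeasure_sphere_measure_sphere:
  "emeasure sphere_measure (sphere (0::'a::euclidean_space) 1) = ennreal (omega DIM('a))"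
proof -
  have "{t *\<^sub>R u | t u. 0 \<le> t \<and> t \<le> 1 \<and> u \<in> sphere (0::'a) 1} = cball 0 1"
  proof (intro equalityI subsetI)
    fix x :: 'a assume x: "x \<in> cball 0 1"
    show "x \<in> {t *\<^sub>R u | t u. 0 \<le> t \<and> t \<le> 1 \<and> u \<in> sphere (0::'a) 1}"
    proof (cases "x = 0")
      case True
      obtain u :: 'a where "u \<in> Basis" using nonempty_Basis by blast
      then show ?thesis
        using True by (intro CollectI exI[of _ "0::real"] exI[of _ u]) auto
    next
      case False
      then have "x = norm x *\<^sub>R sgn x" "norm (sgn x) = 1"
        by (simp_all add: sgn_div_norm)
      then show ?thesis
        using x by (intro CollectI exI[of _ "norm x"] exI[of _ "sgn x"]) auto
    qed
  qed auto
  moreover have "real DIM('a) * unit_ball_vol (real DIM('a)) = omega DIM('a)"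
  proof -
    define x where "x = real DIM('a) / 2"
    have x: "x > 0" by (simp add: x_def)
    then have "x \<notin> \<int>\<^sub>\<le>\<^sub>0" using nonpos_Ints_nonpos[of x] by auto
    then have "Gamma (x + 1) = x * Gamma x" by (rule Gamma_plus1)
    then have "2 * x * (pi powr x / Gamma (x + 1)) = 2 * pi powr x / Gamma x"
      using x Gamma_real_pos[OF x] by (simp add: field_simps)
    then show ?thesis
      by (simp add: unit_ball_vol_def omega_def x_def)
  qed
  ultimately show ?thesis
    by (simp add: emeasure_sphere_measure emeasure_cball ennreal_of_nat_eq_real_of_nat
        flip: ennreal_mult)
qed

definition halfsphere :: "'a::euclidean_space \<Rightarrow> 'a set" where
  "halfsphere e = {u \<in> sphere 0 1. 0 \<le> u \<bullet> e}"

definition halfsphere_uniform :: "'a::euclidean_space \<Rightarrow> 'a measure" where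
  "halfsphere_uniform e =
     scale_measure (ennreal (2 / omega DIM('a))) (restrict_space sphere_measure (halfsphere e))"

definition pos_hull :: "'a::real_vector set \<Rightarrow> 'a set" where
  "pos_hull A = {\<Sum>x\<in>F. c x *\<^sub>R x | F c. finite F \<and> F \<subseteq> A \<and> (\<forall>x\<in>F. 0 \<le> c x)}"

definition sph_hull :: "'a::euclidean_space set \<Rightarrow> 'a set" where
  "sph_hull A = sphere 0 1 \<inter> pos_hull A"

definition pointed_polyhedral_cone :: "'a::euclidean_space set \<Rightarrow> bool" where
  "pointed_polyhedral_cone C \<longleftrightarrow> polyhedron C \<and> convex_cone C \<and> C \<inter> uminus ` C = {0}"

text \<open>
  If \<open>P\<close> is not a spherical polytope then it has no faces in the sense of \<open>sph_face\<close>,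
  so \<open>f_number k P = 0\<close>.
\<close>

definition sph_face :: "nat \<Rightarrow> 'a::euclidean_space set \<Rightarrow> 'a set \<Rightarrow> bool" where
  "sph_face k F P \<longleftrightarrow>
     (\<exists>C G. pointed_polyhedral_cone C \<and> P = C \<inter> sphere 0 1 \<and>
        G face_of C \<and> aff_dim G = int (k + 1) \<and> F = G \<inter> sphere 0 1)"

definition f_number :: "nat \<Rightarrow> 'a::euclidean_space set \<Rightarrow> nat" where
  "f_number k P = card {F. sph_face k F P}"

definition iid_halfsphere ::
    "'a::euclidean_space \<Rightarrow> nat \<Rightarrow> 'b measure \<Rightarrow> (nat \<Rightarrow> 'b \<Rightarrow> 'a) \<Rightarrow> bool" where
  "iid_halfsphere e n M X \<longleftrightarrow>
     prob_space M \<and>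
     prob_space.indep_vars M (\<lambda>_. halfsphere_uniform e) X {1..n} \<and>
     (\<forall>i\<in>{1..n}. distr M (halfsphere_uniform e) (X i) = halfsphere_uniform e)"

definition random_polytope :: "nat \<Rightarrow> (nat \<Rightarrow> 'b \<Rightarrow> 'a::euclidean_space) \<Rightarrow> 'b \<Rightarrow> 'a set" where
  "random_polytope n X w = sph_hull ((\<lambda>i. X i w) ` {1..n})"

end

theory Submission
  imports Defs
begin

text \<open>
  Almost surely the facets of $P_n$ correspond to the $d$-subsets of the sample whose linear span
  has all other sample points on one of its two sides. Given the span, with unit normal $u$ at angle
  $\alpha$ to $e$, the two sides have $\mu$-measure $1 - \alpha/\pi$ and $\alpha/\pi$, because the
  measure of a lune is additive, hence linear, in its opening angle. Replacing some sample points
  by their antipodes does not change the span, so for the law of $u$ the points may be taken uniform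
  on the whole sphere; then $\pm u$ is rotation invariant and averaging over rotations replaces it
  by a uniform direction, whose angle to $e$ has density proportional to $\sin^{d-1}\alpha$.

  A uniform point of the sphere is the direction of a uniform point of the unit ball, which reduces
  all computations to Lebesgue measure. For the limit, the integral is compared with Beta integrals.
\<close>

section \<open>The uniform distribution on the ball\<close>

text \<open>The obstacle is to give the normal \<open>u\<close> a law without conditional
  distributions or integration over the sphere. The span of \<open>d\<close> points is therefore
  represented by \<open>normal_vec\<close>, a generalised cross product: it is polynomial in the
  points, hence measurable, and scaling the points by nonzero factors scales it by a nonzero factor.
  Normalising points of the ball and flipping them into the halfsphere are such scalings, and the
  quantities evaluated at the normal (\<open>cap_angle\<close>, \<open>lune_weight\<close>) ignore
  nonzero factors. So raw points of the ball may stand for the \<open>d\<close> spanning points, and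
  conditioning on the span becomes Fubini over their coordinates. Since the sign of a normal is
  arbitrary, angles are folded to [0, pi/2]. Folding doubles the density, whence the 2 in
  \<open>2 * omega d / omega (d + 1)\<close>, and the two sides of the hyperplane unfold it again to
  a single power integrated over [0, pi]. In the limit, Legendre's duplication formula makes
  \<open>omega d * omega (d + 1)\<close> elementary, which removes \<open>omega (d + 1)\<close> and
  leaves a square.\<close>

lemma orthogonal_transformation_borel_measurable:
  fixes f :: "'a::euclidean_space \<Rightarrow> 'a"
  assumes "orthogonal_transformation f"
  shows "f \<in> borel_measurable borel"
  using assms
  by (intro borel_measurable_continuous_onI linear_continuous_on)
     (auto simp: orthogonal_transformation_linear linear_conv_bounded_linear[symmetric])

lemma nn_integral_lborel_translate:
  fixes g :: "'a::euclidean_space \<Rightarrow> ennreal"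
  assumes [measurable]: "g \<in> borel_measurable borel"
  shows "(\<integral>\<^sup>+x. g (c + x) \<partial>lborel) = (\<integral>\<^sup>+x. g x \<partial>lborel)"
proof -
  have "(\<integral>\<^sup>+x. g x \<partial>lborel) = (\<integral>\<^sup>+x. g x \<partial>distr lborel borel ((+) c))"
    by (simp add: lborel_distr_plus)
  also have "\<dots> = (\<integral>\<^sup>+x. g (c + x) \<partial>lborel)"
    by (subst nn_integral_distr) auto
  finally show ?thesis by simp
qed

text \<open>The uniqueness argument for translation invariant measures: both measures agree on the ball.\<close>
lemma lborel_distr_orthogonal:
  fixes f :: "'a::euclidean_space \<Rightarrow> 'a"
  assumes f: "orthogonal_transformation f"
  shows "distr lborel borel f = lborel"
proof (rule measure_eqI)
  fix A assume "A \<in> sets (distr lborel borel f)"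
  then have A [measurable]: "A \<in> sets borel" by simp
  note [measurable] = orthogonal_transformation_borel_measurable[OF f]
  define h where "h = inv f"
  have h: "orthogonal_transformation h"
    unfolding h_def by (rule orthogonal_transformation_inv[OF f])
  note [measurable] = orthogonal_transformation_borel_measurable[OF h]
  have fh: "f (h x) = x" "h (f x) = x" for x
    using orthogonal_transformation_bij[OF f] unfolding h_def
    by (auto simp: bij_is_surj bij_is_inj surj_f_inv_f)
  have lin: "f (x + y) = f x + f y" for x y
    using f by (simp add: orthogonal_transformation_linear linear_add)
  have nf: "norm (f x) = norm x" for x
    using f by (rule orthogonal_transformation_norm)
  let ?B = "cball 0 1 :: 'a set"
  have [measurable]: "?B \<in> sets borel" by simp
  have [measurable]: "(\<lambda>p. f (fst p)) \<in> borel_measurable (lborel \<Otimes>\<^sub>M lborel)"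
    "(\<lambda>p. f (snd p)) \<in> borel_measurable (lborel \<Otimes>\<^sub>M lborel)"
    "(\<lambda>p. h (fst p)) \<in> borel_measurable (lborel \<Otimes>\<^sub>M lborel)"
    "(\<lambda>p. h (snd p)) \<in> borel_measurable (lborel \<Otimes>\<^sub>M lborel)"
    using orthogonal_transformation_borel_measurable[OF f] orthogonal_transformation_borel_measurable[OF h]
    by (auto intro: measurable_compose[rotated])
  \<comment> \<open>The product of the two volumes is a double integral over \<open>x\<close> and
    \<open>y\<close>; evaluating it in two orders moves \<open>f\<close> from the shift of
    \<open>A\<close> to the argument of its indicator.\<close>
  have "emeasure lborel A * emeasure lborel ?B
      = (\<integral>\<^sup>+y. indicator ?B y * (\<integral>\<^sup>+x. indicator A x \<partial>lborel) \<partial>lborel)"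
    by (subst nn_integral_multc) (auto simp: mult.commute intro!: borel_measurable_indicator)
  also have "\<dots> = (\<integral>\<^sup>+y. indicator ?B y * (\<integral>\<^sup>+x. indicator A (f y + x) \<partial>lborel) \<partial>lborel)"
    by (subst nn_integral_lborel_translate[where g = "indicator A"]) auto
  also have "\<dots> = (\<integral>\<^sup>+y. (\<integral>\<^sup>+x. indicator ?B y * indicator A (f y + x) \<partial>lborel) \<partial>lborel)"
    by (subst nn_integral_cmult) auto
  also have "\<dots> = (\<integral>\<^sup>+x. (\<integral>\<^sup>+y. indicator ?B y * indicator A (f y + x) \<partial>lborel) \<partial>lborel)"
    by (rule lborel_pair.Fubini') measurable
  \<comment> \<open>Shifting \<open>y\<close> by \<open>- h x\<close> cancels the summand
    \<open>x\<close> inside \<open>A\<close>, because \<open>f (h x) = x\<close>.\<close>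
  also have "\<dots> = (\<integral>\<^sup>+x. (\<integral>\<^sup>+y. indicator ?B (- h x + y) * indicator A (f y) \<partial>lborel) \<partial>lborel)"
  proof (rule nn_integral_cong)
    fix x
    have "(\<integral>\<^sup>+y. indicator ?B y * indicator A (f y + x) \<partial>lborel)
        = (\<integral>\<^sup>+y. indicator ?B (- h x + y) * indicator A (f (- h x + y) + x) \<partial>lborel)"
      by (subst nn_integral_lborel_translate) auto
    moreover have "f (- h x + y) + x = f y" for y
      using lin[of "h x" "- h x + y"] fh by simp
    ultimately show "(\<integral>\<^sup>+y. indicator ?B y * indicator A (f y + x) \<partial>lborel)
        = (\<integral>\<^sup>+y. indicator ?B (- h x + y) * indicator A (f y) \<partial>lborel)" by simp
  qed
  also have "\<dots> = (\<integral>\<^sup>+y. (\<integral>\<^sup>+x. indicator ?B (- h x + y) * indicator A (f y) \<partial>lborel) \<partial>lborel)"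
    by (rule lborel_pair.Fubini') measurable
  also have "\<dots> = (\<integral>\<^sup>+y. emeasure lborel ?B * indicator A (f y) \<partial>lborel)"
  proof (rule nn_integral_cong)
    fix y
    \<comment> \<open>For fixed \<open>y\<close> the admissible \<open>x\<close> form a ball around
      \<open>f y\<close>, whose volume does not depend on \<open>y\<close>.\<close>
    have "(indicator ?B (- h x + y) :: ennreal) = indicator ?B (- f y + x)" for x
    proof -
      have "norm (- h x + y) = norm (f (- h x + y))" by (simp add: nf)
      also have "f (- h x + y) = - (- f y + x)"
        using lin[of "h x" "- h x + y"] fh(1)[of x] by (simp add: algebra_simps)
      finally show ?thesis using norm_minus_commute[of x "f y"] by (simp add: indicator_def)
    qed
    then have "(\<integral>\<^sup>+x. indicator ?B (- h x + y) * indicator A (f y) \<partial>lborel)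
      = (\<integral>\<^sup>+x. indicator ?B (- f y + x) \<partial>lborel) * indicator A (f y)"
      by (simp add: nn_integral_multc)
    also have "(\<integral>\<^sup>+x. indicator ?B (- f y + x) \<partial>lborel) = (\<integral>\<^sup>+x. indicator ?B x \<partial>lborel)"
      by (rule nn_integral_lborel_translate) auto
    finally show "(\<integral>\<^sup>+x. indicator ?B (- h x + y) * indicator A (f y) \<partial>lborel)
       = emeasure lborel ?B * indicator A (f y)" by simp
  qed
  also have "\<dots> = emeasure lborel ?B * (\<integral>\<^sup>+y. indicator A (f y) \<partial>lborel)"
    by (rule nn_integral_cmult) measurable
  also have "(\<integral>\<^sup>+y. indicator A (f y) \<partial>lborel) = emeasure (distr lborel borel f) A"
    by (subst nn_integral_indicator[symmetric], simp, subst nn_integral_distr) auto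
  finally have "emeasure lborel ?B * emeasure lborel A
      = emeasure lborel ?B * emeasure (distr lborel borel f) A"
    by (simp add: mult.commute)
  moreover have "emeasure lborel ?B \<noteq> 0" "emeasure lborel ?B \<noteq> top"
    using unit_ball_vol_pos[of "real DIM('a)"]
    by (simp_all add: emeasure_cball del: unit_ball_vol_pos)
  ultimately show "emeasure (distr lborel borel f) A = emeasure lborel A"
    by (simp add: ennreal_mult_cancel_left)
qed simp

definition ball_measure :: "'a::euclidean_space measure" where
  "ball_measure = uniform_measure lborel (cball 0 1)"

lemma sets_ball_measure [simp, measurable_cong]: "sets ball_measure = sets borel"
  by (simp add: ball_measure_def)

lemma space_ball_measure [simp]: "space ball_measure = UNIV"
  by (simp add: ball_measure_def)

lemma emeasure_unit_cball:
  "emeasure lborel (cball (0::'a::euclidean_space) 1) = ennreal (unit_ball_vol DIM('a))"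
  by (simp add: emeasure_cball)

lemma prob_space_ball_measure: "prob_space (ball_measure :: 'a::euclidean_space measure)"
  unfolding ball_measure_def
  using unit_ball_vol_pos[of "real DIM('a)"]
  by (intro prob_space_uniform_measure) (simp_all add: emeasure_unit_cball del: unit_ball_vol_pos)

lemma ball_measure_null:
  assumes "A \<in> null_sets lborel"
  shows "A \<in> null_sets ball_measure"
proof -
  have [measurable]: "A \<in> sets borel" using assms by (auto simp: null_sets_def)
  have "emeasure lborel (cball 0 1 \<inter> A) \<le> emeasure lborel A"
    by (intro emeasure_mono) auto
  then have "emeasure lborel (cball 0 1 \<inter> A) = 0" using assms by (auto simp: null_sets_def)
  then show ?thesis
    by (auto simp: null_sets_def ball_measure_def)
qed

lemma ball_measure_hyperplane:
  assumes "w \<noteq> (0::'a::euclidean_space)"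
  shows "{y. w \<bullet> y = 0} \<in> null_sets ball_measure"
proof (rule ball_measure_null)
  have "negligible {y. w \<bullet> y = 0}" using assms by (intro negligible_hyperplane) auto
  then have "{y. w \<bullet> y = 0} \<in> null_sets lebesgue" by (simp add: negligible_iff_null_sets)
  moreover have "{y. w \<bullet> y = 0} \<in> sets borel" by measurable
  ultimately show "{y. w \<bullet> y = 0} \<in> null_sets lborel"
    by (simp add: null_sets_completion_iff)
qed

lemma ball_measure_distr_orthogonal:
  fixes f :: "'a::euclidean_space \<Rightarrow> 'a"
  assumes f: "orthogonal_transformation f"
  shows "distr ball_measure borel f = ball_measure"
proof (rule measure_eqI)
  note [measurable] = orthogonal_transformation_borel_measurable[OF f]
  fix A assume "A \<in> sets (distr (ball_measure :: 'a measure) borel f)"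
  then have A [measurable]: "A \<in> sets borel" by simp
  have nf: "norm (f x) = norm x" for x
    using f by (rule orthogonal_transformation_norm)
  have "emeasure (distr ball_measure borel f) A = emeasure (ball_measure :: 'a measure) (f -` A)"
    by (subst emeasure_distr) simp_all
  also have "\<dots> = emeasure lborel (cball 0 1 \<inter> f -` A) / emeasure lborel (cball (0::'a) 1)"
    unfolding ball_measure_def using measurable_sets_borel[OF orthogonal_transformation_borel_measurable[OF f] A]
    by (subst emeasure_uniform_measure) auto
  also have "cball 0 1 \<inter> f -` A = f -` (cball 0 1 \<inter> A)"
    by (auto simp: nf)
  also have "emeasure lborel \<dots> = emeasure (distr lborel borel f) (cball 0 1 \<inter> A)"
    by (subst emeasure_distr) auto
  also have "\<dots> = emeasure lborel (cball 0 1 \<inter> A)"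
    by (simp add: lborel_distr_orthogonal[OF f])
  also have "\<dots> / emeasure lborel (cball (0::'a) 1) = emeasure ball_measure A"
    by (simp add: ball_measure_def)
  finally show "emeasure (distr ball_measure borel f) A = emeasure ball_measure A" .
qed simp

section \<open>Hyperplane reflections as a source of isometries\<close>

definition hyperplane_reflection :: "'a::euclidean_space \<Rightarrow> 'a \<Rightarrow> 'a" where
  "hyperplane_reflection v x = x - (2 * (x \<bullet> v) / (v \<bullet> v)) *\<^sub>R v"

lemma orthogonal_transformation_hyperplane_reflection: "orthogonal_transformation (hyperplane_reflection v)"
proof -
  have "linear (hyperplane_reflection v)"
    by (rule linearI) (simp_all add: hyperplane_reflection_def inner_add_left add_divide_distrib
        distrib_left scaleR_add_left scaleR_diff_right)
  moreover have "hyperplane_reflection v x \<bullet> hyperplane_reflection v y = x \<bullet> y" for x y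
  proof (cases "v = 0")
    case False
    then have "(x - a *\<^sub>R v) \<bullet> (y - b *\<^sub>R v) = x \<bullet> y - b * (x \<bullet> v) - a * (y \<bullet> v) + a * b * (v \<bullet> v)" for a b
      by (simp add: inner_diff_left inner_diff_right inner_commute)
    from this[of "2 * (x \<bullet> v) / (v \<bullet> v)" "2 * (y \<bullet> v) / (v \<bullet> v)"] False show ?thesis
      by (simp add: hyperplane_reflection_def field_simps)
  qed (simp add: hyperplane_reflection_def)
  ultimately show ?thesis by (simp add: orthogonal_transformation_def)
qed

text \<open>Equal norms give \<open>(p - q) \<bullet> (p - q) = 2 * (p \<bullet> (p - q))\<close>,
  so the coefficient in the reflection is 1. For \<open>p = q\<close> the subtracted multiple is 0
  and the reflection is the identity.\<close>

lemma hyperplane_reflection_diff: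
  assumes "norm p = norm q"
  shows "hyperplane_reflection (p - q) p = q"
proof (cases "p = q")
  case False
  have "p \<bullet> p = q \<bullet> q" using assms by (simp add: norm_eq_sqrt_inner)
  then have "(p - q) \<bullet> (p - q) = 2 * (p \<bullet> (p - q))"
    by (simp add: inner_diff_left inner_diff_right inner_commute)
  moreover have "(p - q) \<bullet> (p - q) \<noteq> 0" using False by simp
  ultimately show ?thesis by (simp add: hyperplane_reflection_def)
qed (simp add: hyperplane_reflection_def)

section \<open>The halfsphere as an image of the ball\<close>

text \<open>Directions below the equator are replaced by their antipodes, so the halfsphere is
  covered twice. The value \<open>e\<close> at 0 keeps the map inside \<open>halfsphere e\<close>
  everywhere, as a map into a restricted space must be.\<close>

definition half_sgn :: "'a::euclidean_space \<Rightarrow> 'a \<Rightarrow> 'a" where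
  "half_sgn e y = (if y = 0 then e else if 0 \<le> y \<bullet> e then sgn y else - sgn y)"

lemma borel_measurable_sgn_euclidean [measurable]:
  "(sgn :: 'a::euclidean_space \<Rightarrow> 'a) \<in> borel_measurable borel"
proof -
  have "(\<lambda>x::'a. x /\<^sub>R norm x) \<in> borel_measurable borel" by measurable
  then show ?thesis by (simp add: sgn_div_norm[abs_def])
qed

lemma half_sgn_measurable [measurable]: "half_sgn e \<in> borel_measurable borel"
  unfolding half_sgn_def[abs_def] by measurable

lemma half_sgn_halfsphere: "norm e = 1 \<Longrightarrow> half_sgn e y \<in> halfsphere e"
  by (auto simp: half_sgn_def halfsphere_def norm_sgn mult_nonneg_nonneg mult_nonneg_nonpos
      dest: norm_eq_1[THEN iffD1]) (auto simp: sgn_div_norm mult_nonneg_nonneg mult_nonneg_nonpos)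

lemma sets_halfsphere_uniform:
  fixes e :: "'a::euclidean_space"
  shows "sets (halfsphere_uniform e) = sets (restrict_space borel (halfsphere e))"
proof -
  have "sets (halfsphere_uniform e)
      = sets (restrict_space (sphere_measure :: 'a measure) (halfsphere e))"
    by (simp add: halfsphere_uniform_def)
  also have "\<dots> = sets (restrict_space (restrict_space borel (sphere 0 1)) (halfsphere e))"
    by (rule sets_restrict_space_cong) (simp add: sphere_measure_def)
  also have "\<dots> = sets (restrict_space borel (sphere 0 1 \<inter> halfsphere e))"
    by (subst sets_restrict_restrict_space) simp
  also have "sphere 0 1 \<inter> halfsphere e = halfsphere e"
    by (auto simp: halfsphere_def)
  finally show ?thesis .
qed

lemma space_halfsphere_uniform: "space (halfsphere_uniform e) = halfsphere e"
  using sets_eq_imp_space_eq[OF sets_halfsphere_uniform[of e]] by (simp add: space_restrict_space)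

lemma halfsphere_borel [measurable]: "halfsphere e \<in> sets borel"
proof -
  have "closed (sphere 0 1 \<inter> {u. 0 \<le> e \<bullet> u})"
    by (intro closed_Int closed_sphere closed_halfspace_ge[of 0 e, simplified])
  moreover have "sphere 0 1 \<inter> {u. 0 \<le> e \<bullet> u} = halfsphere e"
    by (auto simp: halfsphere_def inner_commute)
  ultimately show ?thesis by (metis borel_closed)
qed

lemma half_sgn_measurable_halfsphere:
  assumes "norm e = 1"
  shows "half_sgn e \<in> ball_measure \<rightarrow>\<^sub>M halfsphere_uniform e"
proof -
  have "half_sgn e \<in> borel \<rightarrow>\<^sub>M restrict_space borel (halfsphere e)"
    using half_sgn_halfsphere[OF assms] by (intro measurable_restrict_space2) auto
  then show ?thesis
    by (subst measurable_cong_sets[OF sets_ball_measure sets_halfsphere_uniform])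
qed

lemma emeasure_lborel_uminus:
  fixes A :: "'a::euclidean_space set"
  assumes A[measurable]: "A \<in> sets borel"
  shows "emeasure lborel (uminus -` A) = emeasure lborel A"
proof -
  have o: "orthogonal_transformation (uminus :: 'a \<Rightarrow> 'a)"
    by (auto simp: orthogonal_transformation_def intro: linear_uminus linear_id linear_compose_neg)
  have "emeasure lborel A = emeasure (distr lborel borel uminus) A"
    by (simp add: lborel_distr_orthogonal[OF o])
  also have "\<dots> = emeasure lborel (uminus -` A)"
    by (subst emeasure_distr) auto
  finally show ?thesis by simp
qed

lemma kappa_eq_unit_ball_vol: "n > 0 \<Longrightarrow> kappa n = unit_ball_vol (real n)"
proof -
  assume n: "n > 0"
  define x where "x = real n / 2"
  have x: "x > 0" using n by (simp add: x_def)
  then have "x \<notin> \<int>\<^sub>\<le>\<^sub>0" using nonpos_Ints_nonpos[of x] by auto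
  then have "Gamma (x + 1) = x * Gamma x" by (rule Gamma_plus1)
  then have "pi powr x / Gamma (x + 1) = 2 * pi powr x / Gamma x / (2 * x)"
    using x Gamma_real_pos[OF x] by (simp add: field_simps)
  then show ?thesis
    by (simp add: unit_ball_vol_def omega_def kappa_def x_def)
qed

lemma unit_ball_vol_omega:
  "real DIM('a::euclidean_space) * unit_ball_vol (real DIM('a)) = omega DIM('a)"
  using kappa_eq_unit_ball_vol[of "DIM('a)"] by (simp add: kappa_def field_simps)

text \<open>Apart from the null hyperplane orthogonal to \<open>e\<close>, the preimage of
  \<open>A\<close> in the ball is the cone over \<open>A\<close> together with its antipodal copy,
  of equal volume. This doubling is the factor 2 in \<open>2 / omega DIM('a)\<close>.\<close>

lemma halfsphere_uniform_eq_distr: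
  fixes e :: "'a::euclidean_space"
  assumes e: "norm e = 1"
  shows "halfsphere_uniform e = distr ball_measure (halfsphere_uniform e) (half_sgn e)"
proof (rule measure_eqI)
  fix A assume A: "A \<in> sets (halfsphere_uniform e)"
  note m = half_sgn_measurable_halfsphere[OF e]
  have Ah: "A \<subseteq> halfsphere e"
    using sets.sets_into_space[OF A] by (simp add: space_halfsphere_uniform)
  have Ab [measurable]: "A \<in> sets borel"
    using A by (simp add: sets_halfsphere_uniform sets_restrict_space_iff)
  have As: "A \<subseteq> sphere 0 1" using Ah by (auto simp: halfsphere_def)
  let ?V = "emeasure lborel (cball (0::'a) 1)"
  \<comment> \<open>The cone over \<open>A\<close> in the ball, with the equator removed so that it
    is disjoint from its antipodal copy.\<close>
  let ?C = "(sgn -` A \<inter> {y. 0 < e \<bullet> y}) \<inter> cball 0 1"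
  let ?Z = "{y. e \<bullet> y = 0}"
  have [measurable]: "sgn -` A \<in> sets borel" "half_sgn e -` A \<in> sets borel"
    using measurable_sets_borel[OF borel_measurable_sgn_euclidean Ab]
      measurable_sets_borel[OF half_sgn_measurable Ab] by auto
  have Zm [measurable]: "?Z \<in> sets borel" by measurable
  have Z: "?Z \<in> null_sets lborel"
  proof -
    have "negligible ?Z" using e by (intro negligible_hyperplane) auto
    then have "?Z \<in> null_sets lebesgue" by (simp add: negligible_iff_null_sets)
    then show ?thesis by (simp add: null_sets_completion_iff)
  qed
  have Cm [measurable]: "?C \<in> sets borel" by measurable
  have C'm: "uminus -` ?C \<in> sets borel"
    using measurable_sets_borel[OF borel_measurable_uminus[OF measurable_ident] Cm] by simp
  have ZD: "emeasure lborel (X - ?Z) = emeasure lborel X" if "X \<in> sets borel" for X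
    using that Z by (intro emeasure_Diff_null_set) auto
  have "emeasure (halfsphere_uniform e) A = ennreal (2 / omega DIM('a)) * emeasure sphere_measure A"
  proof -
    have "halfsphere e \<in> sets (restrict_space borel (sphere 0 1))"
      by (auto simp: sets_restrict_space_iff halfsphere_def halfsphere_borel[unfolded halfsphere_def])
    then have "halfsphere e \<inter> space sphere_measure \<in> sets (sphere_measure :: 'a measure)"
      using sets.Int_space_eq2[of "halfsphere e" "sphere_measure :: 'a measure"]
      by (simp add: sphere_measure_def)
    then show ?thesis
      using Ah unfolding halfsphere_uniform_def
      by (subst emeasure_scale_measure, subst emeasure_restrict_space) auto
  qed
  also have "emeasure sphere_measure A
     = of_nat DIM('a) * emeasure lborel (sgn -` A \<inter> (cball 0 1 - {0}))"
  proof -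
    have "A \<in> sets (restrict_space borel (sphere 0 1))"
      using As by (auto simp: sets_restrict_space_iff)
    then show ?thesis
      unfolding sphere_measure_def
      by (subst emeasure_scale_measure, subst emeasure_distr[OF sgn_measurable_sphere], simp,
          subst emeasure_restrict_space) (auto simp: space_restrict_space)
  qed
  also have "emeasure lborel (sgn -` A \<inter> (cball 0 1 - {0})) = emeasure lborel ?C"
  proof -
    have "emeasure lborel (sgn -` A \<inter> (cball 0 1 - {0}))
        = emeasure lborel (sgn -` A \<inter> (cball 0 1 - {0}) - ?Z)"
      by (rule ZD[symmetric]) measurable
    also have "sgn -` A \<inter> (cball 0 1 - {0}) - ?Z = ?C"
    proof -
      have "0 < e \<bullet> y" if "sgn y \<in> A" "e \<bullet> y \<noteq> 0" for y
      proof -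
        have "0 \<le> sgn y \<bullet> e" "y \<noteq> 0" using that Ah by (auto simp: halfsphere_def)
        then show ?thesis using that(2) by (simp add: sgn_div_norm zero_le_mult_iff inner_commute)
      qed
      then show ?thesis by auto
    qed
    finally show ?thesis .
  qed
  finally have 1: "emeasure (halfsphere_uniform e) A
      = ennreal (2 / omega DIM('a)) * (of_nat DIM('a) * emeasure lborel ?C)" .
  have "emeasure (distr ball_measure (halfsphere_uniform e) (half_sgn e)) A
      = emeasure ball_measure (half_sgn e -` A)"
    using A by (subst emeasure_distr[OF m]) auto
  also have "\<dots> = emeasure lborel (cball 0 1 \<inter> half_sgn e -` A) / ?V"
    by (simp add: ball_measure_def)
  also have "emeasure lborel (cball 0 1 \<inter> half_sgn e -` A)
     = emeasure lborel (cball 0 1 \<inter> half_sgn e -` A - ?Z)"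
    by (rule ZD[symmetric]) measurable
  also have "cball 0 1 \<inter> half_sgn e -` A - ?Z = ?C \<union> uminus -` ?C"
    by (auto simp: half_sgn_def inner_commute sgn_minus split: if_splits)
  also have "emeasure lborel \<dots> = emeasure lborel ?C + emeasure lborel (uminus -` ?C)"
    using C'm by (intro plus_emeasure[symmetric]) auto
  also have "emeasure lborel (uminus -` ?C) = emeasure lborel ?C"
    by (rule emeasure_lborel_uminus) measurable
  finally have 2: "emeasure (distr ball_measure (halfsphere_uniform e) (half_sgn e)) A
     = (emeasure lborel ?C + emeasure lborel ?C) / ?V" .
  have "emeasure lborel ?C \<le> ?V" by (intro emeasure_mono) auto
  then have "emeasure lborel ?C < top" by (simp add: emeasure_unit_cball le_less_trans)
  then obtain c where c: "emeasure lborel ?C = ennreal c" "c \<ge> 0"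
    by (cases "emeasure lborel ?C") auto
  have v: "unit_ball_vol (real DIM('a)) > 0" by simp
  \<comment> \<open>The constants agree because \<open>omega\<close> is the dimension times the
    volume of the unit ball.\<close>
  show "emeasure (halfsphere_uniform e) A
      = emeasure (distr ball_measure (halfsphere_uniform e) (half_sgn e)) A"
    unfolding 1 2 unfolding c emeasure_unit_cball
    using v c(2)
    by (simp add: unit_ball_vol_omega[where 'a='a, symmetric] divide_ennreal ennreal_of_nat_eq_real_of_nat
        flip: ennreal_mult ennreal_plus)
qed simp

section \<open>Lunes\<close>

text \<open>Cauchy's functional equation on an interval. Nonnegativity makes \<open>F\<close>
  monotone, which takes the place of continuity: on the grid of mesh \<open>L / N\<close> additivity
  gives the exact values, and between two grid points \<open>F\<close> and the linear function lie
  in the same interval of length \<open>F L / N\<close>.\<close>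

lemma additive_nonneg_imp_linear:
  fixes F :: "real \<Rightarrow> real"
  assumes add: "\<And>s t. 0 \<le> s \<Longrightarrow> 0 \<le> t \<Longrightarrow> s + t \<le> L \<Longrightarrow> F (s + t) = F s + F t"
    and nonneg: "\<And>s. 0 \<le> s \<Longrightarrow> s \<le> L \<Longrightarrow> 0 \<le> F s"
    and L: "0 < L" and s: "0 \<le> s" "s \<le> L"
  shows "F s = s / L * F L"
proof -
  have mono: "F x \<le> F y" if "0 \<le> x" "x \<le> y" "y \<le> L" for x y
    using add[of x "y - x"] nonneg[of "y - x"] that by simp
  have mult: "F (real k * h) = real k * F h" if "0 \<le> h" "real k * h \<le> L" for k h
    using that
  proof (induction k)
    case 0
    then show ?case using add[of 0 0] L by simp
  next
    case (Suc k)
    have "real k * h \<le> L" using Suc.prems by (simp add: algebra_simps)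
    then have "F (real k * h + h) = F (real k * h) + F h"
      using Suc.prems by (intro add) (auto simp: algebra_simps)
    then show ?case using Suc \<open>real k * h \<le> L\<close> by (simp add: algebra_simps)
  qed
  have FL: "0 \<le> F L" using nonneg L by simp
  have bound: "\<bar>F s - s / L * F L\<bar> \<le> F L * inverse (real (Suc n))" for n
  proof -
    define N where "N = real (Suc n)"
    define k where "k = nat \<lfloor>N * s / L\<rfloor>"
    define h where "h = L / N"
    have N: "N > 0" by (simp add: N_def)
    have "0 \<le> N * s / L" using N s L by simp
    then have k: "real k \<le> N * s / L" "N * s / L < real k + 1"
      unfolding k_def by linarith+
    then have kh: "real k * h \<le> s" "s < (real k + 1) * h"
      using N L by (simp_all add: h_def field_simps)
    have "F (real (Suc n) * h) = N * F h"
      unfolding N_def by (rule mult) (use N L in \<open>simp_all add: h_def N_def\<close>)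
    moreover have "real (Suc n) * h = L" by (simp add: h_def N_def)
    ultimately have "F L = N * F h" by simp
    then have Fh: "F h = F L / N" using N by (simp add: h_def N_def field_simps)
    have lo: "real k * F h \<le> F s"
    proof -
      have "F (real k * h) = real k * F h" 
        using kh s N L by (intro mult) (auto simp: h_def)
      moreover have "F (real k * h) \<le> F s" using kh s N L by (intro mono) (auto simp: h_def)
      ultimately show ?thesis by simp
    qed
    have hi: "F s \<le> (real k + 1) * F h"
    proof (cases "(real k + 1) * h \<le> L")
      case True
      have "F (real (Suc k) * h) = real (Suc k) * F h"
        using True N L by (intro mult) (auto simp: h_def add.commute)
      moreover have "F s \<le> F (real (Suc k) * h)" using kh s True by (intro mono) (auto simp: add.commute)
      ultimately show ?thesis by (simp add: add.commute)
    next
      \<comment> \<open>The grid point above \<open>s\<close> lies beyond \<open>L\<close>, where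
        additivity says nothing; but then \<open>F L\<close> itself is at most the claimed
        bound.\<close>
      case False
      then have "L * N < L * (real k + 1)" using N L by (simp add: h_def field_simps)
      then have "1 \<le> (real k + 1) / N" using N L by (simp add: mult_less_cancel_left_pos)
      then have "F L \<le> (real k + 1) / N * F L" using mult_right_mono[of 1 "(real k + 1) / N" "F L"] FL by simp
      moreover have "F s \<le> F L" using s by (intro mono) auto
      ultimately show ?thesis by (simp add: Fh)
    qed
    have "real k * (F L / N) \<le> s / L * F L" "s / L * F L \<le> (real k + 1) * (F L / N)"
    proof -
      have "real k / N \<le> s / L" "s / L \<le> (real k + 1) / N" using k N L by (auto simp: field_simps)
      from this[THEN mult_right_mono[OF _ FL]] show "real k * (F L / N) \<le> s / L * F L" 
        "s / L * F L \<le> (real k + 1) * (F L / N)" by simp_all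
    qed
    moreover have "\<bar>x - y\<bar> \<le> c"
      if "k * c \<le> y" "y \<le> (k + 1) * c" "k * c \<le> x" "x \<le> (k + 1) * c" for x y c k :: real
      using that unfolding distrib_right abs_le_iff by simp
    ultimately have "\<bar>F s - s / L * F L\<bar> \<le> F L / N"
      using lo hi unfolding Fh by blast
    then show ?thesis by (simp add: N_def divide_inverse)
  qed
  have "(\<lambda>n. F L * inverse (real (Suc n))) \<longlonglongrightarrow> F L * 0"
    by (intro tendsto_intros LIMSEQ_inverse_real_of_nat)
  then have "\<bar>F s - s / L * F L\<bar> \<le> 0"
    using bound by (intro tendsto_lowerbound) auto
  then show ?thesis by simp
qed

text \<open>The first reflection takes \<open>p\<close> to \<open>p'\<close>. The second takes the
  image of \<open>q\<close> to \<open>q'\<close> and fixes \<open>p'\<close>, because equality of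
  the inner products makes \<open>p'\<close> orthogonal to the vector that defines it.\<close>

lemma orthogonal_transformation_pair:
  fixes p q p' q' :: "'a::euclidean_space"
  assumes "norm p = norm p'" "norm q = norm q'" "p \<bullet> q = p' \<bullet> q'"
  obtains f where "orthogonal_transformation f" "f p = p'" "f q = q'"
proof -
  let ?r = "hyperplane_reflection (p - p')"
  define q1 where "q1 = ?r q"
  let ?t = "hyperplane_reflection (q1 - q')"
  have r: "orthogonal_transformation ?r" "orthogonal_transformation ?t"
    by (rule orthogonal_transformation_hyperplane_reflection)+
  have rp: "?r p = p'" by (rule hyperplane_reflection_diff) fact
  have "norm q1 = norm q'" using r(1) assms by (simp add: q1_def orthogonal_transformation_norm)
  then have tq: "?t q1 = q'" by (rule hyperplane_reflection_diff)
  have "?r p \<bullet> ?r q = p \<bullet> q" using r(1) by (simp add: orthogonal_transformation_def)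
  then have "p' \<bullet> q1 = p \<bullet> q" unfolding rp q1_def .
  then have "p' \<bullet> (q1 - q') = 0" using assms by (simp add: inner_diff_right)
  then have "?t p' = p'" by (simp add: hyperplane_reflection_def)
  then show ?thesis using r rp tq
    by (intro that[of "?t \<circ> ?r"] orthogonal_transformation_compose) (auto simp: q1_def)
qed

text \<open>One bounding half space is closed and the other open, so that two lunes sharing a
  normal, as in \<open>lune p q\<close> and \<open>lune q r\<close>, are disjoint.\<close>

definition lune :: "'a::euclidean_space \<Rightarrow> 'a \<Rightarrow> 'a set" where
  "lune p q = {x. 0 \<le> p \<bullet> x \<and> q \<bullet> x < 0}"

lemma lune_borel [measurable]: "lune p q \<in> sets borel"
  unfolding lune_def by measurable

lemma measure_lune_cong:
  fixes p q p' q' :: "'a::euclidean_space"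
  assumes "norm p = norm p'" "norm q = norm q'" "p \<bullet> q = p' \<bullet> q'"
  shows "measure ball_measure (lune p q) = measure ball_measure (lune p' q')"
proof -
  obtain f where f: "orthogonal_transformation f" "f p = p'" "f q = q'"
    using orthogonal_transformation_pair[OF assms] .
  have [measurable]: "f \<in> borel_measurable ball_measure"
    using orthogonal_transformation_borel_measurable[OF f(1)]
      measurable_cong_sets[OF sets_ball_measure refl] by blast
  have "measure ball_measure (lune p' q') = measure (distr ball_measure borel f) (lune p' q')"
    by (simp add: ball_measure_distr_orthogonal[OF f(1)])
  also have "\<dots> = measure ball_measure (f -` lune p' q')"
    by (subst measure_distr) auto
  also have "f -` lune p' q' = lune p q"
    using f by (auto simp: lune_def orthogonal_transformation_def)
  finally show ?thesis by simp
qed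

lemma AE_ball_measure_hyperplane:
  assumes "w \<noteq> (0::'a::euclidean_space)"
  shows "AE x in ball_measure. w \<bullet> x \<noteq> 0"
  using AE_not_in[OF ball_measure_hyperplane[OF assms]] by simp

lemma AE_ball_measure_nonzero: "AE x in ball_measure. x \<noteq> (0::'a::euclidean_space)"
proof -
  obtain b :: 'a where "b \<in> Basis" using nonempty_Basis by blast
  then have "b \<noteq> 0" using nonzero_Basis by blast
  from AE_ball_measure_hyperplane[OF this] show ?thesis by eventually_elim auto
qed

lemma measure_lune_opposite:
  fixes p :: "'a::euclidean_space"
  assumes p: "p \<noteq> 0"
  shows "measure ball_measure (lune p (-p)) = 1 / 2"
proof -
  interpret prob_space "ball_measure :: 'a measure" by (rule prob_space_ball_measure)
  note ae = AE_ball_measure_hyperplane[OF p]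
  have "measure ball_measure (lune p (-p)) = measure ball_measure (lune (-p) p)"
    by (rule measure_lune_cong) auto
  moreover have "measure ball_measure (lune p (-p) \<union> lune (-p) p)
    = measure ball_measure (lune p (-p)) + measure ball_measure (lune (-p) p)"
    by (rule finite_measure_Union) (auto simp: lune_def)
  moreover have "measure ball_measure (lune p (-p) \<union> lune (-p) p) = 1"
    using ae by (subst prob_eq_1) (auto simp: lune_def elim!: eventually_mono)
  ultimately show ?thesis by simp
qed

text \<open>The vectors \<open>v s\<close> run along the great circle from \<open>p\<close> through
  \<open>q\<close> to \<open>- p\<close>. The measure \<open>F s\<close> swept out by turning the
  second normal is additive in \<open>s\<close> by rotation invariance, and \<open>F pi\<close> is
  the measure of a half space.\<close>

lemma measure_lune:
  fixes p q :: "'a::euclidean_space"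
  assumes p: "norm p = 1" and q: "norm q = 1"
  shows "measure ball_measure (lune p q) = arccos (p \<bullet> q) / (2 * pi)"
proof -
  interpret prob_space "ball_measure :: 'a measure" by (rule prob_space_ball_measure)
  have pp: "p \<bullet> p = 1" "q \<bullet> q = 1" using p q by (simp_all add: norm_eq_1)
  have pq: "\<bar>p \<bullet> q\<bar> \<le> 1" using Cauchy_Schwarz_ineq2[of p q] p q by simp
  consider "p = q" | "p = - q" | "p \<noteq> q" "p \<noteq> - q" by blast
  then show ?thesis
  proof cases
    case 1
    then have "lune p q = {}" by (auto simp: lune_def)
    then show ?thesis using 1 pp by simp
  next
    case 2
    then have "q = - p" "p \<noteq> 0" using p by auto
    then show ?thesis using pp by (simp add: measure_lune_opposite)
  next
    case 3
    define \<alpha> where "\<alpha> = arccos (p \<bullet> q)"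
    have \<alpha>: "0 \<le> \<alpha>" "\<alpha> \<le> pi" "cos \<alpha> = p \<bullet> q"
      using pq by (auto simp: \<alpha>_def abs_le_iff intro: arccos_lbound arccos_ubound)
    have "(q - (p \<bullet> q) *\<^sub>R p) \<bullet> (q - (p \<bullet> q) *\<^sub>R p) = 1 - (p \<bullet> q)\<^sup>2"
      using pp by (simp add: inner_diff_left inner_diff_right inner_commute power2_eq_square)
    then have nb: "norm (q - (p \<bullet> q) *\<^sub>R p) = sin \<alpha>"
      using \<alpha> pq by (simp add: norm_eq_sqrt_inner \<alpha>_def sin_arccos_abs)
    have sin0: "sin \<alpha> \<noteq> 0"
    proof
      assume "sin \<alpha> = 0"
      then have eq: "q = (p \<bullet> q) *\<^sub>R p" using nb by simp
      then have "\<bar>p \<bullet> q\<bar> = 1" using p q by (metis norm_scaleR mult.right_neutral)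
      then show False using eq 3 by (auto simp: abs_if split: if_splits)
    qed
    \<comment> \<open>Gram-Schmidt applied to \<open>p\<close> and \<open>q\<close>; the remainder
      has norm \<open>sin \<alpha>\<close>.\<close>
    define b where "b = (1 / sin \<alpha>) *\<^sub>R (q - (p \<bullet> q) *\<^sub>R p)"
    have bb: "b \<bullet> b = 1"
    proof -
      have "norm b = 1" using nb sin0 sin_ge_zero[OF \<alpha>(1,2)] by (simp add: b_def)
      then show ?thesis by (simp add: norm_eq_1)
    qed
    have pb: "p \<bullet> b = 0" using pp by (simp add: b_def inner_diff_right)
    define v where "v s = cos s *\<^sub>R p + sin s *\<^sub>R b" for s
    have v\<alpha>: "v \<alpha> = q" using sin0 \<alpha> by (simp add: v_def b_def)
    have v0: "v 0 = p" by (simp add: v_def)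
    have vpi: "v pi = - p" by (simp add: v_def)
    have vv: "v s \<bullet> v t = cos (t - s)" for s t
      using pp bb pb by (simp add: v_def inner_add_left inner_add_right inner_commute cos_diff)
    have nv: "norm (v s) = 1" for s by (simp add: norm_eq_sqrt_inner vv)
    define F where "F s = measure ball_measure (lune (v 0) (v s))" for s
    have rot: "measure ball_measure (lune (v s) (v (s + t))) = F t" for s t
      unfolding F_def by (rule measure_lune_cong) (simp_all add: nv vv)
    have F0: "F 0 = 0"
    proof -
      have "lune (v 0) (v 0) = {}" by (auto simp: lune_def)
      then show ?thesis by (simp add: F_def)
    qed
    have add: "F (s + t) = F s + F t" if st: "0 \<le> s" "0 \<le> t" "s + t \<le> pi" for s t
    proof (cases "s = 0 \<or> t = 0")
      case True
      then show ?thesis using F0 by auto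
    next
      case False
      then have s: "0 < s" "s < pi" and t: "0 < t" "t < pi" using st by auto
      have sn: "sin s > 0" "sin t > 0" "sin (s + t) \<ge> 0"
        using s t st by (auto intro: sin_gt_zero sin_ge_zero)
      \<comment> \<open>The three normals lie in one plane; the signs in this linear relation decide
        the inclusions between the lunes.\<close>
      have id: "sin (s + t) * (v s \<bullet> x) = sin t * (v 0 \<bullet> x) + sin s * (v (s + t) \<bullet> x)" for x
      proof -
        have "sin (s + t) * cos s = sin t + sin s * cos (s + t)"
        proof -
          have "sin t = sin ((s + t) - s)" by simp
          also have "\<dots> = sin (s + t) * cos s - cos (s + t) * sin s" by (rule sin_diff)
          finally show ?thesis by simp
        qed
        then have "sin (s + t) *\<^sub>R v s = sin t *\<^sub>R v 0 + sin s *\<^sub>R v (s + t)"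
          by (simp add: v_def algebra_simps flip: scaleR_add_left)
        from arg_cong[OF this, of "\<lambda>z. z \<bullet> x"] show ?thesis by (simp add: inner_add_left)
      qed
      have "v 0 \<noteq> 0" using nv[of 0] by auto
      have "F (s + t) = measure ball_measure (lune (v 0) (v s) \<union> lune (v s) (v (s + t)))"
        unfolding F_def
      proof (rule finite_measure_eq_AE)
        show "AE x in ball_measure. (x \<in> lune (v 0) (v (s + t)))
          = (x \<in> lune (v 0) (v s) \<union> lune (v s) (v (s + t)))"
          using AE_ball_measure_hyperplane[OF \<open>v 0 \<noteq> 0\<close>]
        proof eventually_elim
          case (elim x)
          \<comment> \<open>At \<open>s + t = pi\<close> the left side of \<open>id\<close>
            vanishes, so strictness has to come from \<open>v 0 \<bullet> x\<close> being nonzero,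
            which holds almost everywhere.\<close>
          have 1: "v (s + t) \<bullet> x < 0" if "0 \<le> v 0 \<bullet> x" "v s \<bullet> x < 0"
          proof -
            have "sin (s + t) * (v s \<bullet> x) \<le> 0" using sn that by (simp add: mult_nonneg_nonpos)
            moreover have "0 < sin t * (v 0 \<bullet> x)" using sn that elim by simp
            ultimately have "sin s * (v (s + t) \<bullet> x) < 0" using id[of x] by linarith
            then show ?thesis using sn by (simp add: mult_less_0_iff)
          qed
          have 2: "0 \<le> v 0 \<bullet> x" if "0 \<le> v s \<bullet> x" "v (s + t) \<bullet> x < 0"
          proof -
            have "0 \<le> sin (s + t) * (v s \<bullet> x)" using sn that by simp
            moreover have "sin s * (v (s + t) \<bullet> x) < 0" using sn that by (simp add: mult_less_0_iff)
            ultimately have "0 < sin t * (v 0 \<bullet> x)" using id[of x] by linarith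
            then show ?thesis using sn by (simp add: zero_less_mult_iff)
          qed
          show ?case using 1 2 by (auto simp: lune_def not_less)
        qed
      qed auto
      also have "\<dots> = F s + measure ball_measure (lune (v s) (v (s + t)))"
        unfolding F_def by (rule finite_measure_Union) (auto simp: lune_def)
      finally show ?thesis by (simp add: rot)
    qed
    have Fpi: "F pi = 1 / 2"
      unfolding F_def v0 vpi using p by (intro measure_lune_opposite) auto
    have "F \<alpha> = \<alpha> / pi * F pi"
      using \<alpha> by (intro additive_nonneg_imp_linear add) (auto simp: F_def)
    then show ?thesis unfolding F_def v0 v\<alpha> Fpi[unfolded F_def v0] by (simp add: \<alpha>_def)
  qed
qed

text \<open>The sign of \<open>w \<bullet> half_sgn e y\<close> is the product of the signs of
  \<open>e \<bullet> y\<close> and \<open>w \<bullet> y\<close>, so up to a null set the event is a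
  lune and its antipode.\<close>

lemma measure_half_sgn_side:
  fixes e w :: "'a::euclidean_space"
  assumes e: "norm e = 1" and w: "w \<noteq> 0"
  shows "measure ball_measure {y. 0 < w \<bullet> half_sgn e y} = 1 - arccos (e \<bullet> sgn w) / pi"
proof -
  interpret prob_space "ball_measure :: 'a measure" by (rule prob_space_ball_measure)
  define u where "u = sgn w"
  have u: "norm u = 1" using w by (simp add: u_def norm_sgn)
  have wu: "w = norm w *\<^sub>R u" using w by (simp add: u_def sgn_div_norm)
  have nw: "0 < norm w" using w by simp
  have "e \<noteq> 0" using e by auto
  have "measure ball_measure {y. 0 < w \<bullet> half_sgn e y}
      = measure ball_measure (lune e (-u) \<union> lune (-e) u)"
  proof (rule finite_measure_eq_AE)
    show "AE y in ball_measure. (y \<in> {y. 0 < w \<bullet> half_sgn e y}) = (y \<in> lune e (-u) \<union> lune (-e) u)"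
      using AE_ball_measure_hyperplane[OF \<open>e \<noteq> 0\<close>]
    proof eventually_elim
      case (elim y)
      then have y: "y \<noteq> 0" by auto
      have "w \<bullet> half_sgn e y = (if 0 \<le> e \<bullet> y then 1 else - 1) * (norm w / norm y) * (u \<bullet> y)"
        using y by (subst wu) (auto simp: half_sgn_def sgn_div_norm inner_commute divide_inverse)
      then show ?case using y nw elim
        by (auto simp: lune_def zero_less_mult_iff zero_less_divide_iff mult_less_0_iff not_less)
    qed
    show "{y. 0 < w \<bullet> half_sgn e y} \<in> sets ball_measure" by measurable
  qed auto
  also have "\<dots> = measure ball_measure (lune e (-u)) + measure ball_measure (lune (-e) u)"
    by (rule finite_measure_Union) (auto simp: lune_def)
  also have "\<dots> = 2 * (arccos (- (e \<bullet> u)) / (2 * pi))"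
    using e u by (simp add: measure_lune)
  also have "arccos (- (e \<bullet> u)) = pi - arccos (e \<bullet> u)"
    using Cauchy_Schwarz_ineq2[of e u] e u by (intro arccos_minus) (auto simp: abs_le_iff)
  finally show ?thesis by (simp add: u_def field_simps)
qed

section \<open>Caps\<close>

text \<open>Radius 0 does occur among the slices of a cap, for instance at its poles. The volume is
  then squeezed below that of balls of radius \<open>1 / (n + 1)\<close>.\<close>

lemma emeasure_cball_aux_nonneg:
  assumes A: "finite A" "A \<noteq> {}" and r: "0 \<le> r"
  shows "emeasure (Pi\<^sub>M A (\<lambda>_. lborel))
      ({f. sqrt (\<Sum>i\<in>A. (f i)\<^sup>2) \<le> r} \<inter> space (Pi\<^sub>M A (\<lambda>_. lborel))) =
      ennreal (unit_ball_vol (real (card A)) * r ^ card A)"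
proof (cases "r = 0")
  case True
  let ?P = "Pi\<^sub>M A (\<lambda>_. lborel) :: ('a \<Rightarrow> real) measure"
  let ?B = "\<lambda>r. {f. sqrt (\<Sum>i\<in>A. (f i)\<^sup>2) \<le> r} \<inter> space ?P"
  have c: "card A > 0" using A by (simp add: card_gt_0_iff)
  have le: "emeasure ?P (?B 0) \<le> ennreal (unit_ball_vol (real (card A)) * (inverse (real (Suc n))) ^ card A)" for n
  proof -
    have "?B (inverse (real (Suc n))) \<in> sets ?P" 
    proof -
      have "{f \<in> space ?P. sqrt (\<Sum>i\<in>A. (f i)\<^sup>2) \<le> inverse (real (Suc n))} \<in> sets ?P"
        using A by measurable
      moreover have "{f \<in> space ?P. sqrt (\<Sum>i\<in>A. (f i)\<^sup>2) \<le> inverse (real (Suc n))} = ?B (inverse (real (Suc n)))"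
        by auto
      ultimately show ?thesis by simp
    qed
    then have "emeasure ?P (?B 0) \<le> emeasure ?P (?B (inverse (real (Suc n))))"
      by (intro emeasure_mono) (auto intro: order_trans simp del: real_sqrt_le_0_iff)
    also have "\<dots> = ennreal (unit_ball_vol (real (card A)) * (inverse (real (Suc n))) ^ card A)"
      using A by (intro emeasure_cball_aux) auto
    finally show ?thesis .
  qed
  have "(\<lambda>n. ennreal (unit_ball_vol (real (card A)) * (inverse (real (Suc n))) ^ card A))
     \<longlonglongrightarrow> ennreal (unit_ball_vol (real (card A)) * 0 ^ card A)"
    by (intro tendsto_intros LIMSEQ_inverse_real_of_nat)
  then have "emeasure ?P (?B 0) \<le> ennreal (unit_ball_vol (real (card A)) * 0 ^ card A)"
    by (rule LIMSEQ_le_const) (use le in blast)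
  then show ?thesis using zero_power[OF c, where 'a=real] True by simp
next
  case False
  then show ?thesis using emeasure_cball_aux[of A r] A r by simp
qed

text \<open>Adds up the volumes of the two pieces, a cone and a ball segment, of the cone over a cap.\<close>
lemma integral_sin_power_reduction:
  fixes a :: real
  assumes a: "0 \<le> a"
  shows "integral {0..a} (\<lambda>s. sin s ^ (k + 2)) + sin a ^ (k + 1) * cos a / (real k + 2)
     = (real k + 1) / (real k + 2) * integral {0..a} (\<lambda>s. sin s ^ k)"
proof -
  \<comment> \<open>The integrand is the derivative of \<open>sin s ^ (k + 1) * cos s\<close>, with
    the squared cosine expressed by the sine.\<close>
  have "((\<lambda>s. (real k + 1) * sin s ^ k - (real k + 2) * sin s ^ (k + 2)) has_integral
      (sin a ^ (k + 1) * cos a - sin 0 ^ (k + 1) * cos 0)) {0..a}"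
  proof (rule fundamental_theorem_of_calculus[OF a])
    fix x :: real assume "x \<in> {0..a}"
    have "((\<lambda>s. sin s ^ Suc k) has_real_derivative (1 + real k) * (cos x * sin x ^ k)) (at x within {0..a})"
      by (intro DERIV_power_Suc has_field_derivative_at_within[OF DERIV_sin])
    from DERIV_mult[OF this has_field_derivative_at_within[OF DERIV_cos]]
    have "((\<lambda>s. sin s ^ (k + 1) * cos s) has_real_derivative
        real (k + 1) * (sin x ^ k * cos x) * cos x + sin x ^ (k + 1) * (- sin x)) (at x within {0..a})"
      by (simp add: algebra_simps)
    also have "real (k + 1) * (sin x ^ k * cos x) * cos x + sin x ^ (k + 1) * (- sin x)
       = real (k + 1) * sin x ^ k * (cos x)\<^sup>2 - sin x ^ (k + 2)"
      by (simp add: power2_eq_square)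
    also have "\<dots> = (real k + 1) * sin x ^ k - (real k + 2) * sin x ^ (k + 2)"
      unfolding cos_squared_eq by (simp add: power2_eq_square ring_distribs)
    finally show "((\<lambda>s. sin s ^ (k + 1) * cos s) has_vector_derivative
        ((real k + 1) * sin x ^ k - (real k + 2) * sin x ^ (k + 2))) (at x within {0..a})"
      by (simp add: has_real_derivative_iff_has_vector_derivative)
  qed
  then have "integral {0..a} (\<lambda>s. (real k + 1) * sin s ^ k - (real k + 2) * sin s ^ (k + 2)) = sin a ^ (k + 1) * cos a"
    by (simp add: integral_unique)
  moreover have "integral {0..a} (\<lambda>s. (real k + 1) * sin s ^ k - (real k + 2) * sin s ^ (k + 2))
     = (real k + 1) * integral {0..a} (\<lambda>s. sin s ^ k) - (real k + 2) * integral {0..a} (\<lambda>s. sin s ^ (k + 2))"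
    by (subst Henstock_Kurzweil_Integration.integral_diff)
       (auto intro!: integrable_continuous_real continuous_intros)
  ultimately show ?thesis by (simp add: field_simps)
qed

text \<open>Radius of the slice at signed height \<open>t\<close> of the double cone of half angle
  \<open>a\<close> intersected with the unit ball: up to height \<open>cos a\<close> the cone bounds
  the slice, above it the ball does.\<close>

definition cap_radius :: "real \<Rightarrow> real \<Rightarrow> real" where
  "cap_radius a t = (if \<bar>t\<bar> < cos a then \<bar>t\<bar> * tan a else sqrt (1 - t\<^sup>2))"

lemma cap_radius_minus: "cap_radius a (- t) = cap_radius a t"
  by (simp add: cap_radius_def)

text \<open>On the ball part, \<open>t = - cos s\<close> turns the integrand into
  \<open>sin s ^ (k + 2)\<close>; on the cone part it is a monomial.
  \<open>integral_sin_power_reduction\<close> merges the two values, and evenness in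
  \<open>t\<close> gives the factor 2.\<close>

lemma has_integral_cap_radius:
  assumes a: "0 \<le> a" "a \<le> pi / 2"
  shows "((\<lambda>t. cap_radius a t ^ (k + 1)) has_integral
     (2 * ((real k + 1) / (real k + 2) * integral {0..a} (\<lambda>s. sin s ^ k)))) {-1..1}"
proof -
  let ?n = "k + 1"
  have c: "0 \<le> cos a" "cos a \<le> 1" using a by (auto intro: cos_ge_zero)
  have 1: "((\<lambda>t. sqrt (1 - t\<^sup>2) ^ ?n) has_integral integral {0..a} (\<lambda>s. sin s ^ (k + 2))) {-1..- cos a}"
  proof -
    have "((\<lambda>s. sin s *\<^sub>R (sqrt (1 - (- cos s)\<^sup>2) ^ ?n)) has_integral
        integral {- cos 0..- cos a} (\<lambda>t. sqrt (1 - t\<^sup>2) ^ ?n)) {0..a}"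
      using a c by (intro has_integral_substitution[where c = "-1" and d = 1])
        (auto intro!: continuous_intros derivative_eq_intros)
    moreover have "sin s *\<^sub>R (sqrt (1 - (- cos s)\<^sup>2) ^ ?n) = sin s ^ (k + 2)" if "s \<in> {0..a}" for s
    proof -
      have "0 \<le> sin s" using that a by (intro sin_ge_zero) auto
      moreover have "1 - (cos s)\<^sup>2 = (sin s)\<^sup>2" by (simp add: sin_squared_eq)
      ultimately show ?thesis by simp
    qed
    ultimately have "((\<lambda>s. sin s ^ (k + 2)) has_integral
        integral {- 1..- cos a} (\<lambda>t. sqrt (1 - t\<^sup>2) ^ ?n)) {0..a}"
      by (subst (asm) has_integral_cong) auto
    then have "integral {- 1..- cos a} (\<lambda>t. sqrt (1 - t\<^sup>2) ^ ?n) = integral {0..a} (\<lambda>s. sin s ^ (k + 2))"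
      by (simp add: integral_unique)
    moreover have "(\<lambda>t. sqrt (1 - t\<^sup>2) ^ ?n) integrable_on {-1..- cos a}"
      by (intro integrable_continuous_real continuous_intros)
    ultimately show ?thesis by (simp add: has_integral_iff)
  qed
  have i1: "((\<lambda>t. cap_radius a t ^ ?n) has_integral integral {0..a} (\<lambda>s. sin s ^ (k + 2))) {-1..- cos a}"
    by (rule has_integral_eq[OF _ 1]) (auto simp: cap_radius_def)
  have 2: "((\<lambda>t. (- t * tan a) ^ ?n) has_integral sin a ^ ?n * cos a / (real k + 2)) {- cos a..0}"
  proof -
    have "((\<lambda>t. (- t * tan a) ^ ?n) has_integral
        (- ((- 0) ^ (k + 2)) * tan a ^ ?n / (real k + 2)) - (- ((- (- cos a)) ^ (k + 2)) * tan a ^ ?n / (real k + 2))) {- cos a..0}"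
    proof (rule fundamental_theorem_of_calculus)
      fix x assume "x \<in> {- cos a..0}"
      have "((\<lambda>t. - ((- t) ^ (k + 2)) * tan a ^ ?n / (real k + 2)) has_real_derivative
        - (real (k + 2) * (- x) ^ (k + 1) * (- 1)) * tan a ^ ?n / (real k + 2)) (at x within {- cos a..0})"
        by (auto intro!: derivative_eq_intros simp del: power_Suc)
      also have "- (real (k + 2) * (- x) ^ (k + 1) * (- 1)) * tan a ^ ?n / (real k + 2) = (- x * tan a) ^ ?n"
        unfolding power_mult_distrib by (simp add: field_simps del: power_Suc)
      finally show "((\<lambda>t. - ((- t) ^ (k + 2)) * tan a ^ ?n / (real k + 2)) has_vector_derivative
         (- x * tan a) ^ ?n) (at x within {- cos a..0})"
        by (simp add: has_real_derivative_iff_has_vector_derivative)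
    qed (use c in auto)
    moreover have "cos a ^ (k + 2) * tan a ^ ?n = sin a ^ ?n * cos a"
      by (cases "cos a = 0") (auto simp: tan_def power_divide)
    then have "(- ((- 0) ^ (k + 2)) * tan a ^ ?n / (real k + 2)) - (- ((- (- cos a)) ^ (k + 2)) * tan a ^ ?n / (real k + 2))
       = sin a ^ ?n * cos a / (real k + 2)"
      by (simp del: power_Suc add: zero_power)
    ultimately show ?thesis by (simp only:)
  qed
  \<comment> \<open>At \<open>t = - cos a\<close> the definition of \<open>cap_radius\<close> has
    already switched to the ball branch, hence the exceptional point.\<close>
  have i2: "((\<lambda>t. cap_radius a t ^ ?n) has_integral sin a ^ ?n * cos a / (real k + 2)) {- cos a..0}"
    using 2 by (rule has_integral_spike_finite[rotated 2, where S = "{- cos a}"])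
      (auto simp: cap_radius_def)
  have 3: "((\<lambda>t. cap_radius a t ^ ?n) has_integral
      (real k + 1) / (real k + 2) * integral {0..a} (\<lambda>s. sin s ^ k)) {-1..0}"
    using has_integral_combine[OF _ _ i1 i2] c integral_sin_power_reduction[OF a(1), of k] by simp
  then have "((\<lambda>t. cap_radius a (- t) ^ ?n) has_integral
      (real k + 1) / (real k + 2) * integral {0..a} (\<lambda>s. sin s ^ k)) {-0..- (- 1)}"
    by (subst has_integral_reflect_real)
  then have 4: "((\<lambda>t. cap_radius a t ^ ?n) has_integral
      (real k + 1) / (real k + 2) * integral {0..a} (\<lambda>s. sin s ^ k)) {0..1}"
    by (simp add: cap_radius_minus)
  show ?thesis using has_integral_combine[OF _ _ 3 4] by simp
qed

text \<open>Here \<open>t\<close> is the height along the axis and \<open>s\<close> the distance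
  from it. Squaring turns the cone condition into
  \<open>cos a * s \<le> \<bar>t\<bar> * sin a\<close>. Below height \<open>cos a\<close> this
  implies the bound by the ball, from there on it follows from that bound.\<close>

lemma cap_radius_iff:
  assumes a: "0 \<le> a" "a \<le> pi / 2" and s: "0 \<le> s"
  shows "t\<^sup>2 + s\<^sup>2 \<le> 1 \<and> cos a * sqrt (t\<^sup>2 + s\<^sup>2) \<le> \<bar>t\<bar> \<longleftrightarrow> \<bar>t\<bar> \<le> 1 \<and> s \<le> cap_radius a t"
proof -
  have c: "0 \<le> cos a" "cos a \<le> 1" using a by (auto intro: cos_ge_zero)
  have sn: "0 \<le> sin a" using a by (intro sin_ge_zero) auto
  have sc: "(sin a)\<^sup>2 = 1 - (cos a)\<^sup>2" by (rule sin_squared_eq)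
  have ball: "t\<^sup>2 + s\<^sup>2 \<le> 1 \<longleftrightarrow> \<bar>t\<bar> \<le> 1 \<and> s \<le> sqrt (1 - t\<^sup>2)"
  proof
    assume h: "t\<^sup>2 + s\<^sup>2 \<le> 1"
    then have "t\<^sup>2 \<le> 1" using zero_le_power2[of s] by linarith
    then show "\<bar>t\<bar> \<le> 1 \<and> s \<le> sqrt (1 - t\<^sup>2)" using h by (simp add: abs_square_le_1 real_le_rsqrt)
  next
    assume h: "\<bar>t\<bar> \<le> 1 \<and> s \<le> sqrt (1 - t\<^sup>2)"
    then have "s\<^sup>2 \<le> (sqrt (1 - t\<^sup>2))\<^sup>2" using s by (intro power_mono) auto
    moreover have "0 \<le> 1 - t\<^sup>2" using h by (simp add: abs_square_le_1)
    ultimately show "t\<^sup>2 + s\<^sup>2 \<le> 1" by simp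
  qed
  have "cos a * sqrt (t\<^sup>2 + s\<^sup>2) \<le> \<bar>t\<bar> \<longleftrightarrow> (cos a * sqrt (t\<^sup>2 + s\<^sup>2))\<^sup>2 \<le> \<bar>t\<bar>\<^sup>2"
    using c by (subst power_mono_iff) auto
  also have "\<dots> \<longleftrightarrow> (cos a * s)\<^sup>2 \<le> (\<bar>t\<bar> * sin a)\<^sup>2"
    by (simp add: power_mult_distrib sc algebra_simps)
  also have "\<dots> \<longleftrightarrow> cos a * s \<le> \<bar>t\<bar> * sin a"
    using c s sn by (subst power_mono_iff) auto
  finally have cone: "cos a * sqrt (t\<^sup>2 + s\<^sup>2) \<le> \<bar>t\<bar> \<longleftrightarrow> cos a * s \<le> \<bar>t\<bar> * sin a" .
  show ?thesis
  proof (cases "\<bar>t\<bar> < cos a")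
    case True
    then have c0: "0 < cos a" by linarith
    have "cos a * s \<le> \<bar>t\<bar> * sin a \<longleftrightarrow> s \<le> cap_radius a t"
      using True c0 by (simp add: cap_radius_def tan_def field_simps)
    moreover have "\<bar>t\<bar> * tan a \<le> sqrt (1 - t\<^sup>2)"
    proof (rule real_le_rsqrt)
      have "t\<^sup>2 \<le> (cos a)\<^sup>2" using True by (intro power2_le_iff_abs_le[THEN iffD2]) auto
      then have "t\<^sup>2 * (sin a)\<^sup>2 / (cos a)\<^sup>2 + t\<^sup>2 \<le> 1"
        using c0 by (simp add: sc field_simps)
      then show "(\<bar>t\<bar> * tan a)\<^sup>2 \<le> 1 - t\<^sup>2"
        by (simp add: tan_def power_mult_distrib power_divide)
    qed
    ultimately show ?thesis
      unfolding ball cone using True by (auto simp: cap_radius_def)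
  next
    case False
    have "cos a * s \<le> \<bar>t\<bar> * sin a" if "t\<^sup>2 + s\<^sup>2 \<le> 1"
    proof -
      have "cos a * sqrt (t\<^sup>2 + s\<^sup>2) \<le> cos a * 1"
        using that c by (intro mult_left_mono) auto
      then show ?thesis using False cone by simp
    qed
    then show ?thesis unfolding cone using ball False by (auto simp: cap_radius_def)
  qed
qed


text \<open>The angle between the lines, not the rays, through \<open>u\<close> and
  \<open>z\<close>: a normal vector is only determined up to a nonzero factor of either sign. At
  \<open>z = 0\<close> the value is \<open>pi / 2\<close>.\<close>

definition cap_angle :: "'a::euclidean_space \<Rightarrow> 'a \<Rightarrow> real" where
  "cap_angle u z = arccos \<bar>u \<bullet> sgn z\<bar>"

lemma cap_angle_bounds:
  assumes "norm u = 1"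
  shows "0 \<le> cap_angle u z" "cap_angle u z \<le> pi / 2" "cos (cap_angle u z) = \<bar>u \<bullet> sgn z\<bar>"
proof -
  have "\<bar>u \<bullet> sgn z\<bar> \<le> 1"
    using Cauchy_Schwarz_ineq2[of u "sgn z"] assms by (auto simp: norm_sgn split: if_splits)
  then show "0 \<le> cap_angle u z" "cap_angle u z \<le> pi / 2" "cos (cap_angle u z) = \<bar>u \<bullet> sgn z\<bar>"
    unfolding cap_angle_def using arccos_le_pi2[of "\<bar>u \<bullet> sgn z\<bar>"] by (auto intro: arccos_lbound)
qed

text \<open>Clamping the argument to [-1, 1] turns \<open>arccos\<close> into a continuous function
  on the whole line without changing the composition.\<close>

lemma borel_measurable_arccos:
  assumes [measurable]: "f \<in> borel_measurable M" and le: "\<And>x. \<bar>f x\<bar> \<le> 1"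
  shows "(\<lambda>x. arccos (f x)) \<in> borel_measurable M"
proof -
  have "(\<lambda>t::real. arccos (max (-1) (min 1 t))) \<in> borel_measurable borel"
    by (intro borel_measurable_continuous_onI continuous_intros) auto
  then have "(\<lambda>x. arccos (max (-1) (min 1 (f x)))) \<in> borel_measurable M" by measurable
  moreover have "max (-1) (min 1 (f x)) = f x" for x using le[of x] by auto
  ultimately show ?thesis by simp
qed

lemma abs_inner_sgn_le_1:
  assumes "norm u = 1"
  shows "\<bar>u \<bullet> sgn z\<bar> \<le> 1"
  using Cauchy_Schwarz_ineq2[of u "sgn z"] assms by (auto simp: norm_sgn split: if_splits)

lemma borel_measurable_cap_angle:
  assumes "norm u = 1"
  shows "cap_angle u \<in> borel_measurable borel"
  unfolding cap_angle_def[abs_def] using abs_inner_sgn_le_1[OF assms]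
  by (intro borel_measurable_arccos) auto

lemma cap_angle_le_iff:
  assumes u: "norm u = 1" and z: "z \<noteq> 0" and a: "0 \<le> a" "a \<le> pi / 2"
  shows "cap_angle u z \<le> a \<longleftrightarrow> cos a * norm z \<le> \<bar>z \<bullet> u\<bar>"
proof -
  note b = cap_angle_bounds[OF u, of z]
  have "cap_angle u z \<le> a \<longleftrightarrow> cos a \<le> cos (cap_angle u z)"
    using a b by (subst cos_mono_le_eq) auto
  also have "\<dots> \<longleftrightarrow> cos a * norm z \<le> \<bar>z \<bullet> u\<bar>"
    using z by (simp add: b sgn_div_norm inner_commute abs_mult field_simps)
  finally show ?thesis .
qed

text \<open>Cavalieri's principle along the coordinate \<open>u\<close>: the slice at height
  \<open>t\<close> is a ball of dimension \<open>k + 1\<close> and radius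
  \<open>cap_radius a t\<close>.\<close>

lemma emeasure_cap_Basis:
  fixes u :: "'a::euclidean_space"
  assumes u: "u \<in> Basis" and dim: "DIM('a) = k + 2" and a: "0 \<le> a" "a \<le> pi / 2"
  shows "emeasure lborel {z. norm z \<le> 1 \<and> cos a * norm z \<le> \<bar>z \<bullet> u\<bar>} =
    ennreal (unit_ball_vol (real (k + 1)) * (2 * ((real k + 1) / (real k + 2) * integral {0..a} (\<lambda>s. sin s ^ k))))"
proof -
  interpret product_sigma_finite "\<lambda>_::'a. lborel :: real measure" by standard
  let ?A = "{z::'a. norm z \<le> 1 \<and> cos a * norm z \<le> \<bar>z \<bullet> u\<bar>}"
  let ?B = "Basis - {u} :: 'a set"
  let ?S = "\<lambda>f. \<Sum>b\<in>Basis. f b *\<^sub>R b :: 'a"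
  have [measurable]: "?A \<in> sets borel" by measurable
  have Bu: "Basis = insert u ?B" "finite ?B" "u \<notin> ?B" using u by auto
  have cB: "card ?B = k + 1" using u dim by simp
  have B0: "?B \<noteq> {}"
  proof
    assume "?B = {}"
    then have "card ?B = 0" by (simp only: card.empty)
    then show False using cB by simp
  qed
  have mem: "?S (g(u := t)) \<in> ?A \<longleftrightarrow> t \<in> {-1..1} \<and> sqrt (\<Sum>i\<in>?B. (g i)\<^sup>2) \<le> cap_radius a t" for g t
  proof -
    have co: "?S (g(u := t)) \<bullet> b = (g(u := t)) b" if "b \<in> Basis" for b
      using that by (rule inner_sum_left_Basis)
    have "?S (g(u := t)) \<bullet> ?S (g(u := t)) = (\<Sum>b\<in>Basis. ((g(u := t)) b)\<^sup>2)"
      by (subst euclidean_inner) (simp add: co power2_eq_square del: fun_upd_apply)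
    also have "\<dots> = t\<^sup>2 + (\<Sum>b\<in>?B. (g b)\<^sup>2)"
      using u by (subst Bu(1), subst sum.insert) (auto intro!: sum.cong)
    finally have n: "norm (?S (g(u := t))) = sqrt (t\<^sup>2 + (\<Sum>b\<in>?B. (g b)\<^sup>2))"
      by (simp add: norm_eq_sqrt_inner)
    define s where "s = sqrt (\<Sum>b\<in>?B. (g b)\<^sup>2)"
    have nn: "0 \<le> (\<Sum>b\<in>?B. (g b)\<^sup>2)" by (intro sum_nonneg) auto
    then have s: "0 \<le> s" "s\<^sup>2 = (\<Sum>b\<in>?B. (g b)\<^sup>2)" by (auto simp: s_def)
    have "?S (g(u := t)) \<in> ?A \<longleftrightarrow> t\<^sup>2 + s\<^sup>2 \<le> 1 \<and> cos a * sqrt (t\<^sup>2 + s\<^sup>2) \<le> \<bar>t\<bar>"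
      unfolding mem_Collect_eq n co[OF u] s(2)[symmetric] by simp
    also have "\<dots> \<longleftrightarrow> \<bar>t\<bar> \<le> 1 \<and> s \<le> cap_radius a t"
      by (rule cap_radius_iff[OF a s(1)])
    finally show ?thesis by (auto simp: s_def)
  qed
  have R0: "0 \<le> cap_radius a t" if "t \<in> {-1..1}" for t
  proof -
    have "0 \<le> cos a" "0 \<le> sin a" using a by (auto intro: cos_ge_zero sin_ge_zero)
    then have "0 \<le> tan a" by (simp add: tan_def)
    then show ?thesis using that by (auto simp: cap_radius_def abs_square_le_1)
  qed
  have "emeasure lborel ?A = (\<integral>\<^sup>+z. indicator ?A z \<partial>lborel)" by simp
  also have "\<dots> = (\<integral>\<^sup>+f. indicator ?A (?S f) \<partial>Pi\<^sub>M Basis (\<lambda>_. lborel))"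
    by (subst lborel_eq, subst nn_integral_distr) auto
  also have "\<dots> = (\<integral>\<^sup>+f. indicator ?A (?S f) \<partial>Pi\<^sub>M (insert u ?B) (\<lambda>_. lborel))"
    by (subst (1) Bu(1)) simp
  also have "\<dots> = (\<integral>\<^sup>+t. \<integral>\<^sup>+g. indicator ?A (?S (g(u := t))) \<partial>Pi\<^sub>M ?B (\<lambda>_. lborel) \<partial>lborel)"
  proof (rule product_nn_integral_insert_rev)
    show "(\<lambda>f. indicator ?A (?S f)) \<in> borel_measurable (Pi\<^sub>M (insert u ?B) (\<lambda>_. lborel :: real measure))"
      by (subst Bu(1)[symmetric]) measurable
  qed auto
  also have "\<dots> = (\<integral>\<^sup>+t. indicator {-1..1} t * ennreal (unit_ball_vol (real (k + 1)) * cap_radius a t ^ (k + 1)) \<partial>lborel)"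
  proof (rule nn_integral_cong)
    fix t :: real
    let ?P = "Pi\<^sub>M ?B (\<lambda>_. lborel :: real measure)"
    let ?X = "{f. sqrt (\<Sum>i\<in>?B. (f i)\<^sup>2) \<le> cap_radius a t}"
    have "?X \<inter> space ?P = {f \<in> space ?P. sqrt (\<Sum>i\<in>?B. (f i)\<^sup>2) \<le> cap_radius a t}" by auto
    also have "\<dots> \<in> sets ?P" by measurable
    finally have Xm: "?X \<inter> space ?P \<in> sets ?P" .
    have "(\<integral>\<^sup>+g. indicator ?A (?S (g(u := t))) \<partial>?P) = (\<integral>\<^sup>+g. indicator {-1..1} t * indicator (?X \<inter> space ?P) g \<partial>?P)"
    proof (rule nn_integral_cong)
      fix g assume g: "g \<in> space ?P"
      have ind: "indicator A x = (indicator B y * indicator C z :: ennreal)"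
        if "x \<in> A \<longleftrightarrow> y \<in> B \<and> z \<in> C" for A B C and x :: 'a and y :: real and z :: "'a \<Rightarrow> real"
        using that by (auto simp: indicator_def)
      show "indicator ?A (?S (g(u := t))) = (indicator {-1..1} t * indicator (?X \<inter> space ?P) g :: ennreal)"
        by (rule ind) (use mem[of g t] g in blast)
    qed
    also have "\<dots> = indicator {-1..1} t * emeasure ?P (?X \<inter> space ?P)"
      using Xm by (subst nn_integral_cmult) auto
    also have "\<dots> = indicator {-1..1} t * ennreal (unit_ball_vol (real (k + 1)) * cap_radius a t ^ (k + 1))"
      using emeasure_cball_aux_nonneg[OF Bu(2) B0 R0, of t] cB by (auto simp: indicator_def)
    finally show "(\<integral>\<^sup>+g. indicator ?A (?S (g(u := t))) \<partial>?P) = 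
       indicator {-1..1} t * ennreal (unit_ball_vol (real (k + 1)) * cap_radius a t ^ (k + 1))" .
  qed
  also have "\<dots> = ennreal (unit_ball_vol (real (k + 1)) * (2 * ((real k + 1) / (real k + 2) * integral {0..a} (\<lambda>s. sin s ^ k))))"
    using nn_integral_has_integral_lebesgue[OF _ has_integral_mult_right[OF has_integral_cap_radius[OF a, of k],
        of "unit_ball_vol (real (k + 1))"]] R0
    by (simp add: ennreal_mult' ennreal_indicator)
  finally show ?thesis .
qed

text \<open>Rotation takes \<open>u\<close> to a basis vector, where the volume is known;
  \<open>omega n = n * unit_ball_vol n\<close> then absorbs the factors \<open>k + 1\<close> and
  \<open>k + 2\<close>.\<close>

lemma measure_cap_angle_le:
  fixes u :: "'a::euclidean_space"
  assumes u: "norm u = 1" and dim: "DIM('a) = k + 2" and a: "0 \<le> a" "a \<le> pi / 2"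
  shows "measure ball_measure {z. cap_angle u z \<le> a} =
    2 * omega (k + 1) / omega (k + 2) * integral {0..a} (\<lambda>s. sin s ^ k)"
proof -
  interpret prob_space "ball_measure :: 'a measure" by (rule prob_space_ball_measure)
  obtain b :: 'a where b: "b \<in> Basis" using nonempty_Basis by blast
  then have nb: "norm b = 1" by simp
  obtain f where f: "orthogonal_transformation f" "f b = u"
    using orthogonal_transformation_pair[of b u b u] u nb by (metis norm_eq_1)
  have fm [measurable]: "f \<in> borel_measurable borel"
    by (rule orthogonal_transformation_borel_measurable[OF f(1)])
  let ?C = "\<lambda>u. {z::'a. cos a * norm z \<le> \<bar>z \<bullet> u\<bar>}"
  have [measurable]: "?C v \<in> sets borel" for v by measurable
  have [measurable]: "cap_angle u \<in> borel_measurable borel"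
    by (rule borel_measurable_cap_angle[OF u])
  have "measure ball_measure {z. cap_angle u z \<le> a} = measure ball_measure (?C u)"
  proof (rule finite_measure_eq_AE)
    show "AE z in ball_measure. (z \<in> {z. cap_angle u z \<le> a}) = (z \<in> ?C u)"
      using AE_ball_measure_nonzero by eventually_elim (simp add: cap_angle_le_iff[OF u _ a])
  qed auto
  also have "\<dots> = measure (distr ball_measure borel f) (?C u)"
    by (simp add: ball_measure_distr_orthogonal[OF f(1)])
  also have "\<dots> = measure ball_measure (f -` ?C u)"
    by (subst measure_distr) auto
  also have "f -` ?C u = ?C b"
    using f(1) orthogonal_transformation_norm[OF f(1)]
    by (auto simp: f(2)[symmetric] orthogonal_transformation_def)
  also have "measure ball_measure (?C b) = measure lborel (cball 0 1 \<inter> ?C b) / measure lborel (cball (0::'a) 1)"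
    unfolding ball_measure_def
  proof (subst measure_uniform_measure)
    show "emeasure lborel (cball (0::'a) 1) \<noteq> 0"
      using unit_ball_vol_pos[of "real DIM('a)"] by (simp add: emeasure_unit_cball del: unit_ball_vol_pos)
  qed (auto simp: emeasure_unit_cball)
  also have "cball 0 1 \<inter> ?C b = {z. norm z \<le> 1 \<and> cos a * norm z \<le> \<bar>z \<bullet> b\<bar>}" by auto
  also have "measure lborel \<dots> = unit_ball_vol (real (k + 1)) * (2 * ((real k + 1) / (real k + 2) * integral {0..a} (\<lambda>s. sin s ^ k)))"
  proof -
    have "0 \<le> integral {0..a} (\<lambda>s. sin s ^ k)"
      using a by (intro Henstock_Kurzweil_Integration.integral_nonneg integrable_continuous_real continuous_intros)
        (auto intro!: zero_le_power sin_ge_zero)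
    then show ?thesis
      by (simp add: measure_def emeasure_cap_Basis[OF b dim a])
  qed
  also have "measure lborel (cball (0::'a) 1) = unit_ball_vol (real (k + 2))"
    by (simp add: measure_def emeasure_unit_cball dim)
  finally have *: "measure ball_measure {z. cap_angle u z \<le> a} =
      unit_ball_vol (real (k + 1)) * (2 * ((real k + 1) / (real k + 2) * integral {0..a} (\<lambda>s. sin s ^ k))) / unit_ball_vol (real (k + 2))" .
  have o: "omega n = real n * unit_ball_vol (real n)" if "n > 0" for n
    using kappa_eq_unit_ball_vol[OF that] that by (simp add: kappa_def field_simps)
  have "unit_ball_vol (real (k + 2)) > 0" by simp
  then show ?thesis unfolding * by (simp add: o field_simps)
qed


section \<open>The law of the angle between a fixed line and a uniform one\<close>

lemma nn_integral_sin_power: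
  fixes b x :: real
  assumes "0 \<le> c" "0 \<le> b" "b \<le> pi"
  shows "(\<integral>\<^sup>+s. ennreal (c * sin s ^ k * indicator {0..b} s) \<partial>lborel)
    = ennreal (c * integral {0..b} (\<lambda>s. sin s ^ k))"
proof -
  have "(\<lambda>s. c * sin s ^ k) integrable_on {0..b}"
    by (intro integrable_continuous_real continuous_intros)
  then have "((\<lambda>s. c * sin s ^ k) has_integral (c * integral {0..b} (\<lambda>s. sin s ^ k))) {0..b}"
    by (simp add: has_integral_iff)
  moreover have "0 \<le> c * sin s ^ k" if "s \<in> {0..b}" for s
    using that assms by (auto intro!: mult_nonneg_nonneg zero_le_power sin_ge_zero)
  ultimately have "(\<integral>\<^sup>+s. ennreal (indicator {0..b} s * (c * sin s ^ k)) \<partial>lborel)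
    = ennreal (c * integral {0..b} (\<lambda>s. sin s ^ k))"
    by (intro nn_integral_has_integral_lebesgue) auto
  then show ?thesis by (simp add: mult.commute)
qed

lemma omega_pos: "k > 0 \<Longrightarrow> omega k > 0"
  by (simp add: omega_def Gamma_real_pos)

text \<open>A finite Borel measure on the line is determined by its distribution function, here
  supplied by \<open>measure_cap_angle_le\<close>. The angle between lines stops at
  \<open>pi / 2\<close>, which doubles the density of the angle between rays.\<close>

lemma distr_cap_angle:
  fixes u :: "'a::euclidean_space"
  assumes u: "norm u = 1" and dim: "DIM('a) = k + 2"
  shows "distr ball_measure borel (cap_angle u) = density lborel
    (\<lambda>s. ennreal (2 * omega (k + 1) / omega (k + 2) * sin s ^ k * indicator {0..pi/2} s))"
    (is "?L = density lborel ?g")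
proof -
  interpret prob_space "ball_measure :: 'a measure" by (rule prob_space_ball_measure)
  have cm [measurable]: "cap_angle u \<in> borel_measurable borel"
    by (rule borel_measurable_cap_angle[OF u])
  have cm' [measurable]: "cap_angle u \<in> borel_measurable ball_measure"
    using cm measurable_cong_sets[OF sets_ball_measure refl] by blast
  define c where "c = 2 * omega (k + 1) / omega (k + 2)"
  have c: "0 \<le> c" unfolding c_def using omega_pos[of "k + 1"] omega_pos[of "k + 2"] by simp
  have gm [measurable]: "?g \<in> borel_measurable lborel" by measurable
  have eR: "emeasure (density lborel ?g) {..x}
      = (if x < 0 then 0 else ennreal (c * integral {0..min x (pi/2)} (\<lambda>s. sin s ^ k)))" for x
  proof -
    have "emeasure (density lborel ?g) {..x} = (\<integral>\<^sup>+s. ?g s * indicator {..x} s \<partial>lborel)"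
      by (rule emeasure_density) auto
    also have "\<dots> = (\<integral>\<^sup>+s. ennreal (c * sin s ^ k * indicator (if x < 0 then {} else {0..min x (pi/2)}) s) \<partial>lborel)"
      by (rule nn_integral_cong) (auto simp: indicator_def c_def)
    also have "\<dots> = (if x < 0 then 0 else ennreal (c * integral {0..min x (pi/2)} (\<lambda>s. sin s ^ k)))"
      using nn_integral_sin_power[OF c, of "min x (pi/2)"] pi_gt_zero
      by (auto simp: min_le_iff_disj)
    finally show ?thesis .
  qed
  have mL: "measure ?L {..x}
      = (if x < 0 then 0 else c * integral {0..min x (pi/2)} (\<lambda>s. sin s ^ k))" for x
  proof -
    note b = cap_angle_bounds[OF u]
    have "measure ?L {..x} = measure ball_measure {z. cap_angle u z \<le> x}"
      by (subst measure_distr) (auto simp: vimage_def)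
    also have "{z. cap_angle u z \<le> x} = (if x < 0 then {} else {z. cap_angle u z \<le> min x (pi/2)})"
      using b by (auto simp: not_le intro: order_trans) (meson b(1) less_le_trans not_le)
    finally show ?thesis
      using measure_cap_angle_le[OF u dim, of "min x (pi/2)"] by (auto simp: c_def)
  qed
  have nn: "0 \<le> c * integral {0..min x (pi/2)} (\<lambda>s. sin s ^ k)" if "0 \<le> x" for x
    using measure_nonneg[of ?L "{..x}"] that by (simp add: mL)
  show ?thesis
  proof (rule cdf_unique')
    show "cdf ?L = cdf (density lborel ?g)"
    proof
      fix x
      show "cdf ?L x = cdf (density lborel ?g) x"
        unfolding cdf_def mL unfolding measure_def eR using nn[of x] by simp
    qed
    have "prob_space ?L" using cm' by (rule prob_space_distr)
    then show "finite_borel_measure ?L"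
      unfolding finite_borel_measure_def finite_borel_measure_axioms_def
      by (simp add: prob_space_def)
    have "emeasure (density lborel ?g) UNIV = (\<integral>\<^sup>+s. ennreal (c * sin s ^ k * indicator {0..pi/2} s) \<partial>lborel)"
      unfolding c_def using gm by (subst emeasure_density) simp_all
    also have "\<dots> \<noteq> top"
      using nn_integral_sin_power[OF c, of "pi/2"] by simp
    finally have "finite_measure (density lborel ?g)" by (intro finite_measureI) simp
    then show "finite_borel_measure (density lborel ?g)"
      unfolding finite_borel_measure_def finite_borel_measure_axioms_def by simp
  qed
qed

lemma integral_reflect_pi:
  fixes f :: "real \<Rightarrow> real"
  assumes "continuous_on {0..pi} f"
  shows "integral {0..pi/2} (\<lambda>s. f (pi - s)) = integral {pi/2..pi} f"
proof -
  have "((\<lambda>x. - 1 *\<^sub>R f (pi - x)) has_integral (integral {pi - 0..pi - pi/2} f - integral {pi - pi/2..pi - 0} f)) {0..pi/2}"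
    using assms by (intro has_integral_substitution_general[where s = "{}" and c = 0 and d = pi])
      (auto intro!: continuous_intros derivative_eq_intros)
  moreover have "{pi..pi/2} = {}" using pi_gt_zero by simp
  ultimately have "((\<lambda>x. - f (pi - x)) has_integral (- integral {pi/2..pi} f)) {0..pi/2}" by simp
  from has_integral_neg[OF this] show ?thesis by (simp add: integral_unique)
qed

text \<open>Reflection at \<open>pi / 2\<close> preserves the sine and carries the second power on
  [0, pi/2] to the first power on [pi/2, pi], so the folded integral opens up to the single one over
  [0, pi].\<close>

lemma nn_integral_cap_angle_power:
  fixes u :: "'a::euclidean_space"
  assumes u: "norm u = 1" and dim: "DIM('a) = k + 2"
  shows "(\<integral>\<^sup>+z. ennreal ((1 - cap_angle u z / pi) ^ m + (cap_angle u z / pi) ^ m) \<partial>ball_measure)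
    = ennreal (2 * omega (k + 1) / omega (k + 2) * integral {0..pi} (\<lambda>s. (1 - s / pi) ^ m * sin s ^ k))"
proof -
  define c where "c = 2 * omega (k + 1) / omega (k + 2)"
  have c: "0 \<le> c" unfolding c_def using omega_pos[of "k + 1"] omega_pos[of "k + 2"] by simp
  define H where "H s = (1 - s / pi) ^ m + (s / pi) ^ m" for s :: real
  have [measurable]: "H \<in> borel_measurable borel" unfolding H_def[abs_def] by measurable
  have cm' [measurable]: "cap_angle u \<in> borel_measurable ball_measure"
    using borel_measurable_cap_angle[OF u] measurable_cong_sets[OF sets_ball_measure refl] by blast
  have "(\<integral>\<^sup>+z. ennreal (H (cap_angle u z)) \<partial>ball_measure)
      = (\<integral>\<^sup>+s. ennreal (H s) \<partial>distr ball_measure borel (cap_angle u))"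
    by (subst nn_integral_distr) auto
  also have "\<dots> = (\<integral>\<^sup>+s. ennreal (c * sin s ^ k * indicator {0..pi/2} s) * ennreal (H s) \<partial>lborel)"
    unfolding distr_cap_angle[OF u dim] c_def by (subst nn_integral_density) auto
  also have "\<dots> = (\<integral>\<^sup>+s. ennreal (indicator {0..pi/2} s * (c * (H s * sin s ^ k))) \<partial>lborel)"
  proof (rule nn_integral_cong)
    fix s
    have "0 \<le> c * sin s ^ k" if "s \<in> {0..pi/2}"
      using that c by (auto intro!: mult_nonneg_nonneg zero_le_power sin_ge_zero)
    then show "ennreal (c * sin s ^ k * indicator {0..pi/2} s) * ennreal (H s)
      = ennreal (indicator {0..pi/2} s * (c * (H s * sin s ^ k)))"
      by (auto simp: indicator_def ennreal_mult''[symmetric] mult_ac)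
  qed
  also have "\<dots> = ennreal (c * integral {0..pi/2} (\<lambda>s. H s * sin s ^ k))"
  proof (rule nn_integral_has_integral_lebesgue)
    show "0 \<le> c * (H s * sin s ^ k)" if "s \<in> {0..pi/2}" for s
      using that c by (auto simp: H_def field_simps intro!: mult_nonneg_nonneg add_nonneg_nonneg zero_le_power sin_ge_zero)
    show "((\<lambda>s. c * (H s * sin s ^ k)) has_integral (c * integral {0..pi/2} (\<lambda>s. H s * sin s ^ k))) {0..pi/2}"
      unfolding H_def
      by (intro has_integral_mult_right integrable_integral integrable_continuous_real continuous_intros)
        auto
  qed
  also have "integral {0..pi/2} (\<lambda>s. H s * sin s ^ k) = integral {0..pi} (\<lambda>s. (1 - s / pi) ^ m * sin s ^ k)"
  proof -
    let ?f = "\<lambda>s. (1 - s / pi) ^ m * sin s ^ k"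
    have f: "continuous_on S ?f" for S by (intro continuous_intros) auto
    have "integral {0..pi/2} (\<lambda>s. H s * sin s ^ k) = integral {0..pi/2} (\<lambda>s. ?f s + ?f (pi - s))"
      by (rule integral_cong) (simp add: H_def field_simps)
    also have "\<dots> = integral {0..pi/2} ?f + integral {0..pi/2} (\<lambda>s. ?f (pi - s))"
      by (intro Henstock_Kurzweil_Integration.integral_add integrable_continuous_real continuous_intros) auto
    also have "integral {0..pi/2} (\<lambda>s. ?f (pi - s)) = integral {pi/2..pi} ?f"
      by (rule integral_reflect_pi[OF f])
    also have "integral {0..pi/2} ?f + integral {pi/2..pi} ?f = integral {0..pi} ?f"
      by (intro Henstock_Kurzweil_Integration.integral_combine integrable_continuous_real f) auto
    finally show ?thesis .
  qed
  finally show ?thesis by (simp add: H_def c_def)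
qed

section \<open>The limit of the integral formula\<close>

text \<open>Transfers the first order error of \<open>sin x\<close> against \<open>x\<close> to
  powers, through \<open>x ^ Suc k - y ^ Suc k = x * (x ^ k - y ^ k) + y ^ k * (x -
  y)\<close>.\<close>

lemma power_diff_bound:
  fixes x y :: real
  assumes "0 \<le> y" "y \<le> x" "x - y \<le> x\<^sup>2 / 2" 
  shows "x ^ k - real k / 2 * x ^ (k + 1) \<le> y ^ k"
proof (induction k)
  case (Suc k)
  have x: "0 \<le> x" using assms by simp
  have "x ^ Suc k - y ^ Suc k = x * (x ^ k - y ^ k) + y ^ k * (x - y)"
    by (simp add: algebra_simps)
  also have "\<dots> \<le> x * (real k / 2 * x ^ (k + 1)) + x ^ k * (x\<^sup>2 / 2)"
    using Suc assms x by (intro add_mono mult_left_mono mult_mono power_mono) auto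
  also have "\<dots> = real (Suc k) / 2 * x ^ (Suc k + 1)"
    by (simp add: field_simps power2_eq_square)
  finally show ?case by simp
qed simp

lemma sin_power_bounds:
  fixes x :: real
  assumes "0 \<le> x" "x \<le> pi"
  shows "sin x ^ k \<le> x ^ k" "x ^ k - real k / 2 * x ^ (k + 1) \<le> sin x ^ k"
proof -
  have s: "0 \<le> sin x" using assms by (rule sin_ge_zero)
  have le: "sin x \<le> x" using assms by (intro sin_x_le_x)
  show "sin x ^ k \<le> x ^ k" using s le by (rule power_mono[rotated])
  have "\<bar>sin x - (\<Sum>m<2. sin_coeff m * x ^ m)\<bar> \<le> inverse (fact 2) * \<bar>x\<bar> ^ 2"
    by (rule Maclaurin_sin_bound)
  also have "(\<Sum>m<2. sin_coeff m * x ^ m) = x" by (simp add: numeral_2_eq_2 sin_coeff_def)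
  finally have "x - sin x \<le> x\<^sup>2 / 2" using abs_ge_minus_self[of "sin x - x"] by simp
  then show "x ^ k - real k / 2 * x ^ (k + 1) \<le> sin x ^ k"
    by (intro power_diff_bound s le)
qed

lemma has_integral_Beta_nat:
  "((\<lambda>t::real. (1 - t) ^ m * t ^ k) has_integral (fact k * fact m / fact (k + m + 1))) {0..1}"
proof -
  have "Beta (real k + 1) (real m + 1) = fact k * fact m / fact (k + m + 1)"
    using Gamma_fact[of k, where 'a=real] Gamma_fact[of m, where 'a=real]
      Gamma_fact[of "k + m + 1", where 'a=real]
    by (simp add: Beta_def add.commute add.left_commute)
  then have "((\<lambda>t. t powr (real k + 1 - 1) * (1 - t) powr (real m + 1 - 1)) has_integral
     (fact k * fact m / fact (k + m + 1))) {0..1}"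
    using has_integral_Beta_real[of "real k + 1" "real m + 1"] by simp
  then show ?thesis
    \<comment> \<open>At the endpoints \<open>0 powr 0 = 0\<close> and \<open>0 ^ 0 = 1\<close>
      disagree.\<close>
    by (rule has_integral_spike_finite[rotated 2, where S = "{0, 1}"])
       (auto simp: powr_realpow)
qed

lemma integral_one_minus_power:
  "((\<lambda>s. (1 - s / pi) ^ m * s ^ k) has_integral
      (pi ^ (k + 1) * (fact k * fact m / fact (k + m + 1)))) {0..pi}"
proof -
  let ?f = "\<lambda>s. (1 - s / pi) ^ m * s ^ k"
  have "((\<lambda>t. pi *\<^sub>R ?f (pi * t)) has_integral integral {pi * 0..pi * 1} ?f) {0..1}"
    by (intro has_integral_substitution[where c = 0 and d = pi])
      (auto intro!: continuous_intros derivative_eq_intros mult_left_le)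
  moreover have "(\<lambda>t. pi *\<^sub>R ?f (pi * t)) = (\<lambda>t. pi ^ (k + 1) * ((1 - t) ^ m * t ^ k))"
    by (simp add: fun_eq_iff power_mult_distrib)
  ultimately have "integral {0..pi} ?f = pi ^ (k + 1) * (fact k * fact m / fact (k + m + 1))"
    using has_integral_mult_right[OF has_integral_Beta_nat[of m k], of "pi ^ (k + 1)"]
    by (auto dest: has_integral_unique)
  moreover have "?f integrable_on {0..pi}"
    by (intro integrable_continuous_real continuous_intros) auto
  ultimately show ?thesis by (simp add: has_integral_iff)
qed

text \<open>With \<open>sin s\<close> replaced by \<open>s\<close> the integral is a Beta integral.
  The error term carries one more power of \<open>s\<close> and is therefore smaller by a factor of
  order \<open>1 / m\<close>.\<close>

lemma integral_sin_power_bounds: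
  defines "I \<equiv> \<lambda>m k. integral {0..pi} (\<lambda>s. (1 - s / pi) ^ m * sin s ^ k)"
  shows "I m k \<le> pi ^ (k + 1) * (fact k * fact m / fact (k + m + 1))"
    and "pi ^ (k + 1) * (fact k * fact m / fact (k + m + 1))
       - real k / 2 * (pi ^ (k + 2) * (fact (k + 1) * fact m / fact (k + m + 2))) \<le> I m k"
proof -
  have I: "((\<lambda>s. (1 - s / pi) ^ m * sin s ^ k) has_integral I m k) {0..pi}"
    unfolding I_def by (intro integrable_integral integrable_continuous_real continuous_intros) auto
  have p: "0 \<le> (1 - s / pi) ^ m" if "s \<in> {0..pi}" for s
    using that by (intro zero_le_power) (simp add: field_simps)
  show "I m k \<le> pi ^ (k + 1) * (fact k * fact m / fact (k + m + 1))"
    by (rule has_integral_le[OF I integral_one_minus_power])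
       (auto intro!: mult_left_mono sin_power_bounds p)
  have "((\<lambda>s. (1 - s / pi) ^ m * s ^ k - real k / 2 * ((1 - s / pi) ^ m * s ^ (k + 1))) has_integral
     (pi ^ (k + 1) * (fact k * fact m / fact (k + m + 1))
       - real k / 2 * (pi ^ (k + 1 + 1) * (fact (k + 1) * fact m / fact (k + 1 + m + 1))))) {0..pi}"
    by (intro has_integral_diff has_integral_mult_right integral_one_minus_power)
  then have "pi ^ (k + 1) * (fact k * fact m / fact (k + m + 1))
       - real k / 2 * (pi ^ (k + 1 + 1) * (fact (k + 1) * fact m / fact (k + 1 + m + 1))) \<le> I m k"
  proof (rule has_integral_le[OF _ I])
    fix s assume s: "s \<in> {0..pi}"
    have "(1 - s / pi) ^ m * (s ^ k - real k / 2 * s ^ (k + 1)) \<le> (1 - s / pi) ^ m * sin s ^ k"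
      using s by (intro mult_left_mono sin_power_bounds p) auto
    then show "(1 - s / pi) ^ m * s ^ k - real k / 2 * ((1 - s / pi) ^ m * s ^ (k + 1)) \<le> (1 - s / pi) ^ m * sin s ^ k"
      by (simp add: algebra_simps)
  qed
  then show "pi ^ (k + 1) * (fact k * fact m / fact (k + m + 1))
       - real k / 2 * (pi ^ (k + 2) * (fact (k + 1) * fact m / fact (k + m + 2))) \<le> I m k"
    by (simp add: add.commute add.left_commute)
qed

text \<open>The binomial coefficient cancels the factorials of the Beta value exactly, so the upper
  bound is already the limit and the lower bound differs from it by a constant over
  \<open>m + k + 2\<close>.\<close>

lemma tendsto_choose_integral:
  "(\<lambda>m. real ((m + (k + 1)) choose (k + 1)) * integral {0..pi} (\<lambda>s. (1 - s / pi) ^ m * sin s ^ k))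
     \<longlonglongrightarrow> pi ^ (k + 1) / real (k + 1)"
proof (rule tendsto_sandwich)
  let ?C = "\<lambda>m. real ((m + (k + 1)) choose (k + 1))"
  let ?I = "\<lambda>m. integral {0..pi} (\<lambda>s. (1 - s / pi) ^ m * sin s ^ k)"
  have C: "?C m = fact (k + m + 1) / (fact (k + 1) * fact m)" for m
    using binomial_fact[of "k + 1" "m + (k + 1)", where 'a=real] by (simp add: add_ac)
  have a: "?C m * (pi ^ (k + 1) * (fact k * fact m / fact (k + m + 1))) = pi ^ (k + 1) / real (k + 1)" for m
    unfolding C by (simp add: fact_Suc[of k] field_simps del: fact_Suc of_nat_Suc power_Suc)
  have b: "?C m * (real k / 2 * (pi ^ (k + 2) * (fact (k + 1) * fact m / fact (k + m + 2))))
      = real k / 2 * pi ^ (k + 2) * inverse (real (Suc (m + (k + 1))))" for m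
  proof -
    have "fact (k + m + 2) = real (Suc (m + (k + 1))) * fact (k + m + 1)"
      using fact_Suc[of "k + m + 1", where 'a=real] by (simp add: add_ac del: fact_Suc)
    then show ?thesis unfolding C by (simp add: field_simps del: fact_Suc of_nat_Suc power_Suc)
  qed
  show "\<forall>\<^sub>F m in sequentially. ?C m * ?I m \<le> pi ^ (k + 1) / real (k + 1)"
  proof (intro always_eventually allI)
    fix m
    have "?C m * ?I m \<le> ?C m * (pi ^ (k + 1) * (fact k * fact m / fact (k + m + 1)))"
      by (intro mult_left_mono integral_sin_power_bounds(1)) simp
    then show "?C m * ?I m \<le> pi ^ (k + 1) / real (k + 1)" unfolding a .
  qed
  show "\<forall>\<^sub>F m in sequentially. pi ^ (k + 1) / real (k + 1)
       - real k / 2 * pi ^ (k + 2) * inverse (real (Suc (m + (k + 1)))) \<le> ?C m * ?I m"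
  proof (intro always_eventually allI)
    fix m
    have "?C m * (pi ^ (k + 1) * (fact k * fact m / fact (k + m + 1))
       - real k / 2 * (pi ^ (k + 2) * (fact (k + 1) * fact m / fact (k + m + 2)))) \<le> ?C m * ?I m"
      by (intro mult_left_mono integral_sin_power_bounds(2)) simp
    then show "pi ^ (k + 1) / real (k + 1)
       - real k / 2 * pi ^ (k + 2) * inverse (real (Suc (m + (k + 1)))) \<le> ?C m * ?I m"
      unfolding right_diff_distrib[of "?C m"] a b .
  qed
  have "(\<lambda>m. inverse (real (Suc (m + (k + 1))))) \<longlonglongrightarrow> 0"
    using LIMSEQ_ignore_initial_segment[OF LIMSEQ_inverse_real_of_nat, of "k + 1"] .
  then have "(\<lambda>m. pi ^ (k + 1) / real (k + 1)
       - real k / 2 * pi ^ (k + 2) * inverse (real (Suc (m + (k + 1))))) \<longlonglongrightarrow>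
       pi ^ (k + 1) / real (k + 1) - real k / 2 * pi ^ (k + 2) * 0"
    by (intro tendsto_intros)
  then show "(\<lambda>m. pi ^ (k + 1) / real (k + 1)
       - real k / 2 * pi ^ (k + 2) * inverse (real (Suc (m + (k + 1))))) \<longlonglongrightarrow>
       pi ^ (k + 1) / real (k + 1)" by simp
qed simp

text \<open>Legendre's duplication formula at half integers. Raising \<open>k\<close> by one
  exchanges the two factors and shifts one of them by 1, so the functional equation of
  \<open>Gamma\<close> suffices for the induction.\<close>

lemma Gamma_half_product:
  "Gamma (real (k + 1) / 2) * Gamma (real (k + 2) / 2) = sqrt pi * fact k / 2 ^ k"
proof (induction k)
  case 0
  then show ?case by (simp add: Gamma_one_half_real)
next
  case (Suc k)
  have "real (k + 1) / 2 > 0" by simp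
  then have "real (k + 1) / 2 \<notin> \<int>\<^sub>\<le>\<^sub>0" using nonpos_Ints_nonpos[of "real (k + 1) / 2"] by auto
  then have "Gamma (real (k + 1) / 2 + 1) = real (k + 1) / 2 * Gamma (real (k + 1) / 2)"
    by (rule Gamma_plus1)
  moreover have "real (k + 1) / 2 + 1 = real (Suc k + 2) / 2" by simp
  ultimately have g: "Gamma (real (Suc k + 2) / 2) = real (k + 1) / 2 * Gamma (real (k + 1) / 2)"
    by (simp only:)
  have "Gamma (real (Suc k + 1) / 2) * Gamma (real (Suc k + 2) / 2)
     = real (k + 1) / 2 * (Gamma (real (k + 1) / 2) * Gamma (real (k + 2) / 2))"
    unfolding g by simp
  also have "\<dots> = sqrt pi * fact (Suc k) / 2 ^ Suc k"
    unfolding Suc.IH by (simp add: field_simps)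
  finally show ?case .
qed

lemma omega_product: "omega (k + 1) * omega (k + 2) = 2 ^ (k + 2) * pi ^ (k + 1) / fact k"
proof -
  have "pi powr (real (k + 1) / 2) * pi powr (real (k + 2) / 2) = pi powr (real (k + 1) + 1 / 2)"
  proof -
    have "real (k + 1) / 2 + real (k + 2) / 2 = real (k + 1) + 1 / 2" by (simp add: field_simps)
    then show ?thesis by (simp only: powr_add[symmetric])
  qed
  also have "\<dots> = pi ^ (k + 1) * sqrt pi"
    by (simp only: powr_add powr_half_sqrt[OF pi_ge_zero] powr_realpow[OF pi_gt_zero])
  finally have "omega (k + 1) * omega (k + 2)
     = 4 * (pi ^ (k + 1) * sqrt pi) / (Gamma (real (k + 1) / 2) * Gamma (real (k + 2) / 2))"
    by (simp add: omega_def del: power_Suc of_nat_Suc of_nat_add)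
  then show ?thesis unfolding Gamma_half_product by (simp add: field_simps)
qed

lemma tendsto_expected_facets:
  assumes d: "1 \<le> d"
  shows "(\<lambda>n. 2 * omega d / omega (d + 1) * real (n choose d) *
      integral {0..pi} (\<lambda>\<alpha>. (1 - \<alpha> / pi) ^ (n - d) * sin \<alpha> ^ (d - 1)))
      \<longlonglongrightarrow> fact d * kappa d ^ 2 / 2 ^ d"
proof -
  obtain k where k: "d = k + 1" using d by (metis le_add_diff_inverse add.commute)
  let ?c = "2 * omega d / omega (d + 1)"
  have pos: "omega d > 0" "omega (d + 1) > 0" by (simp_all add: k omega_def Gamma_real_pos)
  have "(\<lambda>m. ?c * (real ((m + (k + 1)) choose (k + 1)) * integral {0..pi} (\<lambda>s. (1 - s / pi) ^ m * sin s ^ k)))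
     \<longlonglongrightarrow> ?c * (pi ^ (k + 1) / real (k + 1))"
    by (intro tendsto_intros tendsto_choose_integral)
  then have "(\<lambda>m. ?c * real ((m + d) choose d) *
      integral {0..pi} (\<lambda>\<alpha>. (1 - \<alpha> / pi) ^ (m + d - d) * sin \<alpha> ^ (d - 1)))
      \<longlonglongrightarrow> ?c * (pi ^ (k + 1) / real (k + 1))"
    by (simp add: k mult.assoc)
  then have "(\<lambda>n. ?c * real (n choose d) *
      integral {0..pi} (\<lambda>\<alpha>. (1 - \<alpha> / pi) ^ (n - d) * sin \<alpha> ^ (d - 1)))
      \<longlonglongrightarrow> ?c * (pi ^ (k + 1) / real (k + 1))"
    by (rule LIMSEQ_offset)
  moreover have "?c * (pi ^ (k + 1) / real (k + 1)) = fact d * kappa d ^ 2 / 2 ^ d"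
  proof -
    \<comment> \<open>This removes \<open>omega (d + 1)\<close>: it cancels against the denominator
      of the constant, and a second factor \<open>omega d\<close> remains.\<close>
    have "pi ^ (k + 1) = omega d * omega (d + 1) * fact k / 2 ^ (k + 2)"
      using omega_product[of k] by (simp add: k field_simps)
    then have "?c * (pi ^ (k + 1) / real (k + 1)) = 2 * omega d ^ 2 * fact k / 2 ^ (k + 2) / real d"
      using pos by (simp add: k power2_eq_square del: power_Suc of_nat_Suc)
    also have "\<dots> = fact d * kappa d ^ 2 / 2 ^ d"
    proof -
      have "fact d = real d * fact k" "(2::real) ^ (k + 2) = 2 * 2 ^ d" "real d > 0" by (simp_all add: k)
      then show ?thesis by (simp add: kappa_def field_simps power2_eq_square)
    qed
    finally show ?thesis .
  qed
  ultimately show ?thesis by simp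
qed

section \<open>Facets of a finitely generated cone\<close>

text \<open>The coefficients are indexed by \<open>J\<close> and not by the set of points, since
  points may coincide on exceptional samples.\<close>

lemma convex_cone_hull_image:
  fixes x :: "'i \<Rightarrow> 'a::real_vector"
  assumes J: "finite J"
  shows "convex_cone hull (x ` J) = {\<Sum>i\<in>J. c i *\<^sub>R x i | c. \<forall>i\<in>J. 0 \<le> c i}" (is "_ = ?R")
proof
  have 0: "0 \<in> ?R" by (intro CollectI exI[of _ "\<lambda>_. 0"]) simp
  have 1: "u + v \<in> ?R" if uv: "u \<in> ?R" "v \<in> ?R" for u v
  proof -
    obtain c where c: "u = (\<Sum>i\<in>J. c i *\<^sub>R x i)" "\<forall>i\<in>J. 0 \<le> c i"
      using uv(1) by blast
    obtain c' where c': "v = (\<Sum>i\<in>J. c' i *\<^sub>R x i)" "\<forall>i\<in>J. 0 \<le> c' i"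
      using uv(2) by blast
    have "u + v = (\<Sum>i\<in>J. (c i + c' i) *\<^sub>R x i)"
      by (simp add: c c' scaleR_add_left sum.distrib)
    moreover have "\<forall>i\<in>J. 0 \<le> c i + c' i" using c c' by simp
    ultimately show ?thesis by (intro CollectI exI[of _ "\<lambda>i. c i + c' i"] conjI)
  qed
  have 2: "t *\<^sub>R u \<in> ?R" if ut: "u \<in> ?R" "0 \<le> t" for u t
  proof -
    obtain c where c: "u = (\<Sum>i\<in>J. c i *\<^sub>R x i)" "\<forall>i\<in>J. 0 \<le> c i"
      using ut(1) by blast
    then have "t *\<^sub>R u = (\<Sum>i\<in>J. (t * c i) *\<^sub>R x i)" by (simp add: scaleR_sum_right)
    moreover have "\<forall>i\<in>J. 0 \<le> t * c i" using c ut by simp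
    ultimately show ?thesis by (intro CollectI exI[of _ "\<lambda>i. t * c i"] conjI)
  qed
  have "convex_cone ?R"
    unfolding convex_cone_iff using 0 1 2 by blast
  moreover have "x ` J \<subseteq> ?R"
  proof
    fix y assume "y \<in> x ` J"
    then obtain j where j: "j \<in> J" "y = x j" by blast
    have "(\<Sum>i\<in>J. (if i = j then 1 else 0) *\<^sub>R x i) = x j"
      using J j by (subst sum.remove[of _ j]) auto
    then show "y \<in> ?R" using j by (intro CollectI exI[of _ "\<lambda>i. if i = j then 1 else 0"]) auto
  qed
  ultimately show "convex_cone hull (x ` J) \<subseteq> ?R" by (intro hull_minimal)
  show "?R \<subseteq> convex_cone hull (x ` J)"
  proof clarify
    fix c :: "'i \<Rightarrow> real" assume c: "\<forall>i\<in>J. 0 \<le> c i"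
    have "(\<Sum>i\<in>K. c i *\<^sub>R x i) \<in> convex_cone hull (x ` J)" if "K \<subseteq> J" for K
      using finite_subset[OF that J] that
    proof (induction K)
      case empty
      then show ?case by (simp add: convex_cone_hull_contains_0)
    next
      case (insert i K)
      then have "c i *\<^sub>R x i \<in> convex_cone hull (x ` J)"
        using c by (intro convex_cone_hull_mul hull_inc) auto
      then show ?case using insert by (simp add: convex_cone_hull_add)
    qed
    then show "(\<Sum>i\<in>J. c i *\<^sub>R x i) \<in> convex_cone hull (x ` J)" by simp
  qed
qed

lemma pos_hull_image:
  fixes x :: "'i \<Rightarrow> 'a::real_vector"
  assumes J: "finite J"
  shows "pos_hull (x ` J) = convex_cone hull (x ` J)"
proof
  show "pos_hull (x ` J) \<subseteq> convex_cone hull (x ` J)"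
  proof
    fix v assume "v \<in> pos_hull (x ` J)"
    then obtain F c where F: "finite F" "F \<subseteq> x ` J" "\<forall>y\<in>F. 0 \<le> c y" "v = (\<Sum>y\<in>F. c y *\<^sub>R y)"
      unfolding pos_hull_def by blast
    have "v \<in> {\<Sum>i\<in>F. c i *\<^sub>R id i | c. \<forall>i\<in>F. 0 \<le> c i}" using F by auto
    then have "v \<in> convex_cone hull (id ` F)" using convex_cone_hull_image[OF F(1), of id] by simp
    then show "v \<in> convex_cone hull (x ` J)" using hull_mono[OF F(2), of convex_cone] by auto
  qed
  show "convex_cone hull (x ` J) \<subseteq> pos_hull (x ` J)"
    unfolding convex_cone_hull_image[OF J]
  proof clarify
    fix c :: "'i \<Rightarrow> real" assume c: "\<forall>i\<in>J. 0 \<le> c i"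
    \<comment> \<open>Coefficients of coinciding points are added up.\<close>
    have "(\<Sum>i\<in>J. c i *\<^sub>R x i) = (\<Sum>y\<in>x ` J. (\<Sum>i\<in>{i \<in> J. x i = y}. c i *\<^sub>R x i))"
      by (rule sum.image_gen[OF J])
    also have "\<dots> = (\<Sum>y\<in>x ` J. (\<Sum>i\<in>{i \<in> J. x i = y}. c i) *\<^sub>R y)"
      by (intro sum.cong refl) (simp add: scaleR_sum_left)
    finally show "(\<Sum>i\<in>J. c i *\<^sub>R x i) \<in> pos_hull (x ` J)"
      unfolding pos_hull_def using J c
      by (intro CollectI exI[of _ "x ` J"] exI[of _ "\<lambda>y. \<Sum>i\<in>{i \<in> J. x i = y}. c i"])
        (auto intro!: sum_nonneg)
  qed
qed

lemma conic_Int_sphere_subset: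
  fixes C D :: "'a::real_normed_vector set"
  assumes C: "conic C" and D: "conic D" "0 \<in> D" and sub: "C \<inter> sphere 0 1 \<subseteq> D"
  shows "C \<subseteq> D"
proof
  fix v assume v: "v \<in> C"
  show "v \<in> D"
  proof (cases "v = 0")
    case False
    have "sgn v \<in> C" using C v unfolding sgn_div_norm by (auto intro: conic_mul)
    then have "sgn v \<in> D" using sub False by (auto simp: norm_sgn)
    then have "norm v *\<^sub>R sgn v \<in> D" using D(1) by (auto intro: conic_mul)
    then show ?thesis using False by (simp add: sgn_div_norm)
  qed (simp add: D)
qed

lemma conic_Int_sphere_eq:
  fixes C D :: "'a::real_normed_vector set"
  assumes "conic C" "0 \<in> C" "conic D" "0 \<in> D" "C \<inter> sphere 0 1 = D \<inter> sphere 0 1"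
  shows "C = D"
  using conic_Int_sphere_subset[of C D] conic_Int_sphere_subset[of D C] assms by blast

text \<open>A cone is determined by its trace on the sphere, so the cone under the existential
  quantifier of \<open>sph_face\<close> can only be \<open>C\<close>. If \<open>C\<close> contains a
  line, there is no face at all.\<close>

lemma sph_face_iff:
  fixes C :: "'a::euclidean_space set"
  assumes C: "polyhedron C" "convex_cone C"
  shows "sph_face k F (C \<inter> sphere 0 1) \<longleftrightarrow> C \<inter> uminus ` C = {0} \<and>
      (\<exists>G. G face_of C \<and> aff_dim G = int (k + 1) \<and> F = G \<inter> sphere 0 1)"
proof -
  have eq: "C' = C" if C': "pointed_polyhedral_cone C'" and int: "C \<inter> sphere 0 1 = C' \<inter> sphere 0 1" for C'
  proof -
    have "convex_cone C'" using C' by (simp add: pointed_polyhedral_cone_def)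
    then have "conic C'" "0 \<in> C'" by (simp_all add: convex_cone_contains_0 convex_cone_def)
    moreover have "conic C" "0 \<in> C" using C by (simp_all add: convex_cone_contains_0 convex_cone_def)
    ultimately show ?thesis using conic_Int_sphere_eq[OF _ _ _ _ int[symmetric]] by blast
  qed
  have "pointed_polyhedral_cone C \<longleftrightarrow> C \<inter> uminus ` C = {0}"
    using C by (simp add: pointed_polyhedral_cone_def)
  note ppc = this
  show ?thesis
  proof
    assume "sph_face k F (C \<inter> sphere 0 1)"
    then obtain C' G where G: "pointed_polyhedral_cone C'" "C \<inter> sphere 0 1 = C' \<inter> sphere 0 1"
      "G face_of C'" "aff_dim G = int (k + 1)" "F = G \<inter> sphere 0 1"
      unfolding sph_face_def by blast
    have "C' = C" using G by (intro eq)
    then show "C \<inter> uminus ` C = {0} \<and> (\<exists>G. G face_of C \<and> aff_dim G = int (k + 1) \<and> F = G \<inter> sphere 0 1)"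
      using G ppc by blast
  next
    assume "C \<inter> uminus ` C = {0} \<and> (\<exists>G. G face_of C \<and> aff_dim G = int (k + 1) \<and> F = G \<inter> sphere 0 1)"
    then show "sph_face k F (C \<inter> sphere 0 1)"
      unfolding sph_face_def using ppc by blast
  qed
qed

text \<open>On the hyperplane a sum of nonpositive terms vanishes, hence every term does, and only
  generators inside the hyperplane keep a positive coefficient.\<close>

lemma convex_cone_hull_Int_hyperplane:
  fixes x :: "'i \<Rightarrow> 'a::real_inner"
  assumes J: "finite J" and a: "\<And>i. i \<in> J \<Longrightarrow> a \<bullet> x i \<le> 0"
  shows "convex_cone hull (x ` J) \<inter> {v. a \<bullet> v = 0} = convex_cone hull (x ` {i \<in> J. a \<bullet> x i = 0})"
    and "v \<in> convex_cone hull (x ` J) \<Longrightarrow> a \<bullet> v \<le> 0"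
proof -
  let ?I = "{i \<in> J. a \<bullet> x i = 0}"
  have av: "a \<bullet> (\<Sum>i\<in>K. c i *\<^sub>R x i) = (\<Sum>i\<in>K. c i * (a \<bullet> x i))" for c K
    by (simp add: inner_sum_right)
  show "a \<bullet> v \<le> 0" if "v \<in> convex_cone hull (x ` J)" for v
    using that a unfolding convex_cone_hull_image[OF J]
    by (auto simp: av intro!: sum_nonpos mult_nonneg_nonpos)
  show "convex_cone hull (x ` J) \<inter> {v. a \<bullet> v = 0} = convex_cone hull (x ` ?I)"
  proof
    show "convex_cone hull (x ` J) \<inter> {v. a \<bullet> v = 0} \<subseteq> convex_cone hull (x ` ?I)"
    proof clarify
      fix v assume v: "v \<in> convex_cone hull (x ` J)" "a \<bullet> v = 0"
      then obtain c where c: "v = (\<Sum>i\<in>J. c i *\<^sub>R x i)" "\<And>i. i \<in> J \<Longrightarrow> 0 \<le> c i"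
        unfolding convex_cone_hull_image[OF J] by blast
      have "(\<Sum>i\<in>J. - (c i * (a \<bullet> x i))) = 0" using v(2) by (simp add: c(1) av sum_negf)
      moreover have "0 \<le> - (c i * (a \<bullet> x i))" if "i \<in> J" for i
        using a[OF that] c(2)[OF that] by (simp add: mult_nonneg_nonpos)
      ultimately have "\<forall>i\<in>J. - (c i * (a \<bullet> x i)) = 0"
        using J by (subst (asm) sum_nonneg_eq_0_iff) auto
      then have "v = (\<Sum>i\<in>?I. c i *\<^sub>R x i)"
        unfolding c(1) using J by (intro sum.mono_neutral_right) auto
      then show "v \<in> convex_cone hull (x ` ?I)"
        using J c(2) by (subst convex_cone_hull_image) auto
    qed
    show "convex_cone hull (x ` ?I) \<subseteq> convex_cone hull (x ` J) \<inter> {v. a \<bullet> v = 0}"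
    proof (rule Int_greatest)
      show "convex_cone hull (x ` ?I) \<subseteq> convex_cone hull (x ` J)" by (rule hull_mono) auto
      show "convex_cone hull (x ` ?I) \<subseteq> {v. a \<bullet> v = 0}"
        using J by (subst convex_cone_hull_image) (auto simp: av)
    qed
  qed
qed

lemma aff_dim_convex_cone_hull:
  fixes S :: "'a::euclidean_space set"
  shows "aff_dim (convex_cone hull S) = int (dim S)"
proof -
  have "convex_cone hull S \<subseteq> span S"
    by (intro hull_minimal subspace_imp_convex_cone subspace_span span_superset)
  then have "span (convex_cone hull S) = span S"
    by (metis hull_subset span_mono span_span subset_antisym)
  then have "dim (convex_cone hull S) = dim S" by (metis dim_span)
  moreover have "0 \<in> affine hull (convex_cone hull S)"
    by (intro hull_inc convex_cone_hull_contains_0)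
  ultimately show ?thesis by (simp add: aff_dim_zero)
qed

text \<open>Strictness outside \<open>I\<close> makes \<open>I\<close> the complete set of indices
  on the exposed face, so that faces correspond to index sets one to one even on degenerate
  samples.\<close>

definition supporting_index :: "'i set \<Rightarrow> ('i \<Rightarrow> 'a::euclidean_space) \<Rightarrow> 'i set \<Rightarrow> bool" where
  "supporting_index J x I \<longleftrightarrow> (\<exists>a. (\<forall>i\<in>I. a \<bullet> x i = 0) \<and> (\<forall>i\<in>J - I. a \<bullet> x i < 0))"

text \<open>Faces of a polyhedron are exposed; the normal of a supporting hyperplane separates the
  generators into those on the face and those strictly to one side.\<close>

lemma face_of_convex_cone_hull_iff:
  fixes x :: "'i \<Rightarrow> 'a::euclidean_space"
  assumes J: "finite J"
  shows "G face_of convex_cone hull (x ` J) \<and> G \<noteq> {} \<longleftrightarrow>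
    (\<exists>I\<subseteq>J. supporting_index J x I \<and> G = convex_cone hull (x ` I))" (is "?L \<longleftrightarrow> ?R")
proof
  let ?C = "convex_cone hull (x ` J)"
  assume ?L
  then have "G exposed_face_of ?C" "G \<noteq> {}"
    using exposed_face_of_polyhedron[OF polyhedron_convex_cone_hull[OF finite_imageI[OF J]]] by blast+
  then obtain a b where ab: "?C \<subseteq> {v. a \<bullet> v \<le> b}" "G = ?C \<inter> {v. a \<bullet> v = b}"
    unfolding exposed_face_of_def by blast
  have "0 \<le> b" using ab(1) convex_cone_hull_contains_0[of "x ` J"] by auto
  obtain v where v: "v \<in> ?C" "a \<bullet> v = b" using ab(2) \<open>G \<noteq> {}\<close> by blast
  \<comment> \<open>A cone contains the double of each of its points, which forces a supporting
    hyperplane that meets it to pass through 0.\<close>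
  then have "2 *\<^sub>R v \<in> ?C" by (intro convex_cone_hull_mul) auto
  then have "a \<bullet> (2 *\<^sub>R v) \<le> b" using ab(1) by blast
  then have "b = 0" using v \<open>0 \<le> b\<close> by simp
  have a: "a \<bullet> x i \<le> 0" if "i \<in> J" for i
    using ab(1) that hull_inc[of "x i" "x ` J" convex_cone] \<open>b = 0\<close> by auto
  let ?I = "{i \<in> J. a \<bullet> x i = 0}"
  have "a \<bullet> x i < 0" if "i \<in> J - ?I" for i
    using a[of i] that by (cases "a \<bullet> x i" "0::real" rule: linorder_cases) auto
  then have "supporting_index J x ?I"
    unfolding supporting_index_def by (intro exI[of _ a]) blast
  moreover have "G = convex_cone hull (x ` ?I)"
    using convex_cone_hull_Int_hyperplane(1)[of J a x] J a ab(2) \<open>b = 0\<close> by simp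
  ultimately show ?R by (intro exI[of _ ?I] conjI Collect_subset)
next
  assume ?R
  then obtain I where I: "I \<subseteq> J" "G = convex_cone hull (x ` I)" "supporting_index J x I"
    by blast
  then obtain a where a: "\<forall>i\<in>I. a \<bullet> x i = 0" "\<forall>i\<in>J - I. a \<bullet> x i < 0"
    unfolding supporting_index_def by blast
  have a': "a \<bullet> x i \<le> 0" if "i \<in> J" for i using a that by (cases "i \<in> I") (auto simp: less_imp_le)
  have "a \<bullet> x i \<noteq> 0" if "i \<in> J - I" for i using a(2) that by force
  then have "{i \<in> J. a \<bullet> x i = 0} = I" using a(1) I(1) by blast
  then have "G = convex_cone hull (x ` J) \<inter> {v. a \<bullet> v = 0}"
    using convex_cone_hull_Int_hyperplane(1)[of J a x] J a' I by simp
  moreover have "convex_cone hull (x ` J) \<inter> {v. a \<bullet> v = 0} face_of convex_cone hull (x ` J)"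
    by (rule face_of_Int_supporting_hyperplane_le[OF convex_convex_cone_hull])
      (rule convex_cone_hull_Int_hyperplane(2)[OF J a'])
  moreover have "G \<noteq> {}" unfolding I(2) by (rule convex_cone_hull_nonempty)
  ultimately show ?L by simp
qed

text \<open>The normal vanishes on the whole face and is negative at all other generators. This
  makes the passage from index sets to faces injective.\<close>

lemma supporting_index_eq:
  fixes x :: "'i \<Rightarrow> 'a::euclidean_space"
  assumes J: "finite J" and I: "I \<subseteq> J" "supporting_index J x I"
  shows "{i \<in> J. x i \<in> convex_cone hull (x ` I)} = I"
proof -
  obtain a where a: "\<forall>i\<in>I. a \<bullet> x i = 0" "\<forall>i\<in>J - I. a \<bullet> x i < 0"
    using I unfolding supporting_index_def by blast
  have fI: "finite I" using I(1) J by (rule finite_subset)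
  have "a \<bullet> v = 0" if "v \<in> convex_cone hull (x ` I)" for v
    using that a(1) unfolding convex_cone_hull_image[OF fI] by (auto simp: inner_sum_right)
  then show ?thesis using a(2) I(1) by (force intro: hull_inc)
qed

text \<open>A face is sent to the set of indices of the generators on it, with the cone hull as
  inverse map; if the cone is not pointed, both sides are 0. No general position is assumed, so the
  count is available at every sample point.\<close>

lemma f_number_sph_hull:
  fixes x :: "'i \<Rightarrow> 'a::euclidean_space"
  assumes J: "finite J" and d: "1 \<le> d"
  defines "C \<equiv> convex_cone hull (x ` J)"
  shows "f_number (d - 1) (sph_hull (x ` J)) =
    card {I. I \<subseteq> J \<and> C \<inter> uminus ` C = {0} \<and> supporting_index J x I \<and> dim (x ` I) = d}"
proof (cases "C \<inter> uminus ` C = {0}")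
  case True
  let ?G = "{G. G face_of C \<and> aff_dim G = int d}"
  have C: "polyhedron C" "convex_cone C"
    using J by (auto simp: C_def polyhedron_convex_cone_hull convex_cone_convex_cone_hull)
  have P: "sph_hull (x ` J) = C \<inter> sphere 0 1"
    by (auto simp: sph_hull_def pos_hull_image[OF J] C_def)
  have ne: "G \<noteq> {}" if "aff_dim G = int d" for G :: "'a set" using that d by auto
  have face: "G face_of C \<and> aff_dim G = int d \<longleftrightarrow>
      (\<exists>I\<subseteq>J. supporting_index J x I \<and> dim (x ` I) = d \<and> G = convex_cone hull (x ` I))" for G
  proof -
    have "G face_of C \<and> aff_dim G = int d \<longleftrightarrow> (G face_of convex_cone hull (x ` J) \<and> G \<noteq> {}) \<and> aff_dim G = int d"
      using ne[of G] by (auto simp: C_def)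
    also have "\<dots> \<longleftrightarrow> (\<exists>I\<subseteq>J. supporting_index J x I \<and> G = convex_cone hull (x ` I)) \<and> aff_dim G = int d"
      unfolding face_of_convex_cone_hull_iff[OF J] ..
    also have "\<dots> \<longleftrightarrow> (\<exists>I\<subseteq>J. supporting_index J x I \<and> dim (x ` I) = d \<and> G = convex_cone hull (x ` I))"
      by (auto simp: aff_dim_convex_cone_hull)
    finally show ?thesis .
  qed
  have faceE: "\<exists>I\<in>{I. I \<subseteq> J \<and> supporting_index J x I \<and> dim (x ` I) = d}. G = convex_cone hull (x ` I)"
    if "G \<in> ?G" for G
  proof -
    have "G face_of C \<and> aff_dim G = int d" using that by simp
    then have "\<exists>I\<subseteq>J. supporting_index J x I \<and> dim (x ` I) = d \<and> G = convex_cone hull (x ` I)"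
      unfolding face .
    then show ?thesis by blast
  qed
  have "{F. sph_face (d - 1) F (sph_hull (x ` J))} = (\<lambda>G. G \<inter> sphere 0 1) ` ?G"
  proof -
    have "int (d - 1 + 1) = int d" using d by simp
    then have "sph_face (d - 1) F (C \<inter> sphere 0 1) \<longleftrightarrow> (\<exists>G. G face_of C \<and> aff_dim G = int d \<and> F = G \<inter> sphere 0 1)" for F
      using sph_face_iff[OF C, of "d - 1" F] True by simp
    then show ?thesis unfolding P by blast
  qed
  moreover have "inj_on (\<lambda>G. G \<inter> sphere 0 1) ?G"
  proof (rule inj_onI)
    have cone: "conic G \<and> 0 \<in> G" if G: "G \<in> ?G" for G
    proof -
      obtain I where "G = convex_cone hull (x ` I)" using faceE[OF G] by blast
      then show ?thesis by (simp add: conic_convex_cone_hull convex_cone_hull_contains_0)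
    qed
    fix G G' assume "G \<in> ?G" "G' \<in> ?G" and eq: "G \<inter> sphere 0 1 = G' \<inter> sphere 0 1"
    then have "conic G \<and> 0 \<in> G" "conic G' \<and> 0 \<in> G'" using cone by blast+
    then show "G = G'" using conic_Int_sphere_eq[OF _ _ _ _ eq] by blast
  qed
  ultimately have "f_number (d - 1) (sph_hull (x ` J)) = card ?G"
    unfolding f_number_def by (simp add: card_image)
  also have "\<dots> = card {I. I \<subseteq> J \<and> supporting_index J x I \<and> dim (x ` I) = d}"
  proof (rule bij_betw_same_card)
    show "bij_betw (\<lambda>G. {i \<in> J. x i \<in> G}) ?G {I. I \<subseteq> J \<and> supporting_index J x I \<and> dim (x ` I) = d}"
    proof (rule bij_betw_byWitness[where f' = "\<lambda>I. convex_cone hull (x ` I)"])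
      let ?S = "{I. I \<subseteq> J \<and> supporting_index J x I \<and> dim (x ` I) = d}"
      have G: "\<exists>I\<in>?S. G = convex_cone hull (x ` I)" if "G \<in> ?G" for G
        using that by (rule faceE)
      have S: "{i \<in> J. x i \<in> convex_cone hull (x ` I)} = I" if "I \<in> ?S" for I
        using that by (intro supporting_index_eq[OF J]) auto
      show "\<forall>G\<in>?G. convex_cone hull (x ` {i \<in> J. x i \<in> G}) = G"
      proof
        fix G assume "G \<in> ?G"
        then obtain I where "I \<in> ?S" "G = convex_cone hull (x ` I)" using G by blast
        then show "convex_cone hull (x ` {i \<in> J. x i \<in> G}) = G" using S by simp
      qed
      show "\<forall>I\<in>?S. {i \<in> J. x i \<in> convex_cone hull (x ` I)} = I" using S by blast
      show "(\<lambda>G. {i \<in> J. x i \<in> G}) ` ?G \<subseteq> ?S"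
      proof
        fix K assume "K \<in> (\<lambda>G. {i \<in> J. x i \<in> G}) ` ?G"
        then obtain G where K: "G \<in> ?G" "K = {i \<in> J. x i \<in> G}" by blast
        then obtain I where I: "I \<in> ?S" "G = convex_cone hull (x ` I)" using G by blast
        have "K = I" using S[OF I(1)] unfolding K(2) I(2) .
        then show "K \<in> ?S" using I by simp
      qed
      show "(\<lambda>I. convex_cone hull (x ` I)) ` ?S \<subseteq> ?G"
      proof
        fix G assume "G \<in> (\<lambda>I. convex_cone hull (x ` I)) ` ?S"
        then obtain I where I: "I \<in> ?S" "G = convex_cone hull (x ` I)" by blast
        then have "\<exists>I\<subseteq>J. supporting_index J x I \<and> dim (x ` I) = d \<and> G = convex_cone hull (x ` I)"
          by blast
        then have "G face_of C \<and> aff_dim G = int d" unfolding face .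
        then show "G \<in> ?G" by simp
      qed
    qed
  qed
  finally show ?thesis using True by simp
next
  case False
  have C: "polyhedron C" "convex_cone C"
    using J by (auto simp: C_def polyhedron_convex_cone_hull convex_cone_convex_cone_hull)
  have "sph_hull (x ` J) = C \<inter> sphere 0 1"
    by (auto simp: sph_hull_def pos_hull_image[OF J] C_def)
  then have "{F. sph_face (d - 1) F (sph_hull (x ` J))} = {}"
    using sph_face_iff[OF C, of "d - 1"] False by simp
  then show ?thesis using False by (simp add: f_number_def)
qed

section \<open>Measurability of the facet structure\<close>

text \<open>The probability space need not be complete, so the number of facets has to be measurable on
  degenerate samples as well; there the facets are found by projecting along compact sets.\<close>
lemma sets_Collect_compact_ex:
  fixes g :: "'b::euclidean_space \<Rightarrow> 'c \<Rightarrow> real"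
  assumes K: "compact K"
    and cont: "\<And>w. w \<in> space M \<Longrightarrow> continuous_on K (\<lambda>a. g a w)"
    and meas: "\<And>a. a \<in> K \<Longrightarrow> g a \<in> borel_measurable M"
  shows "{w \<in> space M. \<exists>a\<in>K. g a w \<le> 0} \<in> sets M"
proof -
  obtain D where D: "countable D" "D \<subseteq> K" "K \<subseteq> closure D"
    using separable[of K] by blast
  \<comment> \<open>The uncountable quantifier becomes countably many strict inequalities over a
    dense set: one direction is continuity, the other the attainment of the minimum on the compact
    set \<open>K\<close>.\<close>
  have iff: "(\<exists>a\<in>K. g a w \<le> 0) \<longleftrightarrow> (\<forall>n::nat. \<exists>a\<in>D. g a w < inverse (real (Suc n)))"
    if w: "w \<in> space M" for w
  proof
    assume "\<exists>a\<in>K. g a w \<le> 0"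
    then obtain a where a: "a \<in> K" "g a w \<le> 0" by blast
    show "\<forall>n::nat. \<exists>a\<in>D. g a w < inverse (real (Suc n))"
    proof
      fix n
      define \<epsilon> where "\<epsilon> = inverse (real (Suc n))"
      have "\<epsilon> > 0" by (simp add: \<epsilon>_def)
      then obtain \<delta> where \<delta>: "\<delta> > 0" "\<And>b. b \<in> K \<Longrightarrow> dist b a < \<delta> \<Longrightarrow> dist (g b w) (g a w) < \<epsilon>"
        using cont[OF w] a(1) unfolding continuous_on_iff by metis
      obtain b where b: "b \<in> D" "dist b a < \<delta>"
        using D(3) a(1) \<delta>(1) by (meson closure_approachable subsetD)
      then have "dist (g b w) (g a w) < \<epsilon>" using \<delta>(2) D(2) by blast
      then have "g b w < \<epsilon>" using a(2) by (simp add: dist_real_def abs_less_iff)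
      then show "\<exists>a\<in>D. g a w < inverse (real (Suc n))" using b unfolding \<epsilon>_def by blast
    qed
  next
    assume *: "\<forall>n::nat. \<exists>a\<in>D. g a w < inverse (real (Suc n))"
    then have "K \<noteq> {}" using D(2) by blast
    then obtain a where a: "a \<in> K" "\<And>b. b \<in> K \<Longrightarrow> g a w \<le> g b w"
      using continuous_attains_inf[OF K _ cont[OF w]] by blast
    have "g a w \<le> inverse (real (Suc n))" for n
    proof -
      obtain b where "b \<in> D" "g b w < inverse (real (Suc n))" using * by blast
      then show ?thesis using a(2)[of b] D(2) by fastforce
    qed
    then have "g a w \<le> 0"
      by (intro LIMSEQ_le_const[OF LIMSEQ_inverse_real_of_nat]) auto
    then show "\<exists>a\<in>K. g a w \<le> 0" using a(1) by blast
  qed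
  have "{w \<in> space M. \<exists>a\<in>K. g a w \<le> 0}
      = {w \<in> space M. \<forall>n::nat. \<exists>a\<in>D. g a w < inverse (real (Suc n))}"
    using iff by blast
  also have "\<dots> \<in> sets M"
  proof (intro sets.sets_Collect_countable_All sets.sets_Collect_countable_Ex' D(1))
    fix n a assume "a \<in> D"
    then have [measurable]: "g a \<in> borel_measurable M" using D(2) meas by blast
    show "{w \<in> space M. g a w < inverse (real (Suc n))} \<in> sets M" by measurable
  qed
  finally show ?thesis .
qed

lemma sum_nonneg_le_0_iff:
  fixes f :: "'i \<Rightarrow> real"
  assumes "finite I" "\<And>i. i \<in> I \<Longrightarrow> 0 \<le> f i"
  shows "sum f I \<le> 0 \<longleftrightarrow> (\<forall>i\<in>I. f i = 0)"
  using sum_nonneg_eq_0_iff[of I f] sum_nonneg[of I f] assms by (metis order_antisym order_refl)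

text \<open>Strict inequalities are not a closed condition, but scaling the normal turns them into
  \<open>a \<bullet> x i \<le> - 1\<close>. The price is an unbounded normal, so the space is
  exhausted by countably many balls.\<close>

lemma supporting_index_iff_bounded:
  fixes x :: "'i \<Rightarrow> 'a::euclidean_space"
  assumes J: "finite J" and I: "I \<subseteq> J"
  shows "supporting_index J x I \<longleftrightarrow> (\<exists>k::nat. \<exists>a\<in>cball 0 (real k).
      (\<Sum>i\<in>I. \<bar>a \<bullet> x i\<bar>) + (\<Sum>i\<in>J - I. max 0 (a \<bullet> x i + 1)) \<le> 0)"
proof
  have fI: "finite I" using I J by (rule finite_subset)
  assume "supporting_index J x I"
  then obtain a where a: "\<And>i. i \<in> I \<Longrightarrow> a \<bullet> x i = 0" "\<And>i. i \<in> J - I \<Longrightarrow> a \<bullet> x i < 0"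
    unfolding supporting_index_def by blast
  \<comment> \<open>A factor above every \<open>inverse (- (a \<bullet> x i))\<close>; a sum, unlike
    a maximum, also makes sense if \<open>J - I\<close> is empty.\<close>
  define t where "t = (\<Sum>i\<in>J - I. inverse (- (a \<bullet> x i)))"
  have t: "inverse (- (a \<bullet> x i)) \<le> t" if "i \<in> J - I" for i
    unfolding t_def using that J a(2)
    by (intro member_le_sum) (auto simp: less_imp_le)
  have "(t *\<^sub>R a) \<bullet> x i + 1 \<le> 0" if "i \<in> J - I" for i
    using t[OF that] a(2)[OF that] by (simp add: field_simps)
  then have "(\<Sum>i\<in>I. \<bar>(t *\<^sub>R a) \<bullet> x i\<bar>) + (\<Sum>i\<in>J - I. max 0 ((t *\<^sub>R a) \<bullet> x i + 1)) = 0 + 0"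
  proof (intro arg_cong2[where f = "(+)"] sum.neutral ballI)
    show "\<bar>(t *\<^sub>R a) \<bullet> x i\<bar> = 0" if "i \<in> I" for i using a(1)[OF that] by simp
  qed (simp del: inner_scaleR_left)
  then have "(\<Sum>i\<in>I. \<bar>(t *\<^sub>R a) \<bullet> x i\<bar>) + (\<Sum>i\<in>J - I. max 0 ((t *\<^sub>R a) \<bullet> x i + 1)) \<le> 0"
    by linarith
  moreover obtain k :: nat where "norm (t *\<^sub>R a) \<le> real k" using real_arch_simple by blast
  then have "t *\<^sub>R a \<in> cball 0 (real k)" by simp
  ultimately show "\<exists>k::nat. \<exists>a\<in>cball 0 (real k).
      (\<Sum>i\<in>I. \<bar>a \<bullet> x i\<bar>) + (\<Sum>i\<in>J - I. max 0 (a \<bullet> x i + 1)) \<le> 0"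
    by (intro exI[of _ k] bexI[of _ "t *\<^sub>R a"])
next
  have fI: "finite I" using I J by (rule finite_subset)
  assume "\<exists>k::nat. \<exists>a\<in>cball 0 (real k).
      (\<Sum>i\<in>I. \<bar>a \<bullet> x i\<bar>) + (\<Sum>i\<in>J - I. max 0 (a \<bullet> x i + 1)) \<le> 0"
  then obtain a where a: "(\<Sum>i\<in>I. \<bar>a \<bullet> x i\<bar>) + (\<Sum>i\<in>J - I. max 0 (a \<bullet> x i + 1)) \<le> 0" by blast
  have "0 \<le> (\<Sum>i\<in>I. \<bar>a \<bullet> x i\<bar>)" "0 \<le> (\<Sum>i\<in>J - I. max 0 (a \<bullet> x i + 1))"
    by (auto intro!: sum_nonneg)
  then have "(\<Sum>i\<in>I. \<bar>a \<bullet> x i\<bar>) = 0" "(\<Sum>i\<in>J - I. max 0 (a \<bullet> x i + 1)) = 0"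
    using a by linarith+
  then have 1: "\<forall>i\<in>I. \<bar>a \<bullet> x i\<bar> = 0" and 2: "\<forall>i\<in>J - I. max 0 (a \<bullet> x i + 1) = 0"
    using fI J by (simp_all add: sum_nonneg_eq_0_iff)
  show "supporting_index J x I"
    unfolding supporting_index_def
  proof (intro exI[of _ a] conjI ballI)
    show "a \<bullet> x i = 0" if "i \<in> I" for i using 1 that by simp
    show "a \<bullet> x i < 0" if "i \<in> J - I" for i
    proof -
      have "max 0 (a \<bullet> x i + 1) = 0" using 2 that by blast
      then show ?thesis by (simp add: max_def split: if_splits)
    qed
  qed
qed

lemma sets_supporting_index:
  fixes X :: "'i \<Rightarrow> 'w \<Rightarrow> 'a::euclidean_space"
  assumes J: "finite J" and I: "I \<subseteq> J"
    and X: "\<And>i. i \<in> J \<Longrightarrow> X i \<in> borel_measurable M"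
  shows "{w \<in> space M. supporting_index J (\<lambda>i. X i w) I} \<in> sets M"
proof -
  have fI: "finite I" using I J by (rule finite_subset)
  have "{w \<in> space M. \<exists>k::nat. \<exists>a\<in>cball 0 (real k).
      (\<Sum>i\<in>I. \<bar>a \<bullet> X i w\<bar>) + (\<Sum>i\<in>J - I. max 0 (a \<bullet> X i w + 1)) \<le> 0} \<in> sets M"
  proof (intro sets.sets_Collect_countable_Ex sets_Collect_compact_ex)
    fix a :: 'a
    show "(\<lambda>w. (\<Sum>i\<in>I. \<bar>a \<bullet> X i w\<bar>) + (\<Sum>i\<in>J - I. max 0 (a \<bullet> X i w + 1))) \<in> borel_measurable M"
      using I by (intro borel_measurable_add borel_measurable_sum borel_measurable_abs
          borel_measurable_max borel_measurable_inner borel_measurable_const X) auto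
  qed (auto intro!: continuous_intros)
  then show ?thesis by (simp add: supporting_index_iff_bounded[OF J I])
qed

lemma orthogonal_notin_span:
  fixes a :: "'a::real_inner"
  assumes "a \<noteq> 0" "\<And>v. v \<in> S \<Longrightarrow> a \<bullet> v = 0"
  shows "a \<notin> span S"
proof
  assume "a \<in> span S"
  moreover have "span S \<subseteq> {v. a \<bullet> v = 0}"
    using assms(2) by (intro span_minimal subspace_hyperplane) auto
  ultimately have "a \<bullet> a = 0" by blast
  then show False using assms(1) by simp
qed

text \<open>The orthogonal complement is a line exactly if it contains a unit vector but no
  orthonormal pair. Both conditions quantify over compact sets, as
  \<open>sets_Collect_compact_ex\<close> demands.\<close>

lemma dim_eq_codim_1_iff:
  fixes S :: "'a::euclidean_space set"
  assumes D: "DIM('a) = d + 1"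
  shows "dim S = d \<longleftrightarrow> (\<exists>a\<in>sphere 0 1. \<forall>v\<in>S. a \<bullet> v = 0) \<and>
    \<not> (\<exists>p\<in>{(a, b). norm a = 1 \<and> norm b = 1 \<and> a \<bullet> b = 0}. \<forall>v\<in>S. fst p \<bullet> v = 0 \<and> snd p \<bullet> v = 0)"
proof -
  have ex: "\<exists>a. norm a = 1 \<and> (\<forall>v\<in>T. a \<bullet> v = 0)" if T: "dim T < DIM('a)" for T :: "'a set"
  proof -
    obtain a where a: "a \<noteq> 0" "span T \<subseteq> {v. a \<bullet> v = 0}"
      using lowdim_subset_hyperplane[OF T] by blast
    have "\<forall>v\<in>T. sgn a \<bullet> v = 0" using a(2) span_superset[of T] by (auto simp: sgn_div_norm)
    then show ?thesis using a(1) by (intro exI[of _ "sgn a"]) (auto simp: norm_sgn)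
  qed
  have 1: "dim S \<le> d \<longleftrightarrow> (\<exists>a\<in>sphere 0 1. \<forall>v\<in>S. a \<bullet> v = 0)"
  proof
    assume "dim S \<le> d"
    then show "\<exists>a\<in>sphere 0 1. \<forall>v\<in>S. a \<bullet> v = 0" using ex[of S] D by auto
  next
    assume "\<exists>a\<in>sphere 0 1. \<forall>v\<in>S. a \<bullet> v = 0"
    then obtain a where a: "norm a = 1" "\<And>v. v \<in> S \<Longrightarrow> a \<bullet> v = 0" by auto
    then have "a \<notin> span S" by (intro orthogonal_notin_span) auto
    then have "dim (insert a S) = dim S + 1" by (simp add: dim_insert)
    moreover have "dim (insert a S) \<le> DIM('a)" by (rule dim_subset_UNIV)
    ultimately show "dim S \<le> d" using D by simp
  qed
  have 2: "dim S < d \<longleftrightarrow> (\<exists>p\<in>{(a, b). norm a = 1 \<and> norm b = 1 \<and> a \<bullet> b = 0}. \<forall>v\<in>S. fst p \<bullet> v = 0 \<and> snd p \<bullet> v = 0)"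
  proof
    assume S: "dim S < d"
    then obtain a where a: "norm a = 1" "\<forall>v\<in>S. a \<bullet> v = 0" using ex[of S] D by auto
    have "dim (insert a S) < DIM('a)" using S D by (simp add: dim_insert)
    then obtain b where b: "norm b = 1" "\<forall>v\<in>insert a S. b \<bullet> v = 0" using ex[of "insert a S"] by auto
    then show "\<exists>p\<in>{(a, b). norm a = 1 \<and> norm b = 1 \<and> a \<bullet> b = 0}. \<forall>v\<in>S. fst p \<bullet> v = 0 \<and> snd p \<bullet> v = 0"
      using a by (intro bexI[of _ "(a, b)"]) (auto simp: inner_commute)
  next
    assume "\<exists>p\<in>{(a, b). norm a = 1 \<and> norm b = 1 \<and> a \<bullet> b = 0}. \<forall>v\<in>S. fst p \<bullet> v = 0 \<and> snd p \<bullet> v = 0"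
    then obtain a b where ab: "norm a = 1" "norm b = 1" "a \<bullet> b = 0"
        "\<And>v. v \<in> S \<Longrightarrow> a \<bullet> v = 0" "\<And>v. v \<in> S \<Longrightarrow> b \<bullet> v = 0" by auto
    have "a \<notin> span S" using ab by (intro orthogonal_notin_span) auto
    moreover have "b \<notin> span (insert a S)"
      using ab by (intro orthogonal_notin_span) (auto simp: inner_commute)
    ultimately have "dim (insert b (insert a S)) = dim S + 2" by (simp add: dim_insert)
    moreover have "dim (insert b (insert a S)) \<le> DIM('a)" by (rule dim_subset_UNIV)
    ultimately show "dim S < d" using D by simp
  qed
  have "dim S = d \<longleftrightarrow> dim S \<le> d \<and> \<not> dim S < d" by auto
  then show ?thesis unfolding 1 2 .
qed

lemma sets_dim_codim_1:
  fixes X :: "'i \<Rightarrow> 'w \<Rightarrow> 'a::euclidean_space"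
  assumes I: "finite I" and D: "DIM('a) = d + 1"
    and X: "\<And>i. i \<in> I \<Longrightarrow> X i \<in> borel_measurable M"
  shows "{w \<in> space M. dim ((\<lambda>i. X i w) ` I) = d} \<in> sets M"
proof -
  let ?P = "{(a::'a, b). norm a = 1 \<and> norm b = 1 \<and> a \<bullet> b = 0}"
  have "?P = (sphere 0 1 \<times> sphere 0 1) \<inter> {p. fst p \<bullet> snd p = 0}" by auto
  moreover have "closed {p::'a \<times> 'a. fst p \<bullet> snd p = 0}"
    by (intro closed_Collect_eq continuous_intros)
  ultimately have P: "compact ?P"
    by (metis compact_Int_closed compact_Times compact_sphere)
  have 1: "(\<forall>v\<in>(\<lambda>i. X i w) ` I. a \<bullet> v = 0) \<longleftrightarrow> (\<Sum>i\<in>I. \<bar>a \<bullet> X i w\<bar>) \<le> 0" for a w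
    by (subst sum_nonneg_le_0_iff[OF I]) auto
  have 2: "(\<forall>v\<in>(\<lambda>i. X i w) ` I. fst p \<bullet> v = 0 \<and> snd p \<bullet> v = 0)
      \<longleftrightarrow> (\<Sum>i\<in>I. \<bar>fst p \<bullet> X i w\<bar> + \<bar>snd p \<bullet> X i w\<bar>) \<le> 0" for p :: "'a \<times> 'a" and w
    by (subst sum_nonneg_le_0_iff[OF I]) (simp_all add: add_nonneg_eq_0_iff)
  have "{w \<in> space M. \<exists>a\<in>sphere 0 1. (\<Sum>i\<in>I. \<bar>a \<bullet> X i w\<bar>) \<le> 0} \<in> sets M"
  proof (rule sets_Collect_compact_ex)
    show "(\<lambda>w. \<Sum>i\<in>I. \<bar>a \<bullet> X i w\<bar>) \<in> borel_measurable M" for a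
      by (intro borel_measurable_sum borel_measurable_abs borel_measurable_inner borel_measurable_const X)
  qed (auto intro!: continuous_intros)
  moreover have "{w \<in> space M. \<exists>p\<in>?P. (\<Sum>i\<in>I. \<bar>fst p \<bullet> X i w\<bar> + \<bar>snd p \<bullet> X i w\<bar>) \<le> 0} \<in> sets M"
  proof (rule sets_Collect_compact_ex[OF P])
    show "(\<lambda>w. \<Sum>i\<in>I. \<bar>fst p \<bullet> X i w\<bar> + \<bar>snd p \<bullet> X i w\<bar>) \<in> borel_measurable M" for p
      by (intro borel_measurable_sum borel_measurable_add borel_measurable_abs borel_measurable_inner
          borel_measurable_const X)
  qed (auto intro!: continuous_intros)
  ultimately show ?thesis
    unfolding dim_eq_codim_1_iff[OF D] 1 2
    by (intro sets.sets_Collect_conj sets.sets_Collect_neg)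
qed

text \<open>The cone is pointed exactly if \<open>{0}\<close> is a face, and since all generators
  are nonzero the index set of that face is empty. Pointedness thereby inherits the measurability of
  supporting index sets.\<close>

lemma pointed_iff_supporting_index_empty:
  fixes x :: "'i \<Rightarrow> 'a::euclidean_space"
  assumes J: "finite J" and x: "\<And>i. i \<in> J \<Longrightarrow> x i \<noteq> 0"
  defines "C \<equiv> convex_cone hull (x ` J)"
  shows "C \<inter> uminus ` C = {0} \<longleftrightarrow> supporting_index J x {}"
proof
  assume pt: "C \<inter> uminus ` C = {0}"
  have z: "v = 0" if "v \<in> C" "- v \<in> C" for v
  proof -
    have "v \<in> uminus ` C" using that(2) by (metis image_eqI minus_minus)
    then show ?thesis using pt that(1) by blast
  qed
  have "{0} face_of C"
    unfolding face_of_def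
  proof (intro conjI ballI impI)
    show "{0} \<subseteq> C" by (simp add: C_def convex_cone_hull_contains_0)
    fix a b v assume ab: "a \<in> C" "b \<in> C" and v: "v \<in> {0}" "v \<in> open_segment a b"
    then obtain u where u: "0 < u" "u < 1" "0 = (1 - u) *\<^sub>R a + u *\<^sub>R b"
      by (auto simp: in_segment)
    have eq: "u *\<^sub>R b = - ((1 - u) *\<^sub>R a)" using u(3) by (simp add: eq_neg_iff_add_eq_0 add.commute)
    have "u *\<^sub>R b = 0"
    proof (rule z)
      show "u *\<^sub>R b \<in> C" using ab u by (auto simp: C_def intro: convex_cone_hull_mul)
      show "- (u *\<^sub>R b) \<in> C" unfolding eq using ab u by (auto simp: C_def intro: convex_cone_hull_mul)
    qed
    then show "b \<in> {0}" "a \<in> {0}" using u eq by auto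
  qed auto
  then obtain I where I: "I \<subseteq> J" "supporting_index J x I" "{0} = convex_cone hull (x ` I)"
    using face_of_convex_cone_hull_iff[OF J, of "{0}" x] unfolding C_def by blast
  have "I = {}"
  proof (rule ccontr)
    assume "I \<noteq> {}"
    then obtain i where i: "i \<in> I" by blast
    then have "x i \<in> convex_cone hull (x ` I)" by (intro hull_inc) auto
    then show False using I(1) I(3)[symmetric] x i by auto
  qed
  then show "supporting_index J x {}" using I by simp
next
  assume "supporting_index J x {}"
  then obtain a where a: "\<And>i. i \<in> J \<Longrightarrow> a \<bullet> x i < 0" unfolding supporting_index_def by blast
  have a': "\<And>i. i \<in> J \<Longrightarrow> a \<bullet> x i \<le> 0" using a by (simp add: less_imp_le)
  have e: "{i \<in> J. a \<bullet> x i = 0} = {}" using a by fastforce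
  have "C \<inter> {v. a \<bullet> v = 0} = {0}"
    using convex_cone_hull_Int_hyperplane(1)[of J a x, OF J a'] unfolding C_def e
    by (simp only: image_empty convex_cone_hull_empty)
  moreover have "a \<bullet> v = 0" if "v \<in> C" "- v \<in> C" for v
    using convex_cone_hull_Int_hyperplane(2)[OF J a' that(1)[unfolded C_def]]
      convex_cone_hull_Int_hyperplane(2)[OF J a' that(2)[unfolded C_def]] by simp
  moreover have "0 \<in> C" by (simp add: C_def convex_cone_hull_contains_0)
  ultimately show "C \<inter> uminus ` C = {0}" by force
qed

section \<open>Normal vectors by determinants\<close>

definition side_det :: "'m::finite \<Rightarrow> ('m \<Rightarrow> 'i) \<Rightarrow> ('i \<Rightarrow> real ^ 'm) \<Rightarrow> real ^ 'm \<Rightarrow> real" where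
  "side_det k b x v = det (\<chi> j. if j = k then v else x (b j))"

text \<open>The generalised cross product of the points in the rows other than \<open>k\<close>; its
  coordinates are the cofactors of row \<open>k\<close>. It is 0 exactly if these points are
  dependent.\<close>

definition normal_vec :: "'m::finite \<Rightarrow> ('m \<Rightarrow> 'i) \<Rightarrow> ('i \<Rightarrow> real ^ 'm) \<Rightarrow> real ^ 'm" where
  "normal_vec k b x = (\<chi> l. side_det k b x (axis l 1))"

text \<open>Linearity of the determinant in row \<open>k\<close>, in effect Laplace expansion along
  it.\<close>

lemma side_det_eq_inner: "side_det k b x v = normal_vec k b x \<bullet> v"
proof -
  have "side_det k b x v = side_det k b x (\<Sum>l\<in>UNIV. (v $ l) *s axis l 1)"
    by (simp add: basis_expansion)
  also have "\<dots> = (\<Sum>l\<in>UNIV. side_det k b x ((v $ l) *s axis l 1))"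
    unfolding side_det_def
    using det_linear_row_sum[of UNIV k "\<lambda>_ l. (v $ l) *s axis l 1" "\<lambda>j. x (b j)"] by simp
  also have "\<dots> = (\<Sum>l\<in>UNIV. v $ l * side_det k b x (axis l 1))"
    unfolding side_det_def
    using det_row_mul[of k _ "\<lambda>_. axis _ 1" "\<lambda>j. x (b j)"] by (intro sum.cong refl) auto
  finally show ?thesis by (simp add: inner_vec_def normal_vec_def mult.commute)
qed

lemma det_nonzero_orthogonal_rows:
  fixes A :: "real ^ 'm ^ 'm"
  assumes A: "det A \<noteq> 0" and a: "\<And>j. a \<bullet> (A $ j) = 0"
  shows "a = 0"
proof -
  have "A *v a = 0"
    using a by (simp add: vec_eq_iff matrix_vector_mul_component inner_commute)
  moreover have "invertible A" using A by (simp add: invertible_det_nz)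
  ultimately show ?thesis
    unfolding invertible_left_inverse matrix_left_invertible_ker by blast
qed

lemma dim_rows_eq:
  fixes x :: "'i \<Rightarrow> real ^ 'm"
  assumes "det (\<chi> j. x (b j)) \<noteq> 0"
  shows "dim (x ` range b) = CARD('m)"
proof (rule ccontr)
  assume "dim (x ` range b) \<noteq> CARD('m)"
  moreover have "dim (x ` range b) \<le> DIM(real ^ 'm)" by (rule dim_subset_UNIV)
  ultimately have "dim (x ` range b) < DIM(real ^ 'm)" by simp
  then obtain a where a: "a \<noteq> 0" "span (x ` range b) \<subseteq> {v. a \<bullet> v = 0}"
    using lowdim_subset_hyperplane by blast
  have "a \<bullet> x (b j) = 0" for j
    using a(2) span_base[of "x (b j)" "x ` range b"] by auto
  then have "a = 0" using det_nonzero_orthogonal_rows[OF assms, of a] by simp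
  then show False using a(1) by simp
qed

lemma ex_inj_range_subset:
  assumes "CARD('m) \<le> card I"
  obtains b :: "'m::finite \<Rightarrow> 'i" where "inj b" "range b \<subseteq> I"
proof -
  obtain K where K: "K \<subseteq> I" "card K = CARD('m)" "finite K"
    using assms obtain_subset_with_card_n by metis
  then obtain b :: "'m \<Rightarrow> 'i" where "bij_betw b UNIV K"
    using finite_same_card_bij[of "UNIV :: 'm set" K] by auto
  then show ?thesis using that[of b] K(1) by (auto simp: bij_betw_def)
qed

text \<open>In general position, \<open>d + 1\<close> indices already span the whole space, so a set
  of points of dimension \<open>d\<close> cannot contain that many.\<close>

lemma dim_index_set:
  fixes x :: "'i \<Rightarrow> real ^ 'm"
  assumes J: "finite J" "CARD('m) \<le> card J" and d: "CARD('m) = d + 1" and I: "I \<subseteq> J"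
    and gp: "\<And>b :: 'm \<Rightarrow> 'i. inj b \<Longrightarrow> range b \<subseteq> J \<Longrightarrow> det (\<chi> j. x (b j)) \<noteq> 0"
  shows "dim (x ` I) = d \<longleftrightarrow> card I = d"
proof
  have fI: "finite I" using I J(1) by (rule finite_subset)
  have le: "dim (x ` K) \<le> card K" if "finite K" for K
    using dim_le_card'[of "x ` K"] card_image_le[of K x] that by simp
  show "card I = d" if dI: "dim (x ` I) = d"
  proof (rule ccontr)
    assume "card I \<noteq> d"
    then have "CARD('m) \<le> card I" using le[OF fI] dI d by simp
    then obtain b :: "'m \<Rightarrow> 'i" where b: "inj b" "range b \<subseteq> I" by (rule ex_inj_range_subset)
    then have "dim (x ` range b) = CARD('m)" using gp[of b] I by (intro dim_rows_eq) auto
    moreover have "dim (x ` range b) \<le> dim (x ` I)" using b by (intro dim_subset image_mono)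
    ultimately show False using dI d by simp
  qed
  show "dim (x ` I) = d" if cI: "card I = d"
  proof -
    \<comment> \<open>Independence is known only for \<open>d + 1\<close> points at a time, so an
      outside point is added and raises the dimension by at most 1.\<close>
    have "card (J - I) \<noteq> 0" using J d cI I fI by (simp add: card_Diff_subset)
    then obtain j where j: "j \<in> J" "j \<notin> I" by (metis DiffE all_not_in_conv card.empty)
    have "CARD('m) \<le> card (insert j I)" using fI j cI d by simp
    then obtain b :: "'m \<Rightarrow> 'i" where b: "inj b" "range b \<subseteq> insert j I" by (rule ex_inj_range_subset)
    then have "dim (x ` range b) = CARD('m)" using gp[of b] I j by (intro dim_rows_eq) auto
    moreover have "dim (x ` range b) \<le> dim (x ` insert j I)" using b by (intro dim_subset image_mono)
    moreover have "dim (x ` insert j I) \<le> dim (x ` I) + 1" by (simp add: dim_insert)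
    ultimately show ?thesis using le[OF fI] cI d by simp
  qed
qed

lemma side_det_eq_0:
  assumes "j \<noteq> k"
  shows "side_det k b x (x (b j)) = 0"
  unfolding side_det_def using assms
  by (intro det_identical_rows[OF assms]) (simp add: row_def vec_eq_iff)

text \<open>In general position the hyperplane through the points of \<open>I\<close> has only one
  normal line, so a supporting normal is a multiple of \<open>normal_vec k b x\<close>; the sign of
  the factor selects the alternative.\<close>

lemma supporting_index_generic:
  fixes x :: "'i \<Rightarrow> real ^ 'm"
  assumes J: "finite J" "CARD('m) \<le> card J" and d: "CARD('m) = d + 1" and I: "I \<subseteq> J" "card I = d"
    and gp: "\<And>b :: 'm \<Rightarrow> 'i. inj b \<Longrightarrow> range b \<subseteq> J \<Longrightarrow> det (\<chi> j. x (b j)) \<noteq> 0"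
    and b: "bij_betw b (UNIV - {k}) I"
  shows "supporting_index J x I \<longleftrightarrow>
    (\<forall>j\<in>J - I. normal_vec k b x \<bullet> x j < 0) \<or> (\<forall>j\<in>J - I. 0 < normal_vec k b x \<bullet> x j)"
proof
  let ?w = "normal_vec k b x"
  have w0: "?w \<bullet> x i = 0" if i: "i \<in> I" for i
  proof -
    obtain j where "j \<noteq> k" "i = b j" using b i unfolding bij_betw_def by blast
    then show ?thesis using side_det_eq_0[of j k b x] by (simp add: side_det_eq_inner)
  qed
  assume "(\<forall>j\<in>J - I. ?w \<bullet> x j < 0) \<or> (\<forall>j\<in>J - I. 0 < ?w \<bullet> x j)"
  then show "supporting_index J x I"
  proof
    assume "\<forall>j\<in>J - I. ?w \<bullet> x j < 0"
    then show ?thesis unfolding supporting_index_def using w0 by blast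
  next
    assume "\<forall>j\<in>J - I. 0 < ?w \<bullet> x j"
    then show ?thesis unfolding supporting_index_def using w0 by (intro exI[of _ "- ?w"]) auto
  qed
next
  let ?w = "normal_vec k b x"
  have fI: "finite I" using I(1) J(1) by (rule finite_subset)
  have w0: "?w \<bullet> x i = 0" if i: "i \<in> I" for i
  proof -
    obtain j where "j \<noteq> k" "i = b j" using b i unfolding bij_betw_def by blast
    then show ?thesis using side_det_eq_0[of j k b x] by (simp add: side_det_eq_inner)
  qed
  assume "supporting_index J x I"
  then obtain a where a: "\<And>i. i \<in> I \<Longrightarrow> a \<bullet> x i = 0" "\<And>i. i \<in> J - I \<Longrightarrow> a \<bullet> x i < 0"
    unfolding supporting_index_def by blast
  have "card (J - I) \<noteq> 0" using J d I fI by (simp add: card_Diff_subset)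
  then obtain j0 where j0: "j0 \<in> J" "j0 \<notin> I" by (metis DiffE all_not_in_conv card.empty)
  \<comment> \<open>An outside point is put into the free row \<open>k\<close>, which completes the
    points of \<open>I\<close> to a basis.\<close>
  define c where "c = (\<lambda>j. if j = k then j0 else b j)"
  have bI: "b j \<in> I" if "j \<noteq> k" for j using b that unfolding bij_betw_def by blast
  have inj: "inj c"
  proof (rule injI)
    fix p q assume "c p = c q"
    then show "p = q"
      using bI j0(2) bij_betw_imp_inj_on[OF b] unfolding c_def inj_on_def
      by (auto split: if_splits)
  qed
  have "range c \<subseteq> J" using bI I(1) j0 by (auto simp: c_def)
  then have det: "det (\<chi> j. x (c j)) \<noteq> 0" using gp inj by blast
  have "(\<chi> j. x (c j)) = (\<chi> j. if j = k then x j0 else x (b j))"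
    by (simp add: vec_eq_iff c_def)
  then have wj0: "?w \<bullet> x j0 \<noteq> 0"
    using det by (simp add: side_det_eq_inner[symmetric] side_det_def)
  \<comment> \<open>Chosen so that \<open>a - t *\<^sub>R ?w\<close> is also orthogonal to the
    outside point, hence to a basis.\<close>
  define t where "t = (a \<bullet> x j0) / (?w \<bullet> x j0)"
  have "a - t *\<^sub>R ?w = 0"
  proof (rule det_nonzero_orthogonal_rows[OF det])
    fix j
    show "(a - t *\<^sub>R ?w) \<bullet> (\<chi> j. x (c j)) $ j = 0"
    proof (cases "j = k")
      case True
      then show ?thesis using wj0 by (simp add: c_def inner_diff_left t_def)
    next
      case False
      then show ?thesis using a(1)[OF bI] w0[OF bI] by (simp add: c_def inner_diff_left)
    qed
  qed
  then have at: "a \<bullet> x j = t * (?w \<bullet> x j)" for j by simp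
  show "(\<forall>j\<in>J - I. ?w \<bullet> x j < 0) \<or> (\<forall>j\<in>J - I. 0 < ?w \<bullet> x j)"
  proof (cases "0 < t")
    case True
    then have "?w \<bullet> x j < 0" if "j \<in> J - I" for j
      using a(2)[OF that] unfolding at by (simp add: mult_less_0_iff)
    then show ?thesis by blast
  next
    case False
    then have "0 < ?w \<bullet> x j" if "j \<in> J - I" for j
      using a(2)[OF that] unfolding at by (auto simp: mult_less_0_iff)
    then show ?thesis by blast
  qed
qed

section \<open>The normal under rescaling and under isometries\<close>

lemma det_scale_rows:
  fixes x :: "'i \<Rightarrow> real ^ 'm"
  shows "det (\<chi> j. c (b j) *\<^sub>R x (b j)) = (\<Prod>j\<in>UNIV. c (b j)) * det (\<chi> j. x (b j))"
  using det_rows_mul[of "\<lambda>j. c (b j)" "\<lambda>j. x (b j)"] by (simp add: scalar_mult_eq_scaleR)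

lemma side_det_scale:
  fixes x :: "'i \<Rightarrow> real ^ 'm"
  shows "side_det k b (\<lambda>i. c i *\<^sub>R x i) v = (\<Prod>j\<in>UNIV - {k}. c (b j)) * side_det k b x v"
proof -
  have "side_det k b (\<lambda>i. c i *\<^sub>R x i) v
     = det (\<chi> j. (if j = k then 1 else c (b j)) *s (if j = k then v else x (b j)))"
    unfolding side_det_def by (intro arg_cong[where f = det]) (simp add: vec_eq_iff)
  also have "\<dots> = (\<Prod>j\<in>UNIV. if j = k then 1 else c (b j)) * side_det k b x v"
    unfolding side_det_def by (rule det_rows_mul)
  also have "(\<Prod>j\<in>UNIV. if j = k then 1 else c (b j)) = (\<Prod>j\<in>UNIV - {k}. c (b j))"
    by (subst prod.remove[of _ k]) (auto intro!: prod.cong)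
  finally show ?thesis .
qed

text \<open>This is how the points of the halfsphere are exchanged for the points of the ball that
  they come from: the line spanned by the normal stays the same.\<close>

lemma normal_vec_scale:
  fixes x :: "'i \<Rightarrow> real ^ 'm"
  shows "normal_vec k b (\<lambda>i. c i *\<^sub>R x i) = (\<Prod>j\<in>UNIV - {k}. c (b j)) *\<^sub>R normal_vec k b x"
  by (simp add: normal_vec_def side_det_scale vec_eq_iff)

lemma normal_vec_cong:
  assumes "\<And>j. j \<noteq> k \<Longrightarrow> x (b j) = y (b j)"
  shows "normal_vec k b x = normal_vec k b y"
proof -
  have "(\<chi> j. if j = k then v else x (b j)) = (\<chi> j. if j = k then v else y (b j))" for v
    using assms by (simp add: vec_eq_iff)
  then show ?thesis by (simp add: normal_vec_def side_det_def)
qed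

text \<open>Applying \<open>f\<close> to every row multiplies the matrix by the transpose of that of
  \<open>f\<close>. Preservation of inner products then moves \<open>f\<close> onto the normal,
  which is tested against all vectors \<open>f v\<close>.\<close>

lemma normal_vec_orthogonal:
  fixes x :: "'i \<Rightarrow> real ^ 'm"
  assumes f: "orthogonal_transformation f"
  shows "normal_vec k b (\<lambda>i. f (x i)) = det (matrix f) *\<^sub>R f (normal_vec k b x)"
proof -
  have lin: "linear f" using f by (rule orthogonal_transformation_linear)
  have side: "side_det k b (\<lambda>i. f (x i)) (f v) = det (matrix f) * side_det k b x v" for v
  proof -
    let ?A = "\<chi> j. if j = k then v else x (b j)"
    have "(\<chi> j. if j = k then f v else f (x (b j))) = ?A ** transpose (matrix f)"
    proof -
      have "f u = matrix f *v u" for u using lin by (simp add: matrix_works linear_matrix_vector_mul_eq)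
      then show ?thesis
        by (simp add: vec_eq_iff matrix_matrix_mult_def matrix_vector_mult_def transpose_def mult.commute)
    qed
    then show ?thesis by (simp add: side_det_def det_mul)
  qed
  have surj: "surj f" using f by (rule orthogonal_transformation_surj)
  show ?thesis
  proof (rule vector_eq_rdot[THEN iffD1], rule allI)
    fix u
    obtain v where v: "u = f v" using surj by blast
    have "normal_vec k b (\<lambda>i. f (x i)) \<bullet> u = det (matrix f) * (normal_vec k b x \<bullet> v)"
      unfolding v side_det_eq_inner[symmetric] by (rule side)
    also have "normal_vec k b x \<bullet> v = f (normal_vec k b x) \<bullet> u"
      using f unfolding v by (simp add: orthogonal_transformation_def)
    finally show "normal_vec k b (\<lambda>i. f (x i)) \<bullet> u = (det (matrix f) *\<^sub>R f (normal_vec k b x)) \<bullet> u"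
      by simp
  qed
qed

section \<open>Random hyperplanes\<close>

lemma borel_measurable_vec_nth_comp:
  fixes f :: "'w \<Rightarrow> real ^ 'm"
  assumes "f \<in> borel_measurable M"
  shows "(\<lambda>w. f w $ l) \<in> borel_measurable M"
proof -
  have "(\<lambda>v::real ^ 'm. v $ l) \<in> borel_measurable borel"
    by (intro borel_measurable_continuous_onI continuous_intros)
  then show ?thesis using assms by (rule measurable_compose[rotated])
qed

lemma borel_measurable_det:
  fixes A :: "'w \<Rightarrow> 'm \<Rightarrow> real ^ 'm"
  assumes "\<And>j. (\<lambda>w. A w j) \<in> borel_measurable M"
  shows "(\<lambda>w. det (\<chi> j. A w j)) \<in> borel_measurable M"
  unfolding det_def vec_lambda_beta using assms
  by (intro borel_measurable_sum borel_measurable_times borel_measurable_const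
      borel_measurable_prod borel_measurable_vec_nth_comp)

lemma borel_measurable_PiM_ball_component:
  "i \<in> I \<Longrightarrow> (\<lambda>y. y i) \<in> borel_measurable (PiM I (\<lambda>_. ball_measure :: 'a::euclidean_space measure))"
  using measurable_component_singleton[of i I "\<lambda>_. ball_measure :: 'a measure"]
    measurable_cong_sets[OF refl sets_ball_measure] by blast

lemma borel_measurable_normal_vec:
  fixes b :: "'m::finite \<Rightarrow> 'i"
  assumes "\<And>j. j \<noteq> k \<Longrightarrow> (\<lambda>w. X w (b j)) \<in> borel_measurable M"
  shows "(\<lambda>w. normal_vec k b (X w)) \<in> borel_measurable M"
proof (rule borel_measurable_euclidean_space[THEN iffD2], rule ballI)
  fix v :: "real ^ 'm"
  show "(\<lambda>w. normal_vec k b (X w) \<bullet> v) \<in> borel_measurable M"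
    unfolding side_det_eq_inner[symmetric] side_det_def
  proof (rule borel_measurable_det)
    show "(\<lambda>w. if j = k then v else X w (b j)) \<in> borel_measurable M" for j
      using assms[of j] by (cases "j = k") auto
  qed
qed

text \<open>Replacing the rows of the unit matrix one by one avoids null sets of polynomials.\<close>
lemma AE_PiM_det_nonzero_aux:
  fixes b :: "'m::finite \<Rightarrow> 'i"
  assumes I: "finite I" "b ` S \<subseteq> I" and b: "inj_on b S"
  shows "AE y in PiM I (\<lambda>_. ball_measure). det (\<chi> j. if j \<in> S then y (b j) else axis j 1) \<noteq> (0::real)"
  using finite[of S] I b
proof (induction S arbitrary: I rule: finite_induct)
  case empty
  have "(\<chi> j. axis j 1) = (mat 1 :: real ^ 'm ^ 'm)"
    by (simp add: vec_eq_iff mat_def axis_def) 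
  then show ?case by simp
next
  case (insert k S)
  let ?L = "\<lambda>_::'i. ball_measure :: (real ^ 'm) measure"
  interpret product_sigma_finite ?L
    by (intro product_sigma_finite.intro prob_space_imp_sigma_finite prob_space_ball_measure)
  let ?D = "\<lambda>y. det (\<chi> j. if j \<in> insert k S then y (b j) else axis j 1) :: real"
  let ?I = "I - {b k}"
  have bk: "b k \<in> I" and bS: "b ` S \<subseteq> ?I" "inj_on b S"
    using insert.prems insert.hyps by (auto simp: inj_on_def)
  have Ieq: "insert (b k) ?I = I" using bk by auto
  have fI: "finite ?I" using insert.prems by simp
  have Dm: "?D \<in> borel_measurable (PiM I ?L)"
  proof (rule borel_measurable_det)
    show "(\<lambda>y. if j \<in> insert k S then y (b j) else axis j 1) \<in> borel_measurable (PiM I ?L)" for j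
      using borel_measurable_PiM_ball_component[of "b j" I] insert.prems(2)
      by (cases "j \<in> insert k S") auto
  qed
  define N where "N = {y \<in> space (PiM I ?L). ?D y = 0}"
  have N: "N \<in> sets (PiM I ?L)"
    unfolding N_def using Dm by measurable
  \<comment> \<open>As a function of the new row alone, the determinant is the inner product with
    this vector.\<close>
  let ?w = "\<lambda>x. normal_vec k (\<lambda>j. j) (\<lambda>j. if j \<in> S then x (b j) else axis j 1)"
  have "emeasure (PiM I ?L) N = (\<integral>\<^sup>+y. indicator N y \<partial>PiM I ?L)" using N by simp
  also have "\<dots> = (\<integral>\<^sup>+x. \<integral>\<^sup>+v. indicator N (x(b k := v)) \<partial>ball_measure \<partial>PiM ?I ?L)"
    using product_nn_integral_insert[of ?I "b k" "indicator N", unfolded Ieq] fI N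
    by (simp add: borel_measurable_indicator)
  also have "\<dots> = (\<integral>\<^sup>+x. 0 \<partial>PiM ?I ?L)"
  proof (rule nn_integral_cong_AE)
    have "AE x in PiM ?I ?L. det (\<chi> j. if j \<in> S then x (b j) else axis j 1) \<noteq> (0::real)"
      by (rule insert.IH[OF fI bS])
    then show "AE x in PiM ?I ?L. (\<integral>\<^sup>+v. indicator N (x(b k := v)) \<partial>ball_measure) = 0"
    proof eventually_elim
      case (elim x)
      have D: "?D (x(b k := v)) = ?w x \<bullet> v" for v
      proof -
        have "(if j \<in> insert k S then (x(b k := v)) (b j) else axis j 1)
            = (if j = k then v else if j \<in> S then x (b j) else axis j 1)" for j
        proof (cases "j = k")
          case False
          then have "b j \<noteq> b k" if "j \<in> S" using insert.prems(3) that by (auto simp: inj_on_def)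
          then show ?thesis using False by simp
        qed simp
        then show ?thesis unfolding side_det_eq_inner[symmetric] side_det_def by (simp only:)
      qed
      \<comment> \<open>The \<open>k\<close>-th coordinate puts the unit row back; this is the
        determinant that the induction hypothesis controls.\<close>
      have "?w x $ k = det (\<chi> j. if j \<in> S then x (b j) else axis j 1)"
      proof -
        have "(if j = k then axis k 1 else if j \<in> S then x (b j) else axis j 1)
            = (if j \<in> S then x (b j) else axis j 1)" for j
          using insert.hyps by auto
        then show ?thesis unfolding normal_vec_def side_det_def vec_lambda_beta by (simp only:)
      qed
      then have "?w x \<noteq> 0" using elim by auto
      then have "{v. ?w x \<bullet> v = 0} \<in> null_sets ball_measure" by (rule ball_measure_hyperplane)
      then have "emeasure ball_measure {v. ?w x \<bullet> v = 0} = 0" by auto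
      moreover have "{v. ?w x \<bullet> v = 0} \<in> sets ball_measure" by measurable
      ultimately have "(\<integral>\<^sup>+v. indicator {v. ?w x \<bullet> v = 0} v \<partial>ball_measure) = 0"
        by (simp add: nn_integral_indicator)
      moreover have "(\<integral>\<^sup>+v. indicator N (x(b k := v)) \<partial>ball_measure)
          \<le> (\<integral>\<^sup>+v. indicator {v. ?w x \<bullet> v = 0} v \<partial>ball_measure)"
        by (rule nn_integral_mono) (simp add: indicator_def N_def D del: fun_upd_apply insert_iff)
      ultimately show ?case by simp
    qed
  qed
  finally have "N \<in> null_sets (PiM I ?L)" using N by (simp add: null_setsI)
  then show ?case by (rule AE_I') (simp add: N_def)
qed

lemma AE_PiM_det_nonzero:
  fixes b :: "'m::finite \<Rightarrow> 'i"
  assumes "finite I" "range b \<subseteq> I" "inj b"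
  shows "AE y in PiM I (\<lambda>_. ball_measure). det (\<chi> j. y (b j)) \<noteq> (0::real)"
  using AE_PiM_det_nonzero_aux[OF assms] by simp

text \<open>Its \<open>k\<close>-th coordinate is the determinant in which only row \<open>k\<close>
  is still a row of the unit matrix.\<close>

lemma AE_PiM_normal_vec_nonzero:
  fixes b :: "'m::finite \<Rightarrow> 'i"
  assumes "finite I" "b ` (UNIV - {k}) \<subseteq> I" "inj_on b (UNIV - {k})"
  shows "AE y in PiM I (\<lambda>_. ball_measure). normal_vec k b y \<noteq> (0 :: real ^ 'm)"
  using AE_PiM_det_nonzero_aux[OF assms]
proof eventually_elim
  case (elim y)
  have "normal_vec k b y $ k = det (\<chi> j. if j \<in> UNIV - {k} then y (b j) else axis j 1)"
  proof -
    have "(if j = k then axis k 1 else y (b j))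
        = (if j \<in> UNIV - {k} then y (b j) else axis j 1)" for j by auto
    then show ?thesis unfolding normal_vec_def side_det_def vec_lambda_beta by (simp only:)
  qed
  then show ?case using elim by auto
qed

text \<open>The probability that \<open>m\<close> independent points of the halfsphere around
  \<open>e\<close> lie on one side of the hyperplane with normal \<open>w\<close>, one summand for
  each side. Passing to the supplementary angle exchanges the summands, so \<open>cap_angle\<close>
  may be used.\<close>

definition lune_weight :: "nat \<Rightarrow> 'a::euclidean_space \<Rightarrow> 'a \<Rightarrow> real" where
  "lune_weight m e w = (1 - cap_angle e w / pi) ^ m + (cap_angle e w / pi) ^ m"

lemma cap_angle_scale:
  assumes "c \<noteq> 0"
  shows "cap_angle e (c *\<^sub>R w) = cap_angle e w"
proof -
  have "sgn (c *\<^sub>R w) = sgn c *\<^sub>R sgn w" by (rule sgn_scaleR)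
  then show ?thesis using assms by (simp add: cap_angle_def abs_mult sgn_real_def)
qed

lemma cap_angle_orthogonal:
  assumes "orthogonal_transformation f"
  shows "cap_angle (f e) (f w) = cap_angle e w"
  using assms orthogonal_transformation_norm[OF assms]
  by (simp add: cap_angle_def sgn_div_norm orthogonal_transformation_def)

lemma emeasure_same_side:
  fixes e w :: "'a::euclidean_space"
  assumes e: "norm e = 1" and w: "w \<noteq> 0" and J: "finite J" "J \<noteq> {}"
  shows "emeasure (PiM J (\<lambda>_. ball_measure)) {y \<in> space (PiM J (\<lambda>_. ball_measure)).
      (\<forall>j\<in>J. w \<bullet> half_sgn e (y j) < 0) \<or> (\<forall>j\<in>J. 0 < w \<bullet> half_sgn e (y j))}
     = ennreal (lune_weight (card J) e w)"
proof -
  let ?L = "\<lambda>_::'b. ball_measure :: 'a measure"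
  interpret B: prob_space "ball_measure :: 'a measure" by (rule prob_space_ball_measure)
  interpret product_sigma_finite ?L
    by (intro product_sigma_finite.intro prob_space_imp_sigma_finite prob_space_ball_measure)
  let ?A = "\<lambda>w. {y. 0 < w \<bullet> half_sgn e y}"
  have A [measurable]: "?A w \<in> sets ball_measure" for w
    by measurable
  have E: "emeasure (PiM J ?L) (PiE J (\<lambda>_. ?A w)) = ennreal ((1 - arccos (e \<bullet> sgn w) / pi) ^ card J)"
    if w: "w \<noteq> 0" for w
  proof -
    have "emeasure (PiM J ?L) (PiE J (\<lambda>_. ?A w)) = (\<Prod>j\<in>J. emeasure ball_measure (?A w))"
      using J A by (intro emeasure_PiM) auto
    also have "\<dots> = ennreal (measure ball_measure (?A w) ^ card J)"
      by (simp add: B.emeasure_eq_measure ennreal_power)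
    finally show ?thesis by (simp add: measure_half_sgn_side[OF e w])
  qed
  have "{y \<in> space (PiM J ?L).
      (\<forall>j\<in>J. w \<bullet> half_sgn e (y j) < 0) \<or> (\<forall>j\<in>J. 0 < w \<bullet> half_sgn e (y j))}
     = PiE J (\<lambda>_. ?A w) \<union> PiE J (\<lambda>_. ?A (- w))"
  proof (rule set_eqI)
    fix y
    have s: "y \<in> space (PiM J ?L) \<longleftrightarrow> y \<in> extensional J"
      by (simp add: space_PiM PiE_def)
    have p: "y \<in> PiE J (\<lambda>_. ?A v) \<longleftrightarrow> y \<in> extensional J \<and> (\<forall>j\<in>J. 0 < v \<bullet> half_sgn e (y j))" for v
      by (simp add: PiE_def Pi_def) blast
    show "y \<in> {y \<in> space (PiM J ?L).
      (\<forall>j\<in>J. w \<bullet> half_sgn e (y j) < 0) \<or> (\<forall>j\<in>J. 0 < w \<bullet> half_sgn e (y j))}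
      \<longleftrightarrow> y \<in> PiE J (\<lambda>_. ?A w) \<union> PiE J (\<lambda>_. ?A (- w))"
      unfolding mem_Collect_eq Un_iff s p by (simp add: inner_minus_left) blast
  qed
  also have "emeasure (PiM J ?L) \<dots> = emeasure (PiM J ?L) (PiE J (\<lambda>_. ?A w)) + emeasure (PiM J ?L) (PiE J (\<lambda>_. ?A (- w)))"
  proof (rule plus_emeasure[symmetric])
    \<comment> \<open>Since \<open>J\<close> is nonempty, no sample lies on both sides at
      once.\<close>
    show "PiE J (\<lambda>_. ?A w) \<inter> PiE J (\<lambda>_. ?A (- w)) = {}"
    proof -
      obtain j where j: "j \<in> J" using J(2) by blast
      have False if "y \<in> PiE J (\<lambda>_. ?A w)" "y \<in> PiE J (\<lambda>_. ?A (- w))" for y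
        using PiE_mem[OF that(1) j] PiE_mem[OF that(2) j] by (simp add: inner_minus_left)
      then show ?thesis by blast
    qed
  qed (use J A in \<open>auto intro!: sets_PiM_I_finite\<close>)
  also have "\<dots> = ennreal ((1 - arccos (e \<bullet> sgn w) / pi) ^ card J)
      + ennreal ((1 - arccos (- (e \<bullet> sgn w)) / pi) ^ card J)"
  proof -
    have "- w \<noteq> 0" using w by simp
    then show ?thesis unfolding E[OF w] E[OF \<open>- w \<noteq> 0\<close>] by (simp add: sgn_minus)
  qed
  also have "\<dots> = ennreal (lune_weight (card J) e w)"
  proof -
    define t where "t = e \<bullet> sgn w"
    have t: "- 1 \<le> t" "t \<le> 1" using abs_inner_sgn_le_1[OF e, of w] by (auto simp: t_def abs_le_iff)
    have am: "arccos (- t) = pi - arccos t" using t by (rule arccos_minus)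
    have b: "0 \<le> arccos t" "arccos t \<le> pi" using t by (auto intro: arccos_lbound arccos_ubound)
    \<comment> \<open>For an obtuse angle \<open>cap_angle\<close> is the supplement, which only
      swaps the two summands.\<close>
    have "(1 - arccos t / pi) ^ n + (1 - arccos (- t) / pi) ^ n = lune_weight n e w" for n
      by (cases "0 \<le> t") (simp_all add: am lune_weight_def cap_angle_def t_def[symmetric] field_simps)
    moreover have "0 \<le> (1 - arccos t / pi) ^ card J" "0 \<le> (1 - arccos (- t) / pi) ^ card J"
      using b by (auto simp: am field_simps intro!: zero_le_power)
    ultimately show ?thesis unfolding t_def[symmetric] by (simp add: ennreal_plus[symmetric] del: ennreal_plus)
  qed
  finally show ?thesis .
qed


lemma lune_weight_scale: "c \<noteq> 0 \<Longrightarrow> lune_weight m e (c *\<^sub>R w) = lune_weight m e w"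
  by (simp add: lune_weight_def cap_angle_scale)

text \<open>The angle is symmetric in its two directions. Hence a random pole with a fixed normal
  can be read as a random normal with a fixed pole.\<close>

lemma lune_weight_sgn_commute: "lune_weight m (sgn z) w = lune_weight m (sgn w) z"
  by (simp add: lune_weight_def cap_angle_def inner_commute)

lemma prob_space_PiM_ball: "prob_space (PiM I (\<lambda>_. ball_measure :: 'a::euclidean_space measure))"
  by (intro prob_space_PiM prob_space_ball_measure)

lemma borel_measurable_lune_weight:
  assumes e: "norm e = 1" and f: "f \<in> borel_measurable M"
  shows "(\<lambda>w. lune_weight m e (f w)) \<in> borel_measurable M"
proof -
  have "(\<lambda>w. cap_angle e (f w)) \<in> borel_measurable M"
    using f borel_measurable_cap_angle[OF e] by (rule measurable_compose)
  then show ?thesis unfolding lune_weight_def by measurable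
qed

text \<open>The reflection exchanging \<open>e\<close> and \<open>e'\<close>, applied to all points,
  preserves the product measure and carries the normal along up to a nonzero factor, which the
  weight ignores.\<close>

lemma nn_integral_lune_weight_rotate:
  fixes b :: "'m::finite \<Rightarrow> 'i" and e e' :: "real ^ 'm"
  assumes I: "finite I" "b ` (UNIV - {k}) \<subseteq> I" and e: "norm e = 1" "norm e' = 1"
  shows "(\<integral>\<^sup>+y. ennreal (lune_weight m e' (normal_vec k b y)) \<partial>PiM I (\<lambda>_. ball_measure))
    = (\<integral>\<^sup>+y. ennreal (lune_weight m e (normal_vec k b y)) \<partial>PiM I (\<lambda>_. ball_measure))"
proof -
  let ?L = "\<lambda>_::'i. ball_measure :: (real ^ 'm) measure"
  define f where "f = hyperplane_reflection (e - e')"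
  have f: "orthogonal_transformation f" unfolding f_def by (rule orthogonal_transformation_hyperplane_reflection)
  have fe: "f e = e'" unfolding f_def using e by (intro hyperplane_reflection_diff) simp
  have bI: "b j \<in> I" if "j \<noteq> k" for j using I(2) that by blast
  have fm: "f \<in> ball_measure \<rightarrow>\<^sub>M ball_measure"
    using orthogonal_transformation_borel_measurable[OF f]
      measurable_cong_sets[OF sets_ball_measure sets_ball_measure] by blast
  have "distr ball_measure ball_measure f = distr ball_measure borel f"
    by (rule distr_cong) auto
  then have df: "distr ball_measure ball_measure f = ball_measure"
    by (simp add: ball_measure_distr_orthogonal[OF f])
  have P: "distr (PiM I ?L) (PiM I ?L) (compose I f) = PiM I ?L"
    using distr_PiM_finite_prob_space'[OF I(1), of ?L ?L f] prob_space_ball_measure fm by (simp add: df)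
  have cm: "compose I f \<in> PiM I ?L \<rightarrow>\<^sub>M PiM I ?L"
    unfolding compose_def using fm
    by (intro measurable_restrict measurable_compose[OF measurable_component_singleton])
  have Nm: "normal_vec k b \<in> borel_measurable (PiM I ?L)"
    by (intro borel_measurable_normal_vec borel_measurable_PiM_ball_component bI)
  have "inj f" using f by (rule orthogonal_transformation_inj)
  then have det: "det (matrix f) \<noteq> 0"
    using det_nz_iff_inj[OF orthogonal_transformation_linear[OF f]] by simp
  have "(\<integral>\<^sup>+y. ennreal (lune_weight m e' (normal_vec k b y)) \<partial>PiM I ?L)
     = (\<integral>\<^sup>+y. ennreal (lune_weight m e' (normal_vec k b y)) \<partial>distr (PiM I ?L) (PiM I ?L) (compose I f))"
    by (simp only: P)
  also have "\<dots> = (\<integral>\<^sup>+y. ennreal (lune_weight m e' (normal_vec k b (compose I f y))) \<partial>PiM I ?L)"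
    using borel_measurable_lune_weight[OF e(2) Nm, of m]
    by (intro nn_integral_distr[OF cm]) simp
  also have "\<dots> = (\<integral>\<^sup>+y. ennreal (lune_weight m e (normal_vec k b y)) \<partial>PiM I ?L)"
  proof (rule nn_integral_cong)
    fix y
    have "normal_vec k b (compose I f y) = normal_vec k b (\<lambda>i. f (y i))"
      using bI by (intro normal_vec_cong) (simp add: compose_def)
    also have "\<dots> = det (matrix f) *\<^sub>R f (normal_vec k b y)"
      by (rule normal_vec_orthogonal[OF f])
    finally have "lune_weight m e' (normal_vec k b (compose I f y)) = lune_weight m (f e) (f (normal_vec k b y))"
      using lune_weight_scale[OF det] by (simp add: fe)
    then show "ennreal (lune_weight m e' (normal_vec k b (compose I f y))) = ennreal (lune_weight m e (normal_vec k b y))"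
      by (simp add: lune_weight_def cap_angle_orthogonal[OF f])
  qed
  finally show ?thesis .
qed

text \<open>The integral does not depend on the pole, so the pole may be averaged over the
  directions of a uniform point \<open>z\<close> of the ball. After Fubini the roles of pole and
  normal are exchanged, and the inner integral is the same for every nonzero normal.\<close>

lemma nn_integral_lune_weight:
  fixes b :: "'m::finite \<Rightarrow> 'i" and e :: "real ^ 'm"
  assumes I: "finite I" "b ` (UNIV - {k}) \<subseteq> I" "inj_on b (UNIV - {k})"
    and e: "norm e = 1" and dim: "CARD('m) = q + 2"
  shows "(\<integral>\<^sup>+y. ennreal (lune_weight m e (normal_vec k b y)) \<partial>PiM I (\<lambda>_. ball_measure))
    = ennreal (2 * omega (q + 1) / omega (q + 2) * integral {0..pi} (\<lambda>s. (1 - s / pi) ^ m * sin s ^ q))"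
proof -
  let ?L = "\<lambda>_::'i. ball_measure :: (real ^ 'm) measure"
  let ?B = "ball_measure :: (real ^ 'm) measure"
  let ?c = "2 * omega (q + 1) / omega (q + 2) * integral {0..pi} (\<lambda>s. (1 - s / pi) ^ m * sin s ^ q)"
  interpret B: prob_space ?B by (rule prob_space_ball_measure)
  interpret P: prob_space "PiM I ?L" by (rule prob_space_PiM_ball)
  interpret PB: pair_sigma_finite ?B "PiM I ?L" ..
  have bI: "b j \<in> I" if "j \<noteq> k" for j using I(2) that by blast
  have Nm: "normal_vec k b \<in> borel_measurable (PiM I ?L)"
    by (intro borel_measurable_normal_vec borel_measurable_PiM_ball_component bI)
  define Q where "Q e = (\<integral>\<^sup>+y. ennreal (lune_weight m e (normal_vec k b y)) \<partial>PiM I ?L)" for e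
  have "Q e = (\<integral>\<^sup>+z. Q e \<partial>?B)" by (simp add: B.emeasure_space_1[simplified])
  also have "\<dots> = (\<integral>\<^sup>+z. Q (sgn z) \<partial>?B)"
    using AE_ball_measure_nonzero unfolding Q_def
  proof (rule nn_integral_cong_AE[OF eventually_mono])
    fix z :: "real ^ 'm" assume "z \<noteq> 0"
    then have "norm (sgn z) = 1" by (simp add: norm_sgn)
    then show "(\<integral>\<^sup>+y. ennreal (lune_weight m e (normal_vec k b y)) \<partial>PiM I ?L)
      = (\<integral>\<^sup>+y. ennreal (lune_weight m (sgn z) (normal_vec k b y)) \<partial>PiM I ?L)"
      by (rule nn_integral_lune_weight_rotate[OF I(1,2) _ e])
  qed
  also have "\<dots> = (\<integral>\<^sup>+y. \<integral>\<^sup>+z. ennreal (lune_weight m (sgn z) (normal_vec k b y)) \<partial>?B \<partial>PiM I ?L)"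
    unfolding Q_def
  proof (rule PB.Fubini'[symmetric])
    let ?M = "?B \<Otimes>\<^sub>M PiM I ?L"
    have 1: "(\<lambda>p. sgn (fst p)) \<in> borel_measurable ?M"
    proof (rule measurable_compose[OF measurable_fst])
      show "sgn \<in> borel_measurable ?B"
        using borel_measurable_sgn_euclidean measurable_cong_sets[OF sets_ball_measure refl] by blast
    qed
    have 2: "(\<lambda>p. sgn (normal_vec k b (snd p))) \<in> borel_measurable ?M"
      by (rule measurable_compose[OF measurable_compose[OF measurable_snd Nm] borel_measurable_sgn_euclidean])
    have "(\<lambda>p. arccos \<bar>sgn (fst p) \<bullet> sgn (normal_vec k b (snd p))\<bar>) \<in> borel_measurable ?M"
    proof (rule borel_measurable_arccos)
      show "(\<lambda>p. \<bar>sgn (fst p) \<bullet> sgn (normal_vec k b (snd p))\<bar>) \<in> borel_measurable ?M"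
        using 1 2 by measurable
      fix p :: "(real ^ 'm) \<times> ('i \<Rightarrow> real ^ 'm)"
      have "\<bar>sgn u \<bullet> sgn v\<bar> \<le> 1" for u v :: "real ^ 'm"
        using abs_inner_sgn_le_1[of "sgn u" v] by (cases "u = 0") (auto simp: norm_sgn)
      then show "\<bar>\<bar>sgn (fst p) \<bullet> sgn (normal_vec k b (snd p))\<bar>\<bar> \<le> 1" by simp
    qed
    then show "(\<lambda>(z, y). ennreal (lune_weight m (sgn z) (normal_vec k b y))) \<in> borel_measurable ?M"
      unfolding lune_weight_def cap_angle_def case_prod_beta by measurable
  qed
  also have "\<dots> = (\<integral>\<^sup>+y. ennreal ?c \<partial>PiM I ?L)"
    using AE_PiM_normal_vec_nonzero[OF I]
  proof (rule nn_integral_cong_AE[OF eventually_mono])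
    fix y assume "normal_vec k b y \<noteq> 0"
    then have u: "norm (sgn (normal_vec k b y)) = 1" by (simp add: norm_sgn)
    have dim': "DIM(real ^ 'm) = q + 2" using dim by simp
    show "(\<integral>\<^sup>+z. ennreal (lune_weight m (sgn z) (normal_vec k b y)) \<partial>?B) = ennreal ?c"
    proof -
      have "(\<integral>\<^sup>+z. ennreal (lune_weight m (sgn z) (normal_vec k b y)) \<partial>?B)
          = (\<integral>\<^sup>+z. ennreal (lune_weight m (sgn (normal_vec k b y)) z) \<partial>?B)"
        by (intro nn_integral_cong arg_cong[where f = ennreal] lune_weight_sgn_commute)
      then show ?thesis
        unfolding lune_weight_def using nn_integral_cap_angle_power[OF u dim', of m] by simp
    qed
  qed
  also have "\<dots> = ennreal ?c" by (simp add: P.emeasure_space_1)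
  finally show ?thesis by (simp add: Q_def)
qed

section \<open>Random facets\<close>

lemma sets_supporting_event:
  fixes b :: "'m::finite \<Rightarrow> 'i" and e :: "real ^ 'm"
  assumes J: "finite J" and I: "I \<subseteq> J" and b: "bij_betw b (UNIV - {k}) I"
  shows "{y \<in> space (PiM J (\<lambda>_. ball_measure)).
      (\<forall>j\<in>J - I. normal_vec k b y \<bullet> half_sgn e (y j) < 0) \<or>
      (\<forall>j\<in>J - I. 0 < normal_vec k b y \<bullet> half_sgn e (y j))} \<in> sets (PiM J (\<lambda>_. ball_measure))"
proof -
  let ?L = "\<lambda>_::'i. ball_measure :: (real ^ 'm) measure"
  have bI: "b j \<in> I" if "j \<noteq> k" for j using b that unfolding bij_betw_def by blast
  have Nm: "normal_vec k b \<in> borel_measurable (PiM J ?L)"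
    using bI I by (intro borel_measurable_normal_vec borel_measurable_PiM_ball_component) blast
  have m: "(\<lambda>y. normal_vec k b y \<bullet> half_sgn e (y j)) \<in> borel_measurable (PiM J ?L)" if "j \<in> J - I" for j
    using that by (intro borel_measurable_inner[OF Nm]
        measurable_compose[OF borel_measurable_PiM_ball_component half_sgn_measurable]) auto
  show ?thesis
    using J m by (intro sets.sets_Collect_disj sets.sets_Collect_finite_All finite_Diff
        borel_measurable_less borel_measurable_const)
qed

text \<open>The normal depends only on the coordinates in \<open>I\<close>. Fubini fixes these
  first; the other \<open>card J - (q + 1)\<close> points then fall on one side with probability
  \<open>lune_weight\<close>.\<close>

lemma emeasure_supporting_event:
  fixes b :: "'m::finite \<Rightarrow> 'i" and e :: "real ^ 'm"
  assumes J: "finite J" "CARD('m) \<le> card J" and I: "I \<subseteq> J" "card I = q + 1"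
    and b: "bij_betw b (UNIV - {k}) I"
    and e: "norm e = 1" and dim: "CARD('m) = q + 2"
  shows "emeasure (PiM J (\<lambda>_. ball_measure)) {y \<in> space (PiM J (\<lambda>_. ball_measure)).
      (\<forall>j\<in>J - I. normal_vec k b y \<bullet> half_sgn e (y j) < 0) \<or>
      (\<forall>j\<in>J - I. 0 < normal_vec k b y \<bullet> half_sgn e (y j))}
    = ennreal (2 * omega (q + 1) / omega (q + 2) *
        integral {0..pi} (\<lambda>s. (1 - s / pi) ^ (card J - (q + 1)) * sin s ^ q))" (is "emeasure _ ?E = _")
proof -
  let ?L = "\<lambda>_::'i. ball_measure :: (real ^ 'm) measure"
  interpret product_sigma_finite ?L
    by (intro product_sigma_finite.intro prob_space_imp_sigma_finite prob_space_ball_measure)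
  let ?K = "J - I"
  have fI: "finite I" using I(1) J(1) by (rule finite_subset)
  have cK: "card ?K = card J - (q + 1)" using I fI by (simp add: card_Diff_subset)
  then have "card ?K \<noteq> 0" using J(2) dim by simp
  then have K: "finite ?K" "?K \<noteq> {}" using J by (auto simp: card_gt_0_iff)
  have IK: "I \<inter> ?K = {}" "I \<union> ?K = J" using I by auto
  have bI: "b j \<in> I" if "j \<noteq> k" for j using b that unfolding bij_betw_def by blast
  have Em: "?E \<in> sets (PiM J ?L)"
    by (rule sets_supporting_event[OF J(1) I(1) b])
  have "emeasure (PiM J ?L) ?E = (\<integral>\<^sup>+x. emeasure (PiM ?K ?L)
      ((\<lambda>y. merge I ?K (x, y)) -` ?E \<inter> space (PiM ?K ?L)) \<partial>PiM I ?L)"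
    using emeasure_fold_integral[OF IK(1) fI K(1), of ?E] Em unfolding IK(2) by blast
  also have "\<dots> = (\<integral>\<^sup>+x. ennreal (lune_weight (card ?K) e (normal_vec k b x)) \<partial>PiM I ?L)"
  proof (rule nn_integral_cong_AE)
    have "AE x in PiM I ?L. normal_vec k b x \<noteq> 0"
      using b by (intro AE_PiM_normal_vec_nonzero fI) (auto simp: bij_betw_def)
    then show "AE x in PiM I ?L. emeasure (PiM ?K ?L)
        ((\<lambda>y. merge I ?K (x, y)) -` ?E \<inter> space (PiM ?K ?L))
       = ennreal (lune_weight (card ?K) e (normal_vec k b x))"
    proof (rule AE_mp, intro AE_I2 impI)
      fix x assume x: "x \<in> space (PiM I ?L)" and N: "normal_vec k b x \<noteq> 0"
      have "(\<lambda>y. merge I ?K (x, y)) -` ?E \<inter> space (PiM ?K ?L) = {y \<in> space (PiM ?K ?L).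
         (\<forall>j\<in>?K. normal_vec k b x \<bullet> half_sgn e (y j) < 0) \<or> (\<forall>j\<in>?K. 0 < normal_vec k b x \<bullet> half_sgn e (y j))}"
      proof -
        have "merge I ?K (x, y) \<in> ?E \<longleftrightarrow> 
          (\<forall>j\<in>?K. normal_vec k b x \<bullet> half_sgn e (y j) < 0) \<or> (\<forall>j\<in>?K. 0 < normal_vec k b x \<bullet> half_sgn e (y j))"
          if y: "y \<in> space (PiM ?K ?L)" for y
        proof -
          have sp: "merge I ?K (x, y) \<in> space (PiM J ?L)"
            using measurable_space[OF measurable_merge[of I ?K ?L], of "(x, y)"] x y
            by (simp add: space_pair_measure Un_absorb1[OF I(1)])
          have N': "normal_vec k b (merge I ?K (x, y)) = normal_vec k b x"
            using bI by (intro normal_vec_cong) (simp add: merge_def)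
          have mj: "merge I ?K (x, y) j = y j" if "j \<in> ?K" for j using that by (simp add: merge_def)
          show ?thesis unfolding mem_Collect_eq N' using sp mj by simp
        qed
        then show ?thesis by blast
      qed
      then show "emeasure (PiM ?K ?L) ((\<lambda>y. merge I ?K (x, y)) -` ?E \<inter> space (PiM ?K ?L))
         = ennreal (lune_weight (card ?K) e (normal_vec k b x))"
        using emeasure_same_side[OF e N K] by simp
    qed
  qed
  also have "\<dots> = ennreal (2 * omega (q + 1) / omega (q + 2) *
        integral {0..pi} (\<lambda>s. (1 - s / pi) ^ card ?K * sin s ^ q))"
    using b by (intro nn_integral_lune_weight fI e dim) (auto simp: bij_betw_def)
  finally show ?thesis by (simp only: cK)
qed

section \<open>Facet events on the product space\<close>

lemma supporting_index_cong:
  assumes "I \<subseteq> J" "\<And>i. i \<in> J \<Longrightarrow> x i = y i"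
  shows "supporting_index J x I \<longleftrightarrow> supporting_index J y I"
proof -
  have "(\<forall>i\<in>I. a \<bullet> x i = 0) \<longleftrightarrow> (\<forall>i\<in>I. a \<bullet> y i = 0)"
    "(\<forall>i\<in>J - I. a \<bullet> x i < 0) \<longleftrightarrow> (\<forall>i\<in>J - I. a \<bullet> y i < 0)" for a
    using assms by (auto simp: subset_eq)
  then show ?thesis by (simp add: supporting_index_def)
qed

text \<open>For nonzero points the condition on \<open>{}\<close> is pointedness of the cone; it is
  part of the event because a cone with a line has no faces in the sense of
  \<open>sph_face\<close>.\<close>

definition facet_index :: "nat \<Rightarrow> 'i set \<Rightarrow> ('i \<Rightarrow> 'a::euclidean_space) \<Rightarrow> 'i set \<Rightarrow> bool" where
  "facet_index d J x I \<longleftrightarrow>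
     supporting_index J x {} \<and> supporting_index J x I \<and> dim (x ` I) = d"

lemma facet_index_cong:
  assumes "I \<subseteq> J" "\<And>i. i \<in> J \<Longrightarrow> x i = y i"
  shows "facet_index d J x I \<longleftrightarrow> facet_index d J y I"
proof -
  have "x ` I = y ` I" using assms by (intro image_cong) auto
  then show ?thesis
    using supporting_index_cong[of "{}" J x y] supporting_index_cong[of I J x y] assms
    unfolding facet_index_def by simp
qed

lemma sets_facet_index:
  fixes X :: "'i \<Rightarrow> 'w \<Rightarrow> 'a::euclidean_space"
  assumes "finite J" "I \<subseteq> J" "DIM('a) = d + 1" "\<And>i. i \<in> J \<Longrightarrow> X i \<in> borel_measurable M"
  shows "{w \<in> space M. facet_index d J (\<lambda>i. X i w) I} \<in> sets M"
  unfolding facet_index_def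
  using assms finite_subset[OF assms(2,1)]
  by (intro sets.sets_Collect_conj sets_supporting_index sets_dim_codim_1) auto

text \<open>Only countably many index maps \<open>b\<close> are in question, so their null sets
  combine to a null set. Avoiding the equator is what later makes the cone pointed, with
  \<open>- e\<close> as strictly supporting normal.\<close>

lemma AE_PiM_generic:
  fixes e :: "real ^ 'm"
  assumes J: "finite J" and e: "norm e = 1"
  shows "AE y in PiM J (\<lambda>_. ball_measure).
     (\<forall>b :: 'm \<Rightarrow> 'i::countable. inj b \<longrightarrow> range b \<subseteq> J \<longrightarrow> det (\<chi> j. y (b j)) \<noteq> 0) \<and>
     (\<forall>i\<in>J. e \<bullet> y i \<noteq> 0)"
proof (intro AE_conjI)
  show "AE y in PiM J (\<lambda>_. ball_measure).
     \<forall>b :: 'm \<Rightarrow> 'i. inj b \<longrightarrow> range b \<subseteq> J \<longrightarrow> det (\<chi> j. y (b j)) \<noteq> (0::real)"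
  proof (rule AE_all_countable[THEN iffD2], rule allI)
    fix b :: "'m \<Rightarrow> 'i"
    show "AE y in PiM J (\<lambda>_. ball_measure). inj b \<longrightarrow> range b \<subseteq> J \<longrightarrow> det (\<chi> j. y (b j)) \<noteq> (0::real)"
      using AE_PiM_det_nonzero[OF J, of b] by (cases "inj b \<and> range b \<subseteq> J") auto
  qed
  have "e \<noteq> 0" using e by auto
  show "AE y in PiM J (\<lambda>_. ball_measure). \<forall>i\<in>J. e \<bullet> y i \<noteq> 0"
  proof (rule AE_finite_allI[OF J])
    fix i assume "i \<in> J"
    then show "AE y in PiM J (\<lambda>_. ball_measure). e \<bullet> y i \<noteq> 0"
      using AE_ball_measure_hyperplane[OF \<open>e \<noteq> 0\<close>]
      by (intro AE_PiM_component prob_space_ball_measure)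
  qed
qed

text \<open>Each flipped and normalised point is a nonzero multiple of the original one, so general
  position and the line of the normal are inherited. The normal may thus be formed from the raw
  points, while the sides are still tested at the points of the halfsphere.\<close>

lemma facet_index_generic:
  fixes e :: "real ^ 'm" and y :: "'i \<Rightarrow> real ^ 'm"
  assumes J: "finite J" "CARD('m) \<le> card J" and d: "CARD('m) = d + 1" and I: "I \<subseteq> J"
    and e: "norm e = 1"
    and gp: "\<And>b :: 'm \<Rightarrow> 'i. inj b \<Longrightarrow> range b \<subseteq> J \<Longrightarrow> det (\<chi> j. y (b j)) \<noteq> 0"
    and ey: "\<And>i. i \<in> J \<Longrightarrow> e \<bullet> y i \<noteq> 0"
  shows "card I \<noteq> d \<Longrightarrow> \<not> facet_index d J (\<lambda>i. half_sgn e (y i)) I"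
    and "card I = d \<Longrightarrow> bij_betw b (UNIV - {k}) I \<Longrightarrow> facet_index d J (\<lambda>i. half_sgn e (y i)) I \<longleftrightarrow>
      (\<forall>j\<in>J - I. normal_vec k b y \<bullet> half_sgn e (y j) < 0) \<or>
      (\<forall>j\<in>J - I. 0 < normal_vec k b y \<bullet> half_sgn e (y j))"
proof -
  let ?x = "\<lambda>i. half_sgn e (y i)"
  \<comment> \<open>The scalar that takes \<open>y i\<close> to its image under
    \<open>half_sgn e\<close>.\<close>
  define c where "c i = (if 0 \<le> y i \<bullet> e then 1 else - 1) / norm (y i)" for i
  have y0: "y i \<noteq> 0" if "i \<in> J" for i using ey[OF that] by auto
  have c0: "c i \<noteq> 0" if "i \<in> J" for i using y0[OF that] by (auto simp: c_def)
  have xc: "?x i = c i *\<^sub>R y i" if "i \<in> J" for i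
    using y0[OF that] by (auto simp: half_sgn_def c_def sgn_div_norm divide_inverse)
  have pos: "0 < e \<bullet> ?x i" if "i \<in> J" for i
    using y0[OF that] ey[OF that] unfolding xc[OF that]
    by (auto simp: c_def inner_commute zero_less_mult_iff zero_less_divide_iff mult_less_0_iff divide_less_0_iff)
  have pt: "supporting_index J ?x {}"
    unfolding supporting_index_def using pos by (intro exI[of _ "- e"]) auto
  have gpx: "det (\<chi> j. ?x (b j)) \<noteq> 0" if b: "inj b" "range b \<subseteq> J" for b :: "'m \<Rightarrow> 'i"
  proof -
    have bJ: "b j \<in> J" for j using b by blast
    have "(\<chi> j. ?x (b j)) = (\<chi> j. c (b j) *\<^sub>R y (b j))" using xc[OF bJ] by (simp add: vec_eq_iff)
    then show ?thesis using gp[OF b] c0[OF bJ] by (simp add: det_scale_rows)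
  qed
  have dim: "dim (?x ` I) = d \<longleftrightarrow> card I = d"
    by (rule dim_index_set[OF J d I gpx])
  show "\<not> facet_index d J ?x I" if "card I \<noteq> d"
    using dim that by (simp add: facet_index_def)
  show "facet_index d J ?x I \<longleftrightarrow>
      (\<forall>j\<in>J - I. normal_vec k b y \<bullet> ?x j < 0) \<or> (\<forall>j\<in>J - I. 0 < normal_vec k b y \<bullet> ?x j)"
    if cI: "card I = d" and b: "bij_betw b (UNIV - {k}) I"
  proof -
    have bJ: "b j \<in> J" if "j \<noteq> k" for j using b that I unfolding bij_betw_def by blast
    have "normal_vec k b ?x = normal_vec k b (\<lambda>i. c i *\<^sub>R y i)"
      using xc bJ by (intro normal_vec_cong) auto
    also have "\<dots> = (\<Prod>j\<in>UNIV - {k}. c (b j)) *\<^sub>R normal_vec k b y" by (rule normal_vec_scale)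
    finally obtain t where t: "t \<noteq> 0" "normal_vec k b ?x = t *\<^sub>R normal_vec k b y"
      using c0 bJ by (metis (no_types, lifting) DiffE finite insertCI prod_zero_iff)
    have "facet_index d J ?x I \<longleftrightarrow> supporting_index J ?x I"
      using pt dim cI by (simp add: facet_index_def)
    also have "\<dots> \<longleftrightarrow> (\<forall>j\<in>J - I. normal_vec k b ?x \<bullet> ?x j < 0) \<or> (\<forall>j\<in>J - I. 0 < normal_vec k b ?x \<bullet> ?x j)"
      by (rule supporting_index_generic[OF J d I cI gpx b])
    also have "\<dots> \<longleftrightarrow> (\<forall>j\<in>J - I. normal_vec k b y \<bullet> ?x j < 0) \<or> (\<forall>j\<in>J - I. 0 < normal_vec k b y \<bullet> ?x j)"
    proof (cases "0 < t")
      case True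
      then show ?thesis unfolding t(2) by (simp add: mult_less_0_iff zero_less_mult_iff)
    next
      case False
      then have "t < 0" using t(1) by simp
      then show ?thesis unfolding t(2) by (auto simp: mult_less_0_iff zero_less_mult_iff)
    qed
    finally show ?thesis .
  qed
qed

section \<open>From the ball model to the given random points\<close>

lemma measurable_halfsphere_uniform_ident: "(\<lambda>x. x) \<in> halfsphere_uniform e \<rightarrow>\<^sub>M borel"
  by (subst measurable_cong_sets[OF sets_halfsphere_uniform refl])
    (intro measurable_restrict_space1 measurable_ident_sets refl)

lemma borel_measurable_PiM_halfsphere_component:
  assumes "i \<in> J"
  shows "(\<lambda>x. x i) \<in> borel_measurable (PiM J (\<lambda>_. halfsphere_uniform e))"
  using measurable_compose[OF measurable_component_singleton[OF assms, of "\<lambda>_. halfsphere_uniform e"]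
      measurable_halfsphere_uniform_ident] .

text \<open>The product of halfsphere measures is pulled back along \<open>half_sgn e\<close> in
  every coordinate. Index sets of other cardinality than \<open>q + 1\<close> are facets only on a
  null set; for the rest the event agrees almost everywhere with the one from
  \<open>emeasure_supporting_event\<close>.\<close>

lemma measure_facet_index:
  fixes e :: "real ^ 'm" and J :: "'i::countable set"
  assumes J: "finite J" "CARD('m) \<le> card J" and I: "I \<subseteq> J"
    and e: "norm e = 1" and dim: "CARD('m) = q + 2"
  shows "measure (PiM J (\<lambda>_. halfsphere_uniform e))
      {x \<in> space (PiM J (\<lambda>_. halfsphere_uniform e)). facet_index (q + 1) J x I} =
    (if card I = q + 1 then 2 * omega (q + 1) / omega (q + 2) *
        integral {0..pi} (\<lambda>s. (1 - s / pi) ^ (card J - (q + 1)) * sin s ^ q) else 0)"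
proof -
  let ?L = "\<lambda>_::'i. ball_measure :: (real ^ 'm) measure"
  let ?H = "\<lambda>_::'i. halfsphere_uniform e"
  let ?d = "q + 1"
  let ?S = "\<lambda>y i. half_sgn e (y i)"
  have d: "CARD('m) = ?d + 1" "DIM(real ^ 'm) = ?d + 1" using dim by simp_all
  have hm: "half_sgn e \<in> ball_measure \<rightarrow>\<^sub>M halfsphere_uniform e"
    by (rule half_sgn_measurable_halfsphere[OF e])
  have Hp: "prob_space (halfsphere_uniform e)"
    by (subst halfsphere_uniform_eq_distr[OF e]) (rule prob_space.prob_space_distr[OF prob_space_ball_measure hm])
  have P: "PiM J ?H = distr (PiM J ?L) (PiM J ?H) (compose J (half_sgn e))"
  proof -
    have "distr (PiM J ?L) (PiM J ?H) (compose J (half_sgn e))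
        = PiM J (\<lambda>i. distr ball_measure (halfsphere_uniform e) (half_sgn e))"
      by (rule distr_PiM_finite_prob_space'[OF J(1) prob_space_ball_measure Hp hm])
    then show ?thesis by (simp add: halfsphere_uniform_eq_distr[OF e, symmetric])
  qed
  have cm: "compose J (half_sgn e) \<in> PiM J ?L \<rightarrow>\<^sub>M PiM J ?H"
    unfolding compose_def using hm
    by (intro measurable_restrict measurable_compose[OF measurable_component_singleton])
  have Am: "{x \<in> space (PiM J ?H). facet_index ?d J x I} \<in> sets (PiM J ?H)"
    by (rule sets_facet_index[OF J(1) I d(2), where X = "\<lambda>i x. x i"])
      (rule borel_measurable_PiM_halfsphere_component)
  have Bm: "{y \<in> space (PiM J ?L). facet_index ?d J (?S y) I} \<in> sets (PiM J ?L)"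
    by (intro sets_facet_index[OF J(1) I d(2)]
        measurable_compose[OF borel_measurable_PiM_ball_component half_sgn_measurable])
  have "measure (PiM J ?H) {x \<in> space (PiM J ?H). facet_index ?d J x I}
      = measure (PiM J ?L) (compose J (half_sgn e) -` {x \<in> space (PiM J ?H). facet_index ?d J x I} \<inter> space (PiM J ?L))"
    by (subst P, rule measure_distr[OF cm Am])
  also have "compose J (half_sgn e) -` {x \<in> space (PiM J ?H). facet_index ?d J x I} \<inter> space (PiM J ?L)
      = {y \<in> space (PiM J ?L). facet_index ?d J (?S y) I}"
  proof -
    have "facet_index ?d J (compose J (half_sgn e) y) I \<longleftrightarrow> facet_index ?d J (?S y) I" for y
      by (rule facet_index_cong[OF I]) (simp add: compose_def)
    then show ?thesis using measurable_space[OF cm] by auto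
  qed
  also have "measure (PiM J ?L) {y \<in> space (PiM J ?L). facet_index ?d J (?S y) I} =
    (if card I = q + 1 then 2 * omega (q + 1) / omega (q + 2) *
        integral {0..pi} (\<lambda>s. (1 - s / pi) ^ (card J - (q + 1)) * sin s ^ q) else 0)"
  proof (cases "card I = ?d")
    case False
    have "AE y in PiM J ?L. \<not> facet_index ?d J (?S y) I"
      using AE_PiM_generic[OF J(1) e]
    proof eventually_elim
      case (elim y)
      then show ?case using facet_index_generic(1)[OF J d(1) I e, of y] False by blast
    qed
    then have "{y \<in> space (PiM J ?L). facet_index ?d J (?S y) I} \<in> null_sets (PiM J ?L)"
      using Bm by (subst (asm) AE_iff_null) auto
    then show ?thesis using False by (auto simp: measure_def)
  next
    case True
    \<comment> \<open>An arbitrary matrix index serves as the free row; the remaining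
      \<open>q + 1\<close> indices enumerate \<open>I\<close>.\<close>
    obtain k :: 'm where True by blast
    have "finite I" using I J(1) by (rule finite_subset)
    then obtain b where b: "bij_betw b (UNIV - {k}) I"
      using finite_same_card_bij[of "UNIV - {k}" I] True dim by auto
    let ?c = "2 * omega (q + 1) / omega (q + 2) *
        integral {0..pi} (\<lambda>s. (1 - s / pi) ^ (card J - (q + 1)) * sin s ^ q)"
    let ?E = "{y \<in> space (PiM J ?L). (\<forall>j\<in>J - I. normal_vec k b y \<bullet> half_sgn e (y j) < 0) \<or>
      (\<forall>j\<in>J - I. 0 < normal_vec k b y \<bullet> half_sgn e (y j))}"
    have E: "emeasure (PiM J ?L) ?E = ennreal ?c"
      by (rule emeasure_supporting_event[OF J I True b e dim])
    have ae: "AE y in PiM J ?L. facet_index ?d J (?S y) I \<longleftrightarrow>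
        (\<forall>j\<in>J - I. normal_vec k b y \<bullet> half_sgn e (y j) < 0) \<or>
        (\<forall>j\<in>J - I. 0 < normal_vec k b y \<bullet> half_sgn e (y j))"
      using AE_PiM_generic[OF J(1) e]
    proof eventually_elim
      case (elim y)
      show ?case
        by (rule facet_index_generic(2)[OF J d(1) I e _ _ True b]) (use elim in blast)+
    qed
    have Em: "?E \<in> sets (PiM J ?L)"
      by (rule sets_supporting_event[OF J(1) I b])
    have "emeasure (PiM J ?L) {y \<in> space (PiM J ?L). facet_index ?d J (?S y) I} = emeasure (PiM J ?L) ?E"
      using ae by (intro emeasure_eq_AE Bm Em) (auto elim!: eventually_mono)
    moreover have "0 \<le> ?c"
    proof -
      have "0 \<le> integral {0..pi} (\<lambda>s. (1 - s / pi) ^ (card J - (q + 1)) * sin s ^ q)"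
        by (intro Henstock_Kurzweil_Integration.integral_nonneg integrable_continuous_real continuous_intros)
          (auto intro!: mult_nonneg_nonneg zero_le_power sin_ge_zero simp: field_simps)
      then show ?thesis using omega_pos[of "q + 1"] omega_pos[of "q + 2"] by simp
    qed
    ultimately show ?thesis using True by (simp add: E measure_def)
  qed
  finally show ?thesis .
qed

lemma iid_halfsphere_measurable:
  assumes iid: "iid_halfsphere e n M X" and i: "i \<in> {1..n}"
  shows "X i \<in> M \<rightarrow>\<^sub>M halfsphere_uniform e"
proof -
  interpret prob_space M using iid by (simp add: iid_halfsphere_def)
  show ?thesis using iid i unfolding iid_halfsphere_def indep_vars_def by blast
qed

text \<open>Linearity of expectation over all subsets \<open>I\<close> of the sample. Only the
  subsets of size \<open>q + 1\<close> contribute, all with the same probability, whence the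
  binomial coefficient.\<close>

lemma expectation_facets:
  fixes e :: "real ^ 'm"
  assumes iid: "iid_halfsphere e n M X" and n: "CARD('m) \<le> n"
    and e: "norm e = 1" and dim: "CARD('m) = q + 2"
  shows "prob_space.expectation M (\<lambda>w. real (f_number q (random_polytope n X w))) =
    real (n choose (q + 1)) * (2 * omega (q + 1) / omega (q + 2) *
        integral {0..pi} (\<lambda>s. (1 - s / pi) ^ (n - (q + 1)) * sin s ^ q))"
proof -
  interpret prob_space M using iid by (simp add: iid_halfsphere_def)
  let ?J = "{1..n}"
  let ?H = "\<lambda>_::nat. halfsphere_uniform e"
  let ?d = "q + 1"
  let ?c = "2 * omega (q + 1) / omega (q + 2) *
        integral {0..pi} (\<lambda>s. (1 - s / pi) ^ (n - (q + 1)) * sin s ^ q)"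
  have d: "DIM(real ^ 'm) = ?d + 1" using dim by simp
  have J: "finite ?J" "CARD('m) \<le> card ?J" "?J \<noteq> {}" using n dim by auto
  note Xm = iid_halfsphere_measurable[OF iid]
  have Xb: "X i \<in> borel_measurable M" if "i \<in> ?J" for i
    using measurable_compose[OF Xm[OF that] measurable_halfsphere_uniform_ident] by simp
  have X0: "X i w \<noteq> 0" if "i \<in> ?J" "w \<in> space M" for i w
  proof -
    have "X i w \<in> halfsphere e"
      using measurable_space[OF Xm[OF that(1)] that(2)] by (simp add: space_halfsphere_uniform)
    then show ?thesis by (auto simp: halfsphere_def)
  qed
  define A where "A I = {w \<in> space M. facet_index ?d ?J (\<lambda>i. X i w) I}" for I
  have Am: "A I \<in> events" if "I \<subseteq> ?J" for I
    unfolding A_def by (rule sets_facet_index[OF J(1) that d Xb])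
  \<comment> \<open>An identity at every sample point, not merely almost everywhere, so that the
    facet count is itself a random variable on \<open>M\<close>.\<close>
  have count: "real (f_number q (random_polytope n X w)) = (\<Sum>I\<in>Pow ?J. indicator (A I) w)"
    if w: "w \<in> space M" for w
  proof -
    let ?C = "convex_cone hull ((\<lambda>i. X i w) ` ?J)"
    have "f_number q (random_polytope n X w) = card {I. I \<subseteq> ?J \<and> ?C \<inter> uminus ` ?C = {0} \<and>
        supporting_index ?J (\<lambda>i. X i w) I \<and> dim ((\<lambda>i. X i w) ` I) = ?d}"
      unfolding random_polytope_def using f_number_sph_hull[OF J(1), of ?d "\<lambda>i. X i w"] by simp
    also have "{I. I \<subseteq> ?J \<and> ?C \<inter> uminus ` ?C = {0} \<and>
        supporting_index ?J (\<lambda>i. X i w) I \<and> dim ((\<lambda>i. X i w) ` I) = ?d} = {I \<in> Pow ?J. w \<in> A I}"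
      using pointed_iff_supporting_index_empty[OF J(1), of "\<lambda>i. X i w"] X0 w
      by (auto simp: A_def facet_index_def)
    finally show ?thesis
      by (simp add: indicator_def sum.If_cases card_eq_sum[symmetric] Int_def)
  qed
  \<comment> \<open>Independence enters only here, as a statement about the joint law; everything
    else concerns the product measure.\<close>
  have joint: "distr M (PiM ?J ?H) (\<lambda>w. \<lambda>i\<in>?J. X i w) = PiM ?J ?H"
  proof -
    have iv: "indep_vars ?H X ?J" using iid by (simp add: iid_halfsphere_def)
    have "distr M (PiM ?J ?H) (\<lambda>w. \<lambda>i\<in>?J. X i w) = PiM ?J (\<lambda>i. distr M (halfsphere_uniform e) (X i))"
      by (rule indep_vars_iff_distr_eq_PiM'[where M' = ?H, THEN iffD1, OF J(3) Xm iv])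
    also have "\<dots> = PiM ?J ?H"
      using iid by (intro PiM_cong) (auto simp: iid_halfsphere_def)
    finally show ?thesis .
  qed
  have prob: "prob (A I) = (if card I = ?d then ?c else 0)" if I: "I \<subseteq> ?J" for I
  proof -
    have gm: "(\<lambda>w. \<lambda>i\<in>?J. X i w) \<in> M \<rightarrow>\<^sub>M PiM ?J ?H"
      by (intro measurable_restrict Xm)
    have Bm: "{x \<in> space (PiM ?J ?H). facet_index ?d ?J x I} \<in> sets (PiM ?J ?H)"
      by (rule sets_facet_index[OF J(1) I d, where X = "\<lambda>i x. x i"])
        (rule borel_measurable_PiM_halfsphere_component)
    have "measure (PiM ?J ?H) {x \<in> space (PiM ?J ?H). facet_index ?d ?J x I}
       = prob ((\<lambda>w. \<lambda>i\<in>?J. X i w) -` {x \<in> space (PiM ?J ?H). facet_index ?d ?J x I} \<inter> space M)"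
      by (subst (1) joint[symmetric], rule measure_distr[OF gm Bm])
    also have "(\<lambda>w. \<lambda>i\<in>?J. X i w) -` {x \<in> space (PiM ?J ?H). facet_index ?d ?J x I} \<inter> space M = A I"
    proof -
      have "facet_index ?d ?J (\<lambda>i\<in>?J. X i w) I \<longleftrightarrow> facet_index ?d ?J (\<lambda>i. X i w) I" for w
        by (rule facet_index_cong[OF I]) simp
      then show ?thesis unfolding A_def using measurable_space[OF gm] by auto
    qed
    finally show ?thesis using measure_facet_index[OF J(1,2) I e dim] by simp
  qed
  have "expectation (\<lambda>w. real (f_number q (random_polytope n X w)))
      = expectation (\<lambda>w. \<Sum>I\<in>Pow ?J. indicator (A I) w)"
    by (rule Bochner_Integration.integral_cong[OF refl count])
  also have "\<dots> = (\<Sum>I\<in>Pow ?J. prob (A I))"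
    using Am by (subst Bochner_Integration.integral_sum) (auto simp: less_top[symmetric])
  also have "\<dots> = (\<Sum>I\<in>Pow ?J. if card I = ?d then ?c else 0)"
    by (rule sum.cong) (auto simp: prob)
  also have "\<dots> = real (card {I. I \<subseteq> ?J \<and> card I = ?d}) * ?c"
    by (simp add: sum.If_cases Int_def)
  also have "card {I. I \<subseteq> ?J \<and> card I = ?d} = n choose ?d"
    using n_subsets[OF J(1), of ?d] by simp
  finally show ?thesis .
qed

theorem theorem3p1:
  fixes d :: nat and e :: "real ^ 'm"
  assumes "2 \<le> d" and "CARD('m) = d + 1" and "e \<in> sphere 0 1"
  shows
    "(\<forall>n (M :: 'b measure) X. d + 1 \<le> n \<longrightarrow> iid_halfsphere e n M X \<longrightarrow>
        prob_space.expectation M (\<lambda>w. real (f_number (d - 1) (random_polytope n X w))) =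
          2 * omega d / omega (d + 1) * real (n choose d) *
          integral {0..pi} (\<lambda>\<alpha>. (1 - \<alpha> / pi) ^ (n - d) * sin \<alpha> ^ (d - 1))) \<and>
     (\<forall>(M :: nat \<Rightarrow> 'b measure) X. (\<forall>n\<ge>d + 1. iid_halfsphere e n (M n) (X n)) \<longrightarrow>
        (\<lambda>n. prob_space.expectation (M n)
               (\<lambda>w. real (f_number (d - 1) (random_polytope n (X n) w))))
          \<longlonglongrightarrow> fact d * kappa d ^ 2 / 2 ^ d)"
proof -
  define q where "q = d - 1"
  have d: "d = q + 1" using assms(1) by (simp add: q_def)
  have dim: "CARD('m) = q + 2" using assms(2) d by simp
  have e: "norm e = 1" using assms(3) by simp
  have main: "prob_space.expectation M (\<lambda>w. real (f_number (d - 1) (random_polytope n X w))) =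
          2 * omega d / omega (d + 1) * real (n choose d) *
          integral {0..pi} (\<lambda>\<alpha>. (1 - \<alpha> / pi) ^ (n - d) * sin \<alpha> ^ (d - 1))"
    if "d + 1 \<le> n" "iid_halfsphere e n M X" for n X and M :: "'b measure"
    using expectation_facets[OF that(2) _ e dim] that(1) dim by (simp add: d)
  show ?thesis
  proof (intro conjI allI impI main)
    fix M :: "nat \<Rightarrow> 'b measure" and X
    assume iid: "\<forall>n\<ge>d + 1. iid_halfsphere e n (M n) (X n)"
    \<comment> \<open>Nothing is known about \<open>M n\<close> and \<open>X n\<close> for small
      \<open>n\<close>; the formula from \<open>n = d + 1\<close> on suffices for a limit.\<close>
    have "\<forall>\<^sub>F n in sequentially. 2 * omega d / omega (d + 1) * real (n choose d) *
          integral {0..pi} (\<lambda>\<alpha>. (1 - \<alpha> / pi) ^ (n - d) * sin \<alpha> ^ (d - 1)) =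
        prob_space.expectation (M n) (\<lambda>w. real (f_number (d - 1) (random_polytope n (X n) w)))"
      using iid by (intro eventually_sequentiallyI[of "d + 1"] main[symmetric]) auto
    then show "(\<lambda>n. prob_space.expectation (M n)
               (\<lambda>w. real (f_number (d - 1) (random_polytope n (X n) w))))
          \<longlonglongrightarrow> fact d * kappa d ^ 2 / 2 ^ d"
      using tendsto_expected_facets[of d] assms(1) by (simp add: tendsto_cong)
  qed
qed

end
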